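(* Let $Q\in C^r([0,b],\mathcal M_2)$ for some $r\in\mathbb N_0=\{0,1,2,\dots\}$ and let $K$ be the integral kernel of the transmutation operator. For every $N>r$ let the coefficients $\{a_n,b_n,c_n,d_n\}_{n=0}^N\subset\mathbb C$ be obtained as the least squares solution of $$\min_{\{a_n,b_n,c_n,d_n\}_{n=0}^N\subset\mathbb C}\Bigl\|\frac12Q(x)+\sum_{n=0}^N\mathcal N_n(x)\begin{pmatrix}a_n&b_n\\ c_n&d_n\end{pmatrix}\Bigr\|^2_{L_2(0,b)}$$ (i.e. they are a minimizer), and define the approximate kernel $$K_N(x,t)=\sum_{n=0}^N\bigl(a_n\mathcal O_n^1(x,t)+b_n\mathcal O_n^2(x,t)+c_n\mathcal O_n^3(x,t)+d_n\mathcal O_n^4(x,t)\bigr).$$ Then there is a constant $C$, independent of $x$ and $N$, such that for every $x\in[0,b]$ and every $N>r$ $$\|K(x,\cdot)-K_N(x,\cdot)\|_{L_2(-x,x)}<\frac{2C}{N^r}.$$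
   Context: $b>0$; $\mathcal M_2$ is the space of complex $2\times2$ matrices with Frobenius norm $|A|=(\sum|a_{ij}|^2)^{1/2}$; the $L_2(\alpha,\beta)$-norm of a matrix function $F$ is $(\int_\alpha^\beta|F|^2)^{1/2}$; $B=\begin{pmatrix}0&1\\ -1&0\end{pmatrix}$, $Q(x)=\begin{pmatrix}p(x)&q(x)\\ q(x)&-p(x)\end{pmatrix}$ with complex-valued $p,q$; $\mathcal P^{\pm}[A]=\frac12(A\pm BAB)$; $\Omega^+=\{(x,t):0\le x\le b,\ |t|\le x\}$. Integral kernel: $K$ is the kernel of the transmutation operator $TY(x)=Y(x)+\int_{-x}^xK(x,t)Y(t)\,dt$ relating $B\frac d{dx}$ and $B\frac d{dx}+Q$, i.e. the solution on $\Omega^+$ of $BK_x+K_tB=-Q(x)K$, $BK(x,x)-K(x,x)B=-Q(x)$, $BK(x,-x)+K(x,-x)B=0$. For $Q$ merely continuous this is understood in the mild sense: $H(\xi,\eta)=K(\xi+\eta,\xi-\eta)$ is the continuous solution on $\{\xi,\eta\ge0,\ \xi+\eta\le b\}$ of $H(\xi,\eta)=\frac12BQ(\xi)+\int_0^\xi BQ(u+\eta)\mathcal P^+[H](u,\eta)du+\int_0^\eta BQ(\xi+v)\mathcal P^-[H](\xi,v)dv$. Formal powers: $(f,g)^T$ is a complex-valued absolutely continuous solution of $g'+pf+qg=0$, $-f'+qf-pg=0$ on $[0,b]$, with $f,g$ non-vanishing on $[0,b]$ and $f(0)g(0)=1$. Put $X^{(0)}(x)=-\int_0^x\frac{p}{f^2}ds$,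 $Y^{(0)}(x)=1+\int_0^x\frac{p}{g^2}ds$, and for $n\ge0$ $Z^{(n)}(x)=\int_0^x(f^2X^{(n)}+g^2Y^{(n)})ds$, $X^{(n+1)}(x)=-(n+1)\int_0^x\bigl(\frac{p}{f^2}Z^{(n)}+\frac gfY^{(n)}\bigr)ds$, $Y^{(n+1)}(x)=(n+1)\int_0^x\bigl(\frac{p}{g^2}Z^{(n)}+\frac fgX^{(n)}\bigr)ds$. The functions $\widetilde X^{(n)},\widetilde Y^{(n)},\widetilde Z^{(n)}$ are defined by the same recurrences starting with $\widetilde X^{(0)}(x)=1+\int_0^x\frac{p}{f^2}ds$, $\widetilde Y^{(0)}(x)=-\int_0^x\frac{p}{g^2}ds$. Define $\Phi_k=(-1)^{(k+1)/2}f(0)(fX^{(k)},gY^{(k)})^T$ for $k$ odd, $\Phi_k=(-1)^{k/2}g(0)(f\widetilde X^{(k)},g\widetilde Y^{(k)})^T$ for $k$ even; $\Psi_k=(-1)^{(k-1)/2}g(0)(f\widetilde X^{(k)},g\widetilde Y^{(k)})^T$ for $k$ odd, $\Psi_k=(-1)^{k/2}f(0)(fX^{(k)},gY^{(k)})^T$ for $k$ even. Generalized wave matrices: for $m\ge0$ (empty sums are $0$) $\mathcal U_{2m-1}(x,t)=\sum_{\text{even }k=0}^m\binom mk\Phi_{m-k}(x)t^k$, $\ \mathcal U_{2m}(x,t)=\sum_{\text{odd }k=1}^m\binom mk\Phi_{m-k}(x)t^k$, $\mathcal V_{2m-1}(x,t)=\sum_{\text{even }k=0}^m\binom mk\Psi_{m-k}(x)t^k$,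 $\ \mathcal V_{2m}(x,t)=\sum_{\text{odd }k=1}^m\binom mk\Psi_{m-k}(x)t^k$, and (matrices given by their columns) $\mathcal O_m^1=[\,\mathcal U_{2m-1}\ \ -\mathcal V_{2m}\,]$, $\mathcal O_m^2=[\,\mathcal V_{2m}\ \ \mathcal U_{2m-1}\,]$, $\mathcal O_m^3=[\,\mathcal V_{2m-1}\ \ \mathcal U_{2m}\,]$, $\mathcal O_m^4=[\,-\mathcal U_{2m}\ \ \mathcal V_{2m-1}\,]$. Finally $\mathcal N_n(x)=[\,-\mathcal V_{2n}(x,x)+B\,\mathcal U_{2n-1}(x,x)\ \ \ \mathcal U_{2n}(x,x)+B\,\mathcal V_{2n-1}(x,x)\,]$. *)

theory Defs
  imports "HOL-Analysis.Analysis"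
begin

type_synonym cvec2 = "complex ^ 2"

text \<open>The library norm on this type is the Frobenius norm.\<close>
type_synonym cmat2 = "complex ^ 2 ^ 2"

definition cscale :: "complex \<Rightarrow> cmat2 \<Rightarrow> cmat2" where
  "cscale c A = (\<chi> i j. c * A $ i $ j)"

text \<open>The matrix with columns u and v.\<close>
definition of_columns :: "cvec2 \<Rightarrow> cvec2 \<Rightarrow> cmat2" where
  "of_columns u v = transpose (vector [u, v])"

definition L2norm :: "real \<Rightarrow> real \<Rightarrow> (real \<Rightarrow> cmat2) \<Rightarrow> real" where
  "L2norm \<alpha> \<beta> F = sqrt (integral {\<alpha>..\<beta>} (\<lambda>x. (norm (F x))\<^sup>2))"

text \<open>The class C^r on S; \<open>D k\<close> is the k-th derivative, one-sided at boundary points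
  of an interval S.\<close>
definition C_class_on :: "nat \<Rightarrow> real set \<Rightarrow> (real \<Rightarrow> 'a::real_normed_vector) \<Rightarrow> bool" where
  "C_class_on r S F \<longleftrightarrow>
     (\<exists>D. (\<forall>x\<in>S. D 0 x = F x) \<and>
          (\<forall>k<r. \<forall>x\<in>S. (D k has_vector_derivative D (Suc k) x) (at x within S)) \<and>
          (\<forall>k\<le>r. continuous_on S (D k)))"

text \<open>Absolute continuity on [\<alpha>, \<beta>]. The set d ranges over the finite families of
  non-overlapping compact subintervals [s, t], with s = Inf k and t = Sup k.\<close>
definition abs_continuous_on_interval ::
    "real \<Rightarrow> real \<Rightarrow> (real \<Rightarrow> 'a::real_normed_vector) \<Rightarrow> bool" where
  "abs_continuous_on_interval \<alpha> \<beta> F \<longleftrightarrow>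
     (\<forall>\<epsilon>>0. \<exists>\<delta>>0. \<forall>d. d division_of (\<Union>d) \<and> \<Union>d \<subseteq> {\<alpha>..\<beta>} \<and> (\<Sum>k\<in>d. Sup k - Inf k) < \<delta>
        \<longrightarrow> (\<Sum>k\<in>d. norm (F (Sup k) - F (Inf k))) < \<epsilon>)"

definition Bmat :: cmat2 where
  "Bmat = vector [vector [0, 1], vector [- 1, 0]]"

definition Qmat :: "(real \<Rightarrow> complex) \<Rightarrow> (real \<Rightarrow> complex) \<Rightarrow> real \<Rightarrow> cmat2" where
  "Qmat p q x = vector [vector [p x, q x], vector [q x, - p x]]"

definition Pplus :: "cmat2 \<Rightarrow> cmat2" where
  "Pplus A = (1/2) *\<^sub>R (A + Bmat ** A ** Bmat)"

definition Pminus :: "cmat2 \<Rightarrow> cmat2" where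
  "Pminus A = (1/2) *\<^sub>R (A - Bmat ** A ** Bmat)"

text \<open>K is the mild solution on \<open>0 \<le> x \<le> b\<close>, \<open>\<bar>t\<bar> \<le> x\<close> of the Goursat problem
  \<open>B K_x + K_t B = - Q K\<close>, \<open>B K(x,x) - K(x,x) B = - Q(x)\<close>, \<open>B K(x,-x) + K(x,-x) B = 0\<close>,
  in the characteristic coordinates \<open>x = \<xi> + \<eta>\<close>, \<open>t = \<xi> - \<eta>\<close>.\<close>
definition transmutation_kernel ::
    "real \<Rightarrow> (real \<Rightarrow> complex) \<Rightarrow> (real \<Rightarrow> complex) \<Rightarrow> (real \<Rightarrow> real \<Rightarrow> cmat2) \<Rightarrow> bool" where
  "transmutation_kernel b p q K \<longleftrightarrow>
     (let H = (\<lambda>\<xi> \<eta>. K (\<xi> + \<eta>) (\<xi> - \<eta>)) in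
        continuous_on {(\<xi>, \<eta>). 0 \<le> \<xi> \<and> 0 \<le> \<eta> \<and> \<xi> + \<eta> \<le> b} (\<lambda>(\<xi>, \<eta>). H \<xi> \<eta>) \<and>
        (\<forall>\<xi> \<eta>. 0 \<le> \<xi> \<and> 0 \<le> \<eta> \<and> \<xi> + \<eta> \<le> b \<longrightarrow>
           H \<xi> \<eta> = (1/2) *\<^sub>R (Bmat ** Qmat p q \<xi>)
             + integral {0..\<xi>} (\<lambda>u. Bmat ** Qmat p q (u + \<eta>) ** Pplus (H u \<eta>))
             + integral {0..\<eta>} (\<lambda>v. Bmat ** Qmat p q (\<xi> + v) ** Pminus (H \<xi> v))))"

definition nonvanishing_solution ::
    "real \<Rightarrow> (real \<Rightarrow> complex) \<Rightarrow> (real \<Rightarrow> complex) \<Rightarrow> (real \<Rightarrow> complex) \<Rightarrow> (real \<Rightarrow> complex) \<Rightarrow> bool" where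
  "nonvanishing_solution b p q f g \<longleftrightarrow>
     abs_continuous_on_interval 0 b f \<and> abs_continuous_on_interval 0 b g \<and>
     (AE x in lebesgue. x \<in> {0..b} \<longrightarrow>
        (\<exists>f' g'. (f has_vector_derivative f') (at x within {0..b}) \<and>
                 (g has_vector_derivative g') (at x within {0..b}) \<and>
                 g' + p x * f x + q x * g x = 0 \<and>
                 - f' + q x * f x - p x * g x = 0)) \<and>
     (\<forall>x\<in>{0..b}. f x \<noteq> 0 \<and> g x \<noteq> 0) \<and>
     f 0 * g 0 = 1"

text \<open>The recurrence for the pair \<open>(X\<^sup>n, Y\<^sup>n)\<close> started from an arbitrary pair;
  Z is the intermediate function \<open>Z\<^sup>n\<close>.\<close>
primrec formal_powers ::
    "(real \<Rightarrow> complex) \<Rightarrow> (real \<Rightarrow> complex) \<Rightarrow> (real \<Rightarrow> complex) \<Rightarrow>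
     (real \<Rightarrow> complex) \<times> (real \<Rightarrow> complex) \<Rightarrow> nat \<Rightarrow> (real \<Rightarrow> complex) \<times> (real \<Rightarrow> complex)" where
  "formal_powers p f g XY0 0 = XY0"
| "formal_powers p f g XY0 (Suc n) =
     (let X = fst (formal_powers p f g XY0 n);
          Y = snd (formal_powers p f g XY0 n);
          Z = (\<lambda>x. integral {0..x} (\<lambda>s. (f s)\<^sup>2 * X s + (g s)\<^sup>2 * Y s))
      in (\<lambda>x. - of_nat (Suc n) * integral {0..x} (\<lambda>s. p s / (f s)\<^sup>2 * Z s + g s / f s * Y s),
          \<lambda>x. of_nat (Suc n) * integral {0..x} (\<lambda>s. p s / (g s)\<^sup>2 * Z s + f s / g s * X s)))"

definition XYpow where
  "XYpow p f g = formal_powers p f g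
     (\<lambda>x. - integral {0..x} (\<lambda>s. p s / (f s)\<^sup>2),
      \<lambda>x. 1 + integral {0..x} (\<lambda>s. p s / (g s)\<^sup>2))"

definition XYpow_tilde where
  "XYpow_tilde p f g = formal_powers p f g
     (\<lambda>x. 1 + integral {0..x} (\<lambda>s. p s / (f s)\<^sup>2),
      \<lambda>x. - integral {0..x} (\<lambda>s. p s / (g s)\<^sup>2))"

definition fgvec ::
    "(real \<Rightarrow> complex) \<Rightarrow> (real \<Rightarrow> complex) \<Rightarrow> (real \<Rightarrow> complex) \<times> (real \<Rightarrow> complex) \<Rightarrow> real \<Rightarrow> cvec2" where
  "fgvec f g XY x = vector [f x * fst XY x, g x * snd XY x]"

definition Phi ::
    "(real \<Rightarrow> complex) \<Rightarrow> (real \<Rightarrow> complex) \<Rightarrow> (real \<Rightarrow> complex) \<Rightarrow> nat \<Rightarrow> real \<Rightarrow> cvec2" where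
  "Phi p f g k x =
     (if odd k then ((- 1) ^ ((k + 1) div 2) * f 0) *s fgvec f g (XYpow p f g k) x
      else ((- 1) ^ (k div 2) * g 0) *s fgvec f g (XYpow_tilde p f g k) x)"

definition Psi ::
    "(real \<Rightarrow> complex) \<Rightarrow> (real \<Rightarrow> complex) \<Rightarrow> (real \<Rightarrow> complex) \<Rightarrow> nat \<Rightarrow> real \<Rightarrow> cvec2" where
  "Psi p f g k x =
     (if odd k then ((- 1) ^ ((k - 1) div 2) * g 0) *s fgvec f g (XYpow_tilde p f g k) x
      else ((- 1) ^ (k div 2) * f 0) *s fgvec f g (XYpow p f g k) x)"

text \<open>With \<open>\<Theta> = \<Phi>\<close> these are \<open>U_{2m-1}\<close> and \<open>U_{2m}\<close>; with \<open>\<Theta> = \<Psi>\<close> they are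
  \<open>V_{2m-1}\<close> and \<open>V_{2m}\<close>. Splitting by the parity of the index avoids the
  index -1 at m = 0.\<close>
definition wave_even_sum :: "(nat \<Rightarrow> real \<Rightarrow> cvec2) \<Rightarrow> nat \<Rightarrow> real \<Rightarrow> real \<Rightarrow> cvec2" where
  "wave_even_sum \<Theta> m x t =
     (\<Sum>k\<in>{k. k \<le> m \<and> even k}. (of_nat (m choose k) * of_real t ^ k) *s \<Theta> (m - k) x)"

definition wave_odd_sum :: "(nat \<Rightarrow> real \<Rightarrow> cvec2) \<Rightarrow> nat \<Rightarrow> real \<Rightarrow> real \<Rightarrow> cvec2" where
  "wave_odd_sum \<Theta> m x t =
     (\<Sum>k\<in>{k. k \<le> m \<and> odd k}. (of_nat (m choose k) * of_real t ^ k) *s \<Theta> (m - k) x)"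

definition U_2m_minus_1 where "U_2m_minus_1 p f g = wave_even_sum (Phi p f g)"
definition U_2m where "U_2m p f g = wave_odd_sum (Phi p f g)"
definition V_2m_minus_1 where "V_2m_minus_1 p f g = wave_even_sum (Psi p f g)"
definition V_2m where "V_2m p f g = wave_odd_sum (Psi p f g)"

definition O1 where
  "O1 p f g m x t = of_columns (U_2m_minus_1 p f g m x t) (- V_2m p f g m x t)"
definition O2 where
  "O2 p f g m x t = of_columns (V_2m p f g m x t) (U_2m_minus_1 p f g m x t)"
definition O3 where
  "O3 p f g m x t = of_columns (V_2m_minus_1 p f g m x t) (U_2m p f g m x t)"
definition O4 where
  "O4 p f g m x t = of_columns (- U_2m p f g m x t) (V_2m_minus_1 p f g m x t)"

definition Nmat where
  "Nmat p f g n x = of_columns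
     (- V_2m p f g n x x + Bmat *v U_2m_minus_1 p f g n x x)
     (U_2m p f g n x x + Bmat *v V_2m_minus_1 p f g n x x)"

text \<open>A coefficient family is a quadruple of sequences, of which only the entries with
  index at most N matter.\<close>
definition lsq_objective ::
    "real \<Rightarrow> (real \<Rightarrow> complex) \<Rightarrow> (real \<Rightarrow> complex) \<Rightarrow> (real \<Rightarrow> complex) \<Rightarrow> (real \<Rightarrow> complex) \<Rightarrow> nat \<Rightarrow>
     (nat \<Rightarrow> complex) \<times> (nat \<Rightarrow> complex) \<times> (nat \<Rightarrow> complex) \<times> (nat \<Rightarrow> complex) \<Rightarrow> real" where
  "lsq_objective b p q f g N = (\<lambda>(a, \<beta>, c, d).
     (L2norm 0 b (\<lambda>x. (1/2) *\<^sub>R Qmat p q x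
        + (\<Sum>n\<le>N. Nmat p f g n x ** vector [vector [a n, \<beta> n], vector [c n, d n]])))\<^sup>2)"

definition approx_kernel ::
    "(real \<Rightarrow> complex) \<Rightarrow> (real \<Rightarrow> complex) \<Rightarrow> (real \<Rightarrow> complex) \<Rightarrow> nat \<Rightarrow>
     (nat \<Rightarrow> complex) \<times> (nat \<Rightarrow> complex) \<times> (nat \<Rightarrow> complex) \<times> (nat \<Rightarrow> complex) \<Rightarrow>
     real \<Rightarrow> real \<Rightarrow> cmat2" where
  "approx_kernel p f g N = (\<lambda>(a, \<beta>, c, d) x t.
     (\<Sum>n\<le>N. cscale (a n) (O1 p f g n x t) + cscale (\<beta> n) (O2 p f g n x t)
            + cscale (c n) (O3 p f g n x t) + cscale (d n) (O4 p f g n x t)))"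

end

theory Submission
  imports Defs
begin

text \<open>
Both \<open>K\<close> and every generalized wave polynomial solve \<open>B K_x + K_t B = - Q K\<close>, and such a solution is
stably determined by its Goursat data, the \<open>Pplus\<close> component on \<open>t = x\<close> and the \<open>Pminus\<close> component
on \<open>t = - x\<close>. For the wave polynomial with coefficient matrices \<open>C\<^sub>n\<close> this data is \<open>- B\<close> times the sum of the
\<open>N\<^sub>n C\<^sub>n\<close>, so the residual of the least squares problem is, up to \<open>B\<close>, the Goursat data of the
difference of the kernels, and it remains to approximate the data \<open>(1/2) B Q\<close> at the rate \<open>N\<^sup>-\<^sup>r\<close>.

The data of a wave polynomial is a Volterra perturbation of the matrix polynomial \<open>C(2x)\<close> given by
its Cauchy data on \<open>x = 0\<close>. Differentiation in \<open>t\<close> preserves the equation, acts on \<open>C\<close> as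
differentiation up to a sign on one component, and acts on the data \<open>A\<close> as a first order operator
\<open>A \<mapsto> A\<^sub>1\<close>. Hence an approximation of \<open>A\<^sub>1\<close> of degree \<open>N\<close> lifts to one of \<open>A\<close> of degree \<open>N + 1\<close>, and a
one-step Jackson inequality gains a factor \<open>1 / N\<close>. This can be repeated \<open>r\<close> times.
\<close>

section \<open>The L2 norm and a Volterra inequality\<close>

text \<open>The Volterra perturbation is not confined to [0, b]: the data at x depends on the
  polynomial over [-x, x], which its values on [0, x] do not bound uniformly in the degree. This
  obstructs inverting the map from coefficients to data. Even polynomials remove it: they are dense
  in the continuous functions on [0, b], their norm over [-b, b] is bounded by that over [0, b], and
  on them the perturbation is a contraction in an exponentially weighted norm. The approximants
  themselves have no parity; even polynomials only represent the residual left by an approximation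
  of \<open>A\<^sub>1\<close>.

  This representing polynomial has uncontrolled degree, but its size is comparable to the error for
  \<open>A\<^sub>1\<close>. Its lift is cut back to degree N + 1, so Jackson's inequality is
  required for polynomials only. What the even polynomial misses is made as small as desired by
  density.

  The passage from A to \<open>A\<^sub>1\<close> is not local: A' = BQ F + 2 \<open>tau\<close>
  \<open>A\<^sub>1\<close> involves the traces F that are not prescribed, recovered from F' = BQ A
  and F(0) = A(0).\<close>

lemma integral_Cauchy_Schwarz:
  fixes f g :: "real \<Rightarrow> real"
  assumes f: "continuous_on {\<alpha>..\<beta>} f" and g: "continuous_on {\<alpha>..\<beta>} g"
  shows "(integral {\<alpha>..\<beta>} (\<lambda>x. f x * g x))\<^sup>2 \<le>
    integral {\<alpha>..\<beta>} (\<lambda>x. (f x)\<^sup>2) * integral {\<alpha>..\<beta>} (\<lambda>x. (g x)\<^sup>2)"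
proof -
  define F where "F = integral {\<alpha>..\<beta>} (\<lambda>x. (f x)\<^sup>2)"
  define G where "G = integral {\<alpha>..\<beta>} (\<lambda>x. (g x)\<^sup>2)"
  define H where "H = integral {\<alpha>..\<beta>} (\<lambda>x. f x * g x)"
  have iF: "((\<lambda>x. (f x)\<^sup>2) has_integral F) {\<alpha>..\<beta>}"
    and iG: "((\<lambda>x. (g x)\<^sup>2) has_integral G) {\<alpha>..\<beta>}"
    and iH: "((\<lambda>x. f x * g x) has_integral H) {\<alpha>..\<beta>}"
    unfolding F_def G_def H_def
    by (intro integrable_integral integrable_continuous_real continuous_intros f g)+
  have quad: "0 \<le> F + 2 * t * H + t\<^sup>2 * G" for t
  proof -
    have "((\<lambda>x. (f x)\<^sup>2 + 2 * t * (f x * g x) + t\<^sup>2 * (g x)\<^sup>2) has_integral F + 2 * t * H + t\<^sup>2 * G) {\<alpha>..\<beta>}"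
      by (intro has_integral_add has_integral_mult_right iF iG iH)
    moreover have "(\<lambda>x. (f x)\<^sup>2 + 2 * t * (f x * g x) + t\<^sup>2 * (g x)\<^sup>2) = (\<lambda>x. (f x + t * g x)\<^sup>2)"
      by (auto simp: power2_eq_square algebra_simps)
    ultimately show ?thesis
      by (auto intro: has_integral_nonneg)
  qed
  have G0: "0 \<le> G"
    using iG by (rule has_integral_nonneg) simp
  have "H\<^sup>2 \<le> F * G"
  proof (cases "G = 0")
    case True
    have "H = 0"
    proof (rule ccontr)
      assume "H \<noteq> 0"
      then show False
        \<comment> \<open>At this t the quadratic, affine because G = 0, takes the value -1.\<close>
        using quad[of "- (F + 1) / (2 * H)"] True by (simp add: field_simps)
    qed
    then show ?thesis using True by simp
  next
    case False
    then have "G > 0" using G0 by simp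
    have "0 \<le> (F + 2 * (- H / G) * H + (- H / G)\<^sup>2 * G) * G"
      using quad[of "- H / G"] \<open>G > 0\<close> by simp
    also have "\<dots> = F * G - H\<^sup>2"
      using \<open>G > 0\<close> by (simp add: field_simps power2_eq_square)
    finally show ?thesis by simp
  qed
  then show ?thesis by (simp add: F_def G_def H_def)
qed

lemma L2norm_nonneg: "0 \<le> L2norm \<alpha> \<beta> F"
proof -
  have "0 \<le> integral {\<alpha>..\<beta>} (\<lambda>x. (norm (F x))\<^sup>2)"
    \<comment> \<open>A function that is not integrable has integral 0, so the bound holds for every
      \<open>F\<close>.\<close>
    by (cases "(\<lambda>x. (norm (F x))\<^sup>2) integrable_on {\<alpha>..\<beta>}")
      (auto intro: integral_nonneg simp: not_integrable_integral)
  then show ?thesis by (simp add: L2norm_def)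
qed

lemma L2norm_square:
  "(L2norm \<alpha> \<beta> F)\<^sup>2 = integral {\<alpha>..\<beta>} (\<lambda>x. (norm (F x))\<^sup>2)"
proof -
  have "0 \<le> integral {\<alpha>..\<beta>} (\<lambda>x. (norm (F x))\<^sup>2)"
    by (cases "(\<lambda>x. (norm (F x))\<^sup>2) integrable_on {\<alpha>..\<beta>}")
      (auto intro: integral_nonneg simp: not_integrable_integral)
  then show ?thesis by (simp add: L2norm_def)
qed

lemma integrable_norm_square:
  fixes F :: "real \<Rightarrow> 'a::real_normed_vector"
  assumes "continuous_on {\<alpha>..\<beta>} F"
  shows "(\<lambda>x. (norm (F x))\<^sup>2) integrable_on {\<alpha>..\<beta>}"
  by (intro integrable_continuous_real continuous_intros assms)

lemma L2norm_le:
  assumes F: "continuous_on {\<alpha>..\<beta>} F" and G: "continuous_on {\<alpha>..\<beta>} G" and c: "0 \<le> c"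
    and le: "\<And>x. x \<in> {\<alpha>..\<beta>} \<Longrightarrow> norm (F x) \<le> c * norm (G x)"
  shows "L2norm \<alpha> \<beta> F \<le> c * L2norm \<alpha> \<beta> G"
proof (rule power2_le_imp_le)
  have "integral {\<alpha>..\<beta>} (\<lambda>x. (norm (F x))\<^sup>2) \<le> integral {\<alpha>..\<beta>} (\<lambda>x. c\<^sup>2 * (norm (G x))\<^sup>2)"
  proof (rule integral_le)
    fix x assume "x \<in> {\<alpha>..\<beta>}"
    from power_mono[OF le[OF this], of 2] show "(norm (F x))\<^sup>2 \<le> c\<^sup>2 * (norm (G x))\<^sup>2"
      by (simp add: power_mult_distrib)
  qed (intro integrable_continuous_real continuous_intros F G)+
  then show "(L2norm \<alpha> \<beta> F)\<^sup>2 \<le> (c * L2norm \<alpha> \<beta> G)\<^sup>2"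
    by (simp add: L2norm_square power_mult_distrib)
qed (simp add: c L2norm_nonneg)

lemma L2norm_cong:
  assumes "\<And>x. x \<in> {\<alpha>..\<beta>} \<Longrightarrow> norm (F x) = norm (G x)"
  shows "L2norm \<alpha> \<beta> F = L2norm \<alpha> \<beta> G"
  unfolding L2norm_def by (rule arg_cong[of _ _ sqrt], rule integral_cong) (simp add: assms)

lemma L2norm_le_sup:
  assumes F: "continuous_on {\<alpha>..\<beta>} F" and "\<alpha> \<le> \<beta>"
    and le: "\<And>x. x \<in> {\<alpha>..\<beta>} \<Longrightarrow> norm (F x) \<le> m"
  shows "L2norm \<alpha> \<beta> F \<le> sqrt (\<beta> - \<alpha>) * m"
proof -
  have m: "0 \<le> m" using le[of \<alpha>] \<open>\<alpha> \<le> \<beta>\<close> norm_ge_zero[of "F \<alpha>"] by (simp del: norm_ge_zero)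
  have "integral {\<alpha>..\<beta>} (\<lambda>x. (norm (F x))\<^sup>2) \<le> integral {\<alpha>..\<beta>} (\<lambda>x. m\<^sup>2)"
    by (rule integral_le) (auto intro!: integrable_norm_square F power_mono le)
  then have "(L2norm \<alpha> \<beta> F)\<^sup>2 \<le> (sqrt (\<beta> - \<alpha>) * m)\<^sup>2"
    using \<open>\<alpha> \<le> \<beta>\<close> by (simp add: L2norm_square power_mult_distrib)
  then show ?thesis
    by (rule power2_le_imp_le) (use m \<open>\<alpha> \<le> \<beta>\<close> in simp)
qed

lemma L2norm_triangle:
  assumes F: "continuous_on {\<alpha>..\<beta>} F" and G: "continuous_on {\<alpha>..\<beta>} G"
  shows "L2norm \<alpha> \<beta> (\<lambda>x. F x + G x) \<le> L2norm \<alpha> \<beta> F + L2norm \<alpha> \<beta> G"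
proof (rule power2_le_imp_le)
  let ?I = "integral {\<alpha>..\<beta>}"
  have "(?I (\<lambda>x. norm (F x) * norm (G x)))\<^sup>2 \<le> (L2norm \<alpha> \<beta> F * L2norm \<alpha> \<beta> G)\<^sup>2"
    unfolding power_mult_distrib L2norm_square
    by (intro integral_Cauchy_Schwarz continuous_intros F G)
  then have cs: "?I (\<lambda>x. norm (F x) * norm (G x)) \<le> L2norm \<alpha> \<beta> F * L2norm \<alpha> \<beta> G"
    by (rule power2_le_imp_le) (simp add: L2norm_nonneg)
  have "?I (\<lambda>x. (norm (F x + G x))\<^sup>2)
      \<le> ?I (\<lambda>x. (norm (F x))\<^sup>2 + 2 * (norm (F x) * norm (G x)) + (norm (G x))\<^sup>2)"
  proof (rule integral_le)
    fix x
    have "(norm (F x + G x))\<^sup>2 \<le> (norm (F x) + norm (G x))\<^sup>2"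
      by (intro power_mono norm_triangle_ineq norm_ge_zero)
    then show "(norm (F x + G x))\<^sup>2 \<le> (norm (F x))\<^sup>2 + 2 * (norm (F x) * norm (G x)) + (norm (G x))\<^sup>2"
      by (simp add: power2_eq_square algebra_simps)
  qed (intro integrable_continuous_real continuous_intros F G)+
  also have "\<dots> = (L2norm \<alpha> \<beta> F)\<^sup>2 + 2 * ?I (\<lambda>x. norm (F x) * norm (G x)) + (L2norm \<alpha> \<beta> G)\<^sup>2"
    unfolding L2norm_square
    by (intro integral_unique has_integral_add has_integral_mult_right integrable_integral
        integrable_continuous_real continuous_intros F G)
  also have "\<dots> \<le> (L2norm \<alpha> \<beta> F + L2norm \<alpha> \<beta> G)\<^sup>2"
    using cs by (simp add: power2_eq_square algebra_simps)
  finally show "(L2norm \<alpha> \<beta> (\<lambda>x. F x + G x))\<^sup>2 \<le> (L2norm \<alpha> \<beta> F + L2norm \<alpha> \<beta> G)\<^sup>2"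
    by (simp add: L2norm_square)
qed (simp add: L2norm_nonneg)

text \<open>\<open>L2norm\<close> accepts only matrix functions, so the scalar functions norm G and
  norm H are carried as multiples of a fixed unit matrix \<open>e\<close>.\<close>

lemma L2norm_triangle_le:
  assumes F: "continuous_on {\<alpha>..\<beta>} F" and G: "continuous_on {\<alpha>..\<beta>} G" and H: "continuous_on {\<alpha>..\<beta>} H"
    and le: "\<And>x. x \<in> {\<alpha>..\<beta>} \<Longrightarrow> norm (F x) \<le> norm (G x) + norm (H x)"
  shows "L2norm \<alpha> \<beta> F \<le> L2norm \<alpha> \<beta> G + L2norm \<alpha> \<beta> H"
proof -
  obtain e :: cmat2 where e: "norm e = 1"
    using vector_choose_size[of 1] by auto
  have "L2norm \<alpha> \<beta> F \<le> 1 * L2norm \<alpha> \<beta> (\<lambda>x. norm (G x) *\<^sub>R e + norm (H x) *\<^sub>R e)"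
    using le by (intro L2norm_le continuous_intros F G H) (simp_all add: scaleR_add_left[symmetric] e)
  also have "\<dots> \<le> L2norm \<alpha> \<beta> (\<lambda>x. norm (G x) *\<^sub>R e) + L2norm \<alpha> \<beta> (\<lambda>x. norm (H x) *\<^sub>R e)"
    unfolding mult_1 by (intro L2norm_triangle continuous_intros G H)
  also have "\<dots> = L2norm \<alpha> \<beta> G + L2norm \<alpha> \<beta> H"
    by (simp add: L2norm_def e)
  finally show ?thesis .
qed

lemma integral_norm_le_L2norm:
  assumes F: "continuous_on {\<alpha>..\<beta>} F" and "\<alpha> \<le> \<beta>"
  shows "integral {\<alpha>..\<beta>} (\<lambda>x. norm (F x)) \<le> sqrt (\<beta> - \<alpha>) * L2norm \<alpha> \<beta> F"
proof (rule power2_le_imp_le)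
  have "(integral {\<alpha>..\<beta>} (\<lambda>x. 1 * norm (F x)))\<^sup>2
      \<le> integral {\<alpha>..\<beta>} (\<lambda>x. 1\<^sup>2) * integral {\<alpha>..\<beta>} (\<lambda>x. (norm (F x))\<^sup>2)"
    by (intro integral_Cauchy_Schwarz continuous_intros F)
  then show "(integral {\<alpha>..\<beta>} (\<lambda>x. norm (F x)))\<^sup>2 \<le> (sqrt (\<beta> - \<alpha>) * L2norm \<alpha> \<beta> F)\<^sup>2"
    using \<open>\<alpha> \<le> \<beta>\<close> by (simp add: power_mult_distrib L2norm_square)
qed (simp add: L2norm_nonneg \<open>\<alpha> \<le> \<beta>\<close>)

lemma integral_exp_weight:
  fixes \<kappa> :: real
  assumes "\<kappa> > 0" "c \<le> d"
  shows "((\<lambda>v. W * exp (\<kappa> * (x + v))) has_integral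
    W * (exp (\<kappa> * (x + d)) - exp (\<kappa> * (x + c))) / \<kappa>) {c..d}"
proof -
  have "((\<lambda>v. W * exp (\<kappa> * (x + v))) has_integral
    (W * exp (\<kappa> * (x + d)) / \<kappa> - W * exp (\<kappa> * (x + c)) / \<kappa>)) {c..d}"
    using assms
    by (intro fundamental_theorem_of_calculus)
      (auto intro!: derivative_eq_intros simp flip: has_real_derivative_iff_has_vector_derivative)
  then show ?thesis by (simp add: right_diff_distrib diff_divide_distrib)
qed

text \<open>At a maximum of \<open>G x y / exp (4 M (x + y))\<close> each of the two integrals is at most
  \<open>G x y / (4 M)\<close>.\<close>
lemma Volterra_bound:
  fixes G :: "real \<Rightarrow> real \<Rightarrow> real"
  assumes T: "compact T" and contG: "continuous_on T (\<lambda>(x, y). G x y)"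
    and sum: "\<And>x y. (x, y) \<in> T \<Longrightarrow> 0 \<le> x + y \<and> x + y \<le> b"
    and M: "M > 0" and A: "A \<ge> 0"
    and l: "\<And>x y. (x, y) \<in> T \<Longrightarrow> l x \<le> y" "\<And>x y v. (x, y) \<in> T \<Longrightarrow> v \<in> {l x..y} \<Longrightarrow> (x, v) \<in> T"
    and m: "\<And>x y. (x, y) \<in> T \<Longrightarrow> m y \<le> x" "\<And>x y u. (x, y) \<in> T \<Longrightarrow> u \<in> {m y..x} \<Longrightarrow> (u, y) \<in> T"
    and le: "\<And>x y. (x, y) \<in> T \<Longrightarrow>
      G x y \<le> A + M * integral {l x..y} (\<lambda>v. G x v) + M * integral {m y..x} (\<lambda>u. G u y)"
    and xy: "(x, y) \<in> T"
  shows "G x y \<le> 2 * A * exp (4 * M * b)"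
proof -
  define \<kappa> where "\<kappa> = 4 * M"
  have \<kappa>: "\<kappa> > 0" using M by (simp add: \<kappa>_def)
  have "continuous_on T (\<lambda>z. (\<lambda>(x, y). G x y) z * exp (- \<kappa> * (fst z + snd z)))"
    by (intro continuous_intros contG)
  from continuous_attains_sup[OF T _ this] xy obtain x0 y0 where 0: "(x0, y0) \<in> T"
    and mx: "\<And>x y. (x, y) \<in> T \<Longrightarrow>
      G x y * exp (- \<kappa> * (x + y)) \<le> G x0 y0 * exp (- \<kappa> * (x0 + y0))"
    by fastforce
  define W where "W = G x0 y0 * exp (- \<kappa> * (x0 + y0))"
  have GW: "G x y \<le> W * exp (\<kappa> * (x + y))" if "(x, y) \<in> T" for x y
  proof -
    have "G x y = G x y * exp (- \<kappa> * (x + y)) * exp (\<kappa> * (x + y))"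
      by (simp add: exp_minus)
    also have "\<dots> \<le> W * exp (\<kappa> * (x + y))"
      unfolding W_def by (intro mult_right_mono mx that) simp
    finally show ?thesis .
  qed
  have W2: "W \<le> 2 * A"
  proof (cases "W \<le> 0")
    case False
    have c1: "continuous_on {l x0..y0} (\<lambda>v. G x0 v)"
      by (rule continuous_on_compose2[OF contG, of "{l x0..y0}" "\<lambda>v. (x0, v)", simplified])
        (use l(2)[OF 0] in \<open>auto intro!: continuous_intros\<close>)
    have c2: "continuous_on {m y0..x0} (\<lambda>u. G u y0)"
      by (rule continuous_on_compose2[OF contG, of "{m y0..x0}" "\<lambda>u. (u, y0)", simplified])
        (use m(2)[OF 0] in \<open>auto intro!: continuous_intros\<close>)
    let ?E = "W * exp (\<kappa> * (x0 + y0)) / \<kappa>"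
    have i1: "integral {l x0..y0} (\<lambda>v. G x0 v) \<le> ?E"
    proof -
      have "integral {l x0..y0} (\<lambda>v. G x0 v) \<le> W * (exp (\<kappa> * (x0 + y0)) - exp (\<kappa> * (x0 + l x0))) / \<kappa>"
        using GW l(2)[OF 0]
        by (intro has_integral_le[OF integrable_integral[OF integrable_continuous_real[OF c1]]
            integral_exp_weight[OF \<kappa> l(1)[OF 0]]]) auto
      also have "\<dots> \<le> ?E"
        using False \<kappa> by (intro divide_right_mono mult_left_mono) auto
      finally show ?thesis .
    qed
    have i2: "integral {m y0..x0} (\<lambda>u. G u y0) \<le> ?E"
    proof -
      have "integral {m y0..x0} (\<lambda>u. G u y0) \<le> W * (exp (\<kappa> * (y0 + x0)) - exp (\<kappa> * (y0 + m y0))) / \<kappa>"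
        using GW m(2)[OF 0]
        by (intro has_integral_le[OF integrable_integral[OF integrable_continuous_real[OF c2]]
            integral_exp_weight[OF \<kappa> m(1)[OF 0]]]) (auto simp: add.commute)
      also have "\<dots> \<le> W * exp (\<kappa> * (y0 + x0)) / \<kappa>"
        using False \<kappa> by (intro divide_right_mono mult_left_mono) auto
      finally show ?thesis by (simp add: add.commute)
    qed
    have "W * exp (\<kappa> * (x0 + y0)) = G x0 y0"
      by (simp add: W_def exp_minus)
    also have "\<dots> \<le> A + M * ?E + M * ?E"
      using le[OF 0] i1 i2 M by (smt (verit) mult_left_mono)
    also have "\<dots> = A + W * exp (\<kappa> * (x0 + y0)) / 2"
      using M by (simp add: \<kappa>_def field_simps)
    finally have "W * exp (\<kappa> * (x0 + y0)) \<le> 2 * A" by simp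
    \<comment> \<open>On \<open>T\<close> the exponent is nonnegative, so the weight is at least
      1.\<close>
    moreover have "W * 1 \<le> W * exp (\<kappa> * (x0 + y0))"
      using False sum[OF 0] \<kappa> by (intro mult_left_mono) auto
    ultimately show ?thesis by simp
  qed (use A in auto)
  have "G x y \<le> W * exp (\<kappa> * (x + y))" by (rule GW[OF xy])
  also have "\<dots> \<le> 2 * A * exp (\<kappa> * (x + y))" using W2 by simp
  also have "\<dots> \<le> 2 * A * exp (4 * M * b)"
    using sum[OF xy] A M by (intro mult_left_mono) (auto simp: \<kappa>_def)
  finally show ?thesis .
qed

section \<open>Matrix algebra\<close>

text \<open>Four entries, each a sum of two products, give the crude factor 8, which only enters
  constants.\<close>

lemma norm_matrix_mult_le:
  fixes A B :: cmat2
  shows "norm (A ** B) \<le> norm A * norm B * 8"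
proof -
  have ent: "cmod ((A ** B) $ i $ j) \<le> 2 * (norm A * norm B)" for i j
  proof -
    have "cmod (A $ i $ k * B $ k $ j) \<le> norm A * norm B" for k
      unfolding norm_mult
      by (intro mult_mono norm_ge_zero order_trans[OF Finite_Cartesian_Product.norm_nth_le]
          Finite_Cartesian_Product.norm_nth_le)
    from this[of 1] this[of 2] show ?thesis
      unfolding matrix_matrix_mult_def
      by (simp add: sum_2) (smt (verit) norm_triangle_ineq)
  qed
  have "norm (A ** B) \<le> (\<Sum>i\<in>UNIV. norm ((A ** B) $ i))"
    unfolding norm_vec_def by (rule L2_set_le_sum) simp
  also have "\<dots> \<le> (\<Sum>i\<in>UNIV. \<Sum>j\<in>UNIV. cmod ((A ** B) $ i $ j))"
    by (rule sum_mono) (simp add: norm_vec_def[of "(A ** B) $ _"] L2_set_le_sum)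
  also have "\<dots> \<le> norm A * norm B * 8"
    using ent[of 1 1] ent[of 1 2] ent[of 2 1] ent[of 2 2] by (simp add: sum_2)
  finally show ?thesis .
qed

interpretation mm: bounded_bilinear "(**) :: cmat2 \<Rightarrow> cmat2 \<Rightarrow> cmat2"
proof
  show "\<exists>K. \<forall>(A::cmat2) (B::cmat2). norm (A ** B) \<le> norm A * norm B * K"
    using norm_matrix_mult_le by blast
qed (simp_all add: matrix_matrix_mult_def vec_eq_iff sum_2 algebra_simps scaleR_right_distrib)

text \<open>An involution, since \<open>Bmat\<close> squares to -1; \<open>Pplus\<close> and
  \<open>Pminus\<close> are the projections onto its eigenspaces for 1 and -1.\<close>

definition tau :: "cmat2 \<Rightarrow> cmat2" where
  "tau A = Bmat ** A ** Bmat"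

lemma Pplus_tau: "Pplus A = (1/2) *\<^sub>R (A + tau A)"
  and Pminus_tau: "Pminus A = (1/2) *\<^sub>R (A - tau A)"
  by (simp_all add: Pplus_def Pminus_def tau_def)

lemma Bmat_square: "Bmat ** Bmat = - mat 1"
  by (simp add: Bmat_def matrix_matrix_mult_def vec_eq_iff forall_2 sum_2 mat_def)

lemma Bmat_Bmat_mult [simp]: "Bmat ** (Bmat ** A) = - (A :: cmat2)"
  by (simp add: matrix_mul_assoc Bmat_square mm.minus_left)

lemma mult_Bmat_Bmat [simp]: "A ** Bmat ** Bmat = - (A :: cmat2)"
  by (simp add: matrix_mul_assoc[symmetric] Bmat_square mm.minus_right)

lemma norm_Bmat_mult [simp]: "norm (Bmat ** A) = norm (A :: cmat2)"
  by (simp add: norm_vec_def L2_set_def sum_2 Bmat_def matrix_matrix_mult_def add.commute)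

lemma norm_mult_Bmat [simp]: "norm (A ** Bmat) = norm (A :: cmat2)"
  by (simp add: norm_vec_def L2_set_def sum_2 Bmat_def matrix_matrix_mult_def add.commute)

lemma tau_tau [simp]: "tau (tau A) = A"
  by (simp add: tau_def matrix_mul_assoc[symmetric] mm.minus_left mm.minus_right Bmat_square)

lemma norm_tau [simp]: "norm (tau A) = norm A"
  by (simp add: tau_def)

lemma bounded_linear_tau: "bounded_linear tau"
  unfolding tau_def
  by (rule bounded_linear_compose[OF mm.bounded_linear_left mm.bounded_linear_right])

lemmas tau_linear = bounded_linear.linear[OF bounded_linear_tau]
lemmas tau_simps = linear_add[OF tau_linear] linear_diff[OF tau_linear] linear_scale[OF tau_linear]
  linear_neg[OF tau_linear] linear_0[OF tau_linear] linear_sum[OF tau_linear]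

lemma bounded_linear_Pplus: "bounded_linear Pplus"
  unfolding Pplus_tau[abs_def]
  by (intro bounded_linear_scaleR_right bounded_linear_add bounded_linear_tau
      bounded_linear_ident bounded_linear_compose[OF bounded_linear_scaleR_right])

lemma bounded_linear_Pminus: "bounded_linear Pminus"
  unfolding Pminus_tau[abs_def]
  by (intro bounded_linear_scaleR_right bounded_linear_sub bounded_linear_tau
      bounded_linear_ident bounded_linear_compose[OF bounded_linear_scaleR_right])

lemmas Pplus_linear = bounded_linear.linear[OF bounded_linear_Pplus]
lemmas Pplus_simps = linear_add[OF Pplus_linear] linear_diff[OF Pplus_linear] linear_scale[OF Pplus_linear]
  linear_neg[OF Pplus_linear] linear_0[OF Pplus_linear] linear_sum[OF Pplus_linear]
lemmas Pminus_linear = bounded_linear.linear[OF bounded_linear_Pminus]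
lemmas Pminus_simps = linear_add[OF Pminus_linear] linear_diff[OF Pminus_linear] linear_scale[OF Pminus_linear]
  linear_neg[OF Pminus_linear] linear_0[OF Pminus_linear] linear_sum[OF Pminus_linear]

lemma half_half: "(1/2) *\<^sub>R x + (1/2) *\<^sub>R x = (x :: 'a :: real_vector)"
  by (metis scaleR_half_double scaleR_right_distrib)

lemma Pplus_plus_Pminus [simp]: "Pplus A + Pminus A = A"
  by (simp add: Pplus_tau Pminus_tau algebra_simps half_half)

lemma Pplus_minus_Pminus: "Pplus A - Pminus A = tau A"
  by (simp add: Pplus_tau Pminus_tau algebra_simps half_half)

lemma P_tau [simp]: "Pplus (tau A) = Pplus A" "Pminus (tau A) = - Pminus A"
  by (simp_all add: Pplus_tau Pminus_tau algebra_simps)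

lemma P_tau_pow [simp]: "Pplus ((tau ^^ k) A) = Pplus A" "Pminus ((tau ^^ k) A) = (-1) ^ k *\<^sub>R Pminus A"
  by (induction k) simp_all

lemma P_P [simp]: "Pplus (Pplus A) = Pplus A" "Pminus (Pminus A) = Pminus A"
  "Pplus (Pminus A) = 0" "Pminus (Pplus A) = 0"
  by (simp_all add: Pplus_tau Pminus_tau tau_simps algebra_simps half_half
      flip: scaleR_add_left)

lemma norm_P_le: "norm (Pplus A) \<le> norm A" "norm (Pminus A) \<le> norm A"
proof -
  have "norm (A + tau A) \<le> norm A + norm (tau A)" "norm (A - tau A) \<le> norm A + norm (tau A)"
    by (rule norm_triangle_ineq norm_triangle_ineq4)+
  then show "norm (Pplus A) \<le> norm A" "norm (Pminus A) \<le> norm A"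
    by (simp_all add: Pplus_tau Pminus_tau)
qed

lemma Bmat_Qmat: "Bmat ** Qmat p q x = - (Qmat p q x ** Bmat)"
  by (simp add: Bmat_def Qmat_def matrix_matrix_mult_def vec_eq_iff forall_2 sum_2)

text \<open>Multiplied by B from the left, the equation reads K_x = BQ K + \<open>tau\<close> K_t,
  so \<open>BQ\<close> is the potential of the system in evolution form.\<close>

definition BQ :: "(real \<Rightarrow> complex) \<Rightarrow> (real \<Rightarrow> complex) \<Rightarrow> real \<Rightarrow> cmat2" where
  "BQ p q x = Bmat ** Qmat p q x"

text \<open>\<open>Bmat\<close> anticommutes with \<open>Qmat\<close>, so multiplication by
  \<open>BQ\<close> interchanges the eigenspaces of \<open>tau\<close>. Along its characteristics
  each component is therefore driven by the other one alone.\<close>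

lemma tau_BQ_mult: "tau (BQ p q x ** A) = - (BQ p q x ** tau A)"
proof -
  have "Bmat ** BQ p q x = - (BQ p q x ** Bmat)"
    by (simp add: BQ_def Bmat_Qmat mm.minus_left mm.minus_right matrix_mul_assoc)
  then show ?thesis
    by (simp add: tau_def matrix_mul_assoc mm.minus_left)
qed

lemma P_BQ_mult [simp]: "Pplus (BQ p q x ** A) = BQ p q x ** Pminus A"
  "Pminus (BQ p q x ** A) = BQ p q x ** Pplus A"
  by (simp_all add: Pplus_tau Pminus_tau tau_BQ_mult mm.scaleR_right mm.diff_right mm.add_right)

lemma P_BQ [simp]: "Pplus (BQ p q x) = BQ p q x" "Pminus (BQ p q x) = 0"
proof -
  have "tau (BQ p q x) = BQ p q x"
    by (simp add: tau_def BQ_def Bmat_Qmat mm.minus_left mm.minus_right matrix_mul_assoc[symmetric] Bmat_square)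
  then show "Pplus (BQ p q x) = BQ p q x" "Pminus (BQ p q x) = 0"
    by (simp_all add: Pplus_tau Pminus_tau half_half algebra_simps)
qed

section \<open>Absolutely continuous solutions\<close>

lemma abs_continuous_on_interval_subset:
  assumes "abs_continuous_on_interval \<alpha> \<beta> F" "{\<alpha>'..\<beta>'} \<subseteq> {\<alpha>..\<beta>}"
  shows "abs_continuous_on_interval \<alpha>' \<beta>' F"
  using assms unfolding abs_continuous_on_interval_def by (meson order_trans)

lemma abs_continuous_imp_continuous_on:
  assumes ac: "abs_continuous_on_interval \<alpha> \<beta> F"
  shows "continuous_on {\<alpha>..\<beta>} F"
  unfolding continuous_on_iff
proof (intro ballI allI impI)
  fix x and e :: real
  assume x: "x \<in> {\<alpha>..\<beta>}" and e: "e > 0"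
  obtain \<delta> where \<delta>: "\<delta> > 0" and
    H: "\<forall>d. d division_of (\<Union>d) \<and> \<Union>d \<subseteq> {\<alpha>..\<beta>} \<and> (\<Sum>k\<in>d. Sup k - Inf k) < \<delta>
        \<longrightarrow> (\<Sum>k\<in>d. norm (F (Sup k) - F (Inf k))) < e"
    using ac[unfolded abs_continuous_on_interval_def, rule_format, OF e] by blast
  have seg: "norm (F t - F s) < e" if "s \<le> t" "t - s < \<delta>" "{s..t} \<subseteq> {\<alpha>..\<beta>}" for s t
    using H[rule_format, of "{{s..t}}"] that division_of_self[of s t] by (simp add: box_real)
  show "\<exists>d>0. \<forall>x'\<in>{\<alpha>..\<beta>}. dist x' x < d \<longrightarrow> dist (F x') (F x) < e"
  proof (intro exI[of _ \<delta>] conjI ballI impI \<delta>)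
    fix x' assume x': "x' \<in> {\<alpha>..\<beta>}" "dist x' x < \<delta>"
    show "dist (F x') (F x) < e"
      using seg[of x x'] seg[of x' x] x x'
      by (cases "x \<le> x'") (auto simp: dist_norm norm_minus_commute)
  qed
qed

text \<open>Gauge integration: tags outside the exceptional set are controlled by the derivative,
  tags inside it lie in an open set of small measure and are controlled by absolute
  continuity.\<close>
lemma abs_continuous_has_integral:
  fixes F :: "real \<Rightarrow> 'a::banach"
  assumes ac: "abs_continuous_on_interval \<alpha> \<beta> F" and "\<alpha> \<le> \<beta>" and E: "negligible E"
    and der: "\<And>x. x \<in> {\<alpha>..\<beta>} - E \<Longrightarrow> (F has_vector_derivative F' x) (at x within {\<alpha>..\<beta>})"
  shows "(F' has_integral (F \<beta> - F \<alpha>)) {\<alpha>..\<beta>}"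
proof -
  \<comment> \<open>With the integrand set to 0 on \<open>E\<close>, the tags in \<open>E\<close>
    contribute increments of \<open>F\<close> alone.\<close>
  define h where "h = (\<lambda>x. if x \<in> E then 0 else F' x)"
  have "(h has_integral (F \<beta> - F \<alpha>)) {\<alpha>..\<beta>}"
    unfolding has_integral_real
  proof (intro allI impI)
    fix e :: real assume e: "e > 0"
    \<comment> \<open>The + 1 keeps the denominator positive when
      \<open>\<alpha> = \<beta>\<close>.\<close>
    define e1 where "e1 = e / 2 / (\<beta> - \<alpha> + 1)"
    have e1: "e1 > 0" "e1 * (\<beta> - \<alpha>) \<le> e / 2"
      using e \<open>\<alpha> \<le> \<beta>\<close> by (auto simp: e1_def field_simps)
    obtain \<delta> where \<delta>: "\<delta> > 0" and
      H: "\<forall>d. d division_of (\<Union>d) \<and> \<Union>d \<subseteq> {\<alpha>..\<beta>} \<and> (\<Sum>k\<in>d. Sup k - Inf k) < \<delta>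
          \<longrightarrow> (\<Sum>k\<in>d. norm (F (Sup k) - F (Inf k))) < e / 2"
      using ac[unfolded abs_continuous_on_interval_def, rule_format, OF half_gt_zero[OF e]] by blast
    have "E \<in> sets lebesgue"
      using E negligible_imp_sets by blast
    from sets_lebesgue_outer_open[OF this \<delta>] obtain T where T: "open T" "E \<subseteq> T"
      "T - E \<in> lmeasurable" "emeasure lebesgue (T - E) < ennreal \<delta>" by blast
    have Tm: "T \<in> lmeasurable" and "measure lebesgue T = measure lebesgue (T - E)"
    proof -
      have E': "E \<in> lmeasurable" "measure lebesgue E = 0"
        using E negligible_iff_measure by blast+
      have "T = (T - E) \<union> E" using T(2) by blast
      then show "T \<in> lmeasurable" using T(3) E'(1) fmeasurable.Un by metis
      show "measure lebesgue T = measure lebesgue (T - E)"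
        using measure_Diff_null_set[of T lebesgue E] E fmeasurableD[OF \<open>T \<in> lmeasurable\<close>]
        by (simp add: negligible_iff_null_sets)
    qed
    then have Tme: "measure lebesgue T < \<delta>"
      using T(3,4) \<delta> by (simp add: emeasure_eq_measure2 ennreal_less_iff)
    have "\<forall>x. \<exists>d>0. x \<in> {\<alpha>..\<beta>} - E \<longrightarrow>
         (\<forall>y\<in>{\<alpha>..\<beta>}. norm (y - x) < d \<longrightarrow> norm (F y - F x - (y - x) *\<^sub>R F' x) \<le> e1 * norm (y - x))"
      using der[unfolded has_vector_derivative_def has_derivative_within_alt] e1(1)
      by (metis zero_less_one)
    then obtain d where d: "\<And>x. 0 < d x"
      "\<And>x y. \<lbrakk>x \<in> {\<alpha>..\<beta>} - E; y \<in> {\<alpha>..\<beta>}; norm (y - x) < d x\<rbrakk>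
          \<Longrightarrow> norm (F y - F x - (y - x) *\<^sub>R F' x) \<le> e1 * norm (y - x)"
      by metis
    define \<gamma> where "\<gamma> = (\<lambda>x. if x \<in> E then T else ball x (d x))"
    have gauge: "gauge \<gamma>"
      using T d(1) by (auto simp: gauge_def \<gamma>_def)
    have small: "norm ((\<Sum>(x, k)\<in>p. measure lborel k *\<^sub>R h x) - (F \<beta> - F \<alpha>)) < e"
      if p: "p tagged_division_of {\<alpha>..\<beta>}" and fine: "\<gamma> fine p" for p
    proof -
      define p1 where "p1 = {xk \<in> p. fst xk \<in> E}"
      define p2 where "p2 = {xk \<in> p. fst xk \<notin> E}"
      have fp: "finite p" using p by blast
      have fp12: "finite p1" "finite p2" "p1 \<inter> p2 = {}" "p = p1 \<union> p2"
        using fp by (auto simp: p1_def p2_def)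
      have kk: "\<exists>u v. k = {u..v} \<and> u \<le> v \<and> x \<in> k \<and> {u..v} \<subseteq> {\<alpha>..\<beta>}" if xk: "(x, k) \<in> p" for x k
      proof -
        obtain u v where uv: "k = {u..v}"
          using tagged_division_ofD(4)[OF p xk] by (auto simp: box_real)
        have "x \<in> k" "k \<subseteq> {\<alpha>..\<beta>}" by (rule tagged_division_ofD(2,3)[OF p xk])+
        then show ?thesis unfolding uv by (intro exI[of _ u] exI[of _ v]) simp
      qed
      let ?D = "\<lambda>k. F (Sup k) - F (Inf k)"
      have "(\<Sum>(x, k)\<in>p. measure lborel k *\<^sub>R h x) - (F \<beta> - F \<alpha>)
          = (\<Sum>(x, k)\<in>p. measure lborel k *\<^sub>R h x - ?D k)"
        using additive_tagged_division_1[OF \<open>\<alpha> \<le> \<beta>\<close> p, of F]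
        by (simp add: case_prod_unfold sum_subtractf)
      also have "\<dots> = (\<Sum>(x, k)\<in>p2. measure lborel k *\<^sub>R h x - ?D k) + (\<Sum>(x, k)\<in>p1. measure lborel k *\<^sub>R h x - ?D k)"
        unfolding fp12(4) by (subst sum.union_disjoint) (use fp12 in auto)
      also have "(\<Sum>(x, k)\<in>p1. measure lborel k *\<^sub>R h x - ?D k) = (\<Sum>(x, k)\<in>p1. - ?D k)"
        by (rule sum.cong) (auto simp: p1_def h_def)
      finally have split: "norm ((\<Sum>(x, k)\<in>p. measure lborel k *\<^sub>R h x) - (F \<beta> - F \<alpha>))
          \<le> norm (\<Sum>(x, k)\<in>p2. measure lborel k *\<^sub>R h x - ?D k) + norm (\<Sum>(x, k)\<in>p1. - ?D k)"
        by (simp only: norm_triangle_ineq)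
      have "norm (\<Sum>(x, k)\<in>p2. measure lborel k *\<^sub>R h x - ?D k) \<le> (\<Sum>(x, k)\<in>p2. e1 * (Sup k - Inf k))"
      proof (rule sum_norm_le, safe)
        fix x k assume xk: "(x, k) \<in> p2"
        then have xkp: "(x, k) \<in> p" "x \<notin> E" by (auto simp: p2_def)
        from kk[OF xkp(1)] obtain u v where uv: "k = {u..v}" "u \<le> v" "x \<in> {u..v}" "{u..v} \<subseteq> {\<alpha>..\<beta>}"
          by auto
        have "k \<subseteq> ball x (d x)" using fineD[OF fine xkp(1)] xkp(2) by (simp add: \<gamma>_def)
        moreover have "u \<in> k" "v \<in> k" using uv by auto
        ultimately have "u \<in> ball x (d x)" "v \<in> ball x (d x)" by blast+
        then have dd: "norm (u - x) < d x" "norm (v - x) < d x"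
          by (simp_all add: dist_norm norm_minus_commute)
        have "norm ((v - u) *\<^sub>R F' x - (F v - F u))
            = norm ((F u - F x - (u - x) *\<^sub>R F' x) - (F v - F x - (v - x) *\<^sub>R F' x))"
          by (simp add: algebra_simps)
        also have "\<dots> \<le> e1 * norm (u - x) + e1 * norm (v - x)"
          by (rule order_trans[OF norm_triangle_ineq4 add_mono])
            (use d(2)[of x u] d(2)[of x v] uv xkp dd in auto)
        also have "\<dots> = e1 * (v - u)"
          using uv by (simp add: algebra_simps)
        finally show "norm (measure lborel k *\<^sub>R h x - ?D k) \<le> e1 * (Sup k - Inf k)"
          using uv xkp by (simp add: h_def)
      qed
      also have "\<dots> \<le> (\<Sum>(x, k)\<in>p. e1 * (Sup k - Inf k))"
        using kk fp e1(1) by (intro sum_mono2) (fastforce simp: p2_def)+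
      also have "\<dots> = e1 * (\<beta> - \<alpha>)"
        using additive_tagged_division_1[OF \<open>\<alpha> \<le> \<beta>\<close> p, of "\<lambda>x. x"]
        by (simp add: case_prod_unfold flip: sum_distrib_left)
      finally have s2: "norm (\<Sum>(x, k)\<in>p2. measure lborel k *\<^sub>R h x - ?D k) \<le> e / 2"
        using e1(2) by simp
      have part: "p1 tagged_partial_division_of {\<alpha>..\<beta>}"
        by (rule tagged_partial_division_subset[of p])
          (use p in \<open>auto simp: p1_def tagged_division_of_def\<close>)
      have tag: "p1 tagged_division_of (\<Union>(snd ` p1))"
        using tagged_partial_division_of_Union_self[OF part] by simp
      define ds where "ds = snd ` p1"
      have ds: "ds division_of \<Union>ds"
        unfolding ds_def by (rule partial_division_of_tagged_division[OF part])
      have "k \<subseteq> {\<alpha>..\<beta>}" "k \<subseteq> T" if "k \<in> ds" for k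
      proof -
        from that obtain x where "(x, k) \<in> p" "x \<in> E" by (auto simp: ds_def p1_def)
        with kk[of x k] fineD[OF fine, of x k] show "k \<subseteq> {\<alpha>..\<beta>}" "k \<subseteq> T"
          by (auto simp: \<gamma>_def)
      qed
      then have sub: "\<Union>ds \<subseteq> {\<alpha>..\<beta>}" "\<Union>ds \<subseteq> T" by blast+
      have "(\<Sum>k\<in>ds. Sup k - Inf k) = (\<Sum>k\<in>ds. measure lebesgue k)"
      proof (rule sum.cong)
        fix k assume "k \<in> ds"
        then obtain x where "(x, k) \<in> p" by (auto simp: ds_def p1_def)
        from kk[OF this] show "Sup k - Inf k = measure lebesgue k" by auto
      qed simp
      also have "\<dots> = measure lebesgue (\<Union>ds)"
        using ds by (rule content_division)
      also have "\<dots> \<le> measure lebesgue T"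
        by (rule measure_mono_fmeasurable[OF sub(2) _ Tm])
          (use ds lmeasurable_division in \<open>blast intro: fmeasurableD\<close>)
      finally have "(\<Sum>k\<in>ds. norm (?D k)) < e / 2"
        using Tme by (intro H[rule_format]) (use ds sub(1) in simp)
      moreover have "(\<Sum>(x, k)\<in>p1. norm (?D k)) = (\<Sum>k\<in>ds. norm (?D k))"
      proof -
        \<comment> \<open>Several tags may share a degenerate interval, so the sum is carried over
          to \<open>ds\<close> by \<open>sum.over_tagged_division_lemma\<close>, whose summand must
          vanish on intervals with empty interior. At the empty set \<open>Sup\<close> and
          \<open>Inf\<close> are unspecified, hence the explicit 0.\<close>
        let ?n = "\<lambda>k. if k = {} then 0 else norm (?D k)"
        have ne: "k \<noteq> {}" if "(x, k) \<in> p1" for x k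
          using kk[of x k] that by (auto simp: p1_def)
        have "(\<Sum>(x, k)\<in>p1. norm (?D k)) = (\<Sum>(x, k)\<in>p1. ?n k)"
          using ne by (intro sum.cong) auto
        also have "\<dots> = (\<Sum>k\<in>ds. ?n k)"
          unfolding ds_def
          by (rule sum.over_tagged_division_lemma[OF tag]) (auto simp: box_real not_less le_less)
        also have "\<dots> = (\<Sum>k\<in>ds. norm (?D k))"
          using ne by (intro sum.cong) (auto simp: ds_def)
        finally show ?thesis .
      qed
      moreover have "norm (\<Sum>(x, k)\<in>p1. - ?D k) \<le> (\<Sum>(x, k)\<in>p1. norm (?D k))"
        by (rule sum_norm_le) (auto simp: norm_minus_commute)
      ultimately show ?thesis using split s2 by linarith
    qed
    show "\<exists>\<gamma>. gauge \<gamma> \<and> (\<forall>\<D>. \<D> tagged_division_of {\<alpha>..\<beta>} \<and> \<gamma> fine \<D> \<longrightarrow>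
        norm ((\<Sum>(x, k)\<in>\<D>. measure lborel k *\<^sub>R h x) - (F \<beta> - F \<alpha>)) < e)"
      using gauge small by (intro exI[of _ \<gamma>]) simp
  qed
  then show ?thesis
    by (rule has_integral_spike[OF E, rotated]) (simp add: h_def)
qed

text \<open>The almost everywhere derivative agrees with a continuous function, so F is the integral
  of that function and the fundamental theorem applies at every point.\<close>

lemma abs_continuous_has_vector_derivative:
  fixes F :: "real \<Rightarrow> 'a::banach"
  assumes ac: "abs_continuous_on_interval 0 b F" and E: "negligible E"
    and der: "\<And>x. x \<in> {0..b} - E \<Longrightarrow> (F has_vector_derivative F' x) (at x within {0..b})"
    and F': "continuous_on {0..b} F'" and x: "x \<in> {0..b}"
  shows "(F has_vector_derivative F' x) (at x within {0..b})"
proof -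
  have eq: "F 0 + integral {0..t} F' = F t" if t: "t \<in> {0..b}" for t
  proof -
    have "(F' has_integral (F t - F 0)) {0..t}"
      by (rule abs_continuous_has_integral[OF abs_continuous_on_interval_subset[OF ac] _ E])
        (use t in \<open>auto intro: has_vector_derivative_within_subset[OF der]\<close>)
    then show ?thesis by (simp add: integral_unique)
  qed
  have "((\<lambda>t. F 0 + integral {0..t} F') has_vector_derivative F' x) (at x within {0..b})"
    using integral_has_vector_derivative[OF F' x] by (auto intro: derivative_eq_intros)
  then show ?thesis
    by (rule has_vector_derivative_transform[OF x eq[symmetric], rotated]) 
qed

text \<open>Solved for f' and g', the equations have continuous right-hand sides, so they hold
  everywhere and not only almost everywhere.\<close>

lemma nonvanishing_solution_derivative:
  assumes sol: "nonvanishing_solution b p q f g"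
    and p: "continuous_on {0..b} p" and q: "continuous_on {0..b} q" and x: "x \<in> {0..b}"
  shows "(f has_vector_derivative q x * f x - p x * g x) (at x within {0..b})"
    and "(g has_vector_derivative - p x * f x - q x * g x) (at x within {0..b})"
proof -
  define P where "P x \<longleftrightarrow> (\<exists>f' g'. (f has_vector_derivative f') (at x within {0..b}) \<and>
      (g has_vector_derivative g') (at x within {0..b}) \<and>
      g' + p x * f x + q x * g x = 0 \<and> - f' + q x * f x - p x * g x = 0)" for x
  have ac: "abs_continuous_on_interval 0 b f" "abs_continuous_on_interval 0 b g"
    and ae: "AE x in lebesgue. x \<in> {0..b} \<longrightarrow> P x"
    using sol by (auto simp: nonvanishing_solution_def P_def)
  from ae obtain E where "E \<in> null_sets lebesgue"
    and E: "{x \<in> space lebesgue. \<not> (x \<in> {0..b} \<longrightarrow> P x)} \<subseteq> E"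
    unfolding eventually_ae_filter by blast
  then have neg: "negligible E" by (simp add: negligible_iff_null_sets)
  note cont = p q ac[THEN abs_continuous_imp_continuous_on]
  have der: "(f has_vector_derivative q x * f x - p x * g x) (at x within {0..b}) \<and>
    (g has_vector_derivative - p x * f x - q x * g x) (at x within {0..b})" if "x \<in> {0..b} - E" for x
  proof -
    from that E have "P x" by auto
    then obtain f' g' where *: "(f has_vector_derivative f') (at x within {0..b})"
        "(g has_vector_derivative g') (at x within {0..b})"
        "g' + p x * f x + q x * g x = 0" "- f' + q x * f x - p x * g x = 0"
      unfolding P_def by blast
    have "g' = (g' + p x * f x + q x * g x) - p x * f x - q x * g x"
      "f' = q x * f x - p x * g x - (- f' + q x * f x - p x * g x)" by simp_all
    then have "g' = - p x * f x - q x * g x" "f' = q x * f x - p x * g x"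
      unfolding *(3,4) by simp_all
    then show ?thesis using *(1,2) by simp
  qed
  show "(f has_vector_derivative q x * f x - p x * g x) (at x within {0..b})"
    by (rule abs_continuous_has_vector_derivative[OF ac(1) neg _ _ x])
      (use der in \<open>auto intro!: continuous_intros cont\<close>)
  show "(g has_vector_derivative - p x * f x - q x * g x) (at x within {0..b})"
    by (rule abs_continuous_has_vector_derivative[OF ac(2) neg _ _ x])
      (use der in \<open>auto intro!: continuous_intros cont\<close>)
qed

section \<open>Formal powers\<close>

lemma has_vector_derivative_inverse:
  fixes h :: "real \<Rightarrow> complex"
  assumes "(h has_vector_derivative h') (at x within S)" "h x \<noteq> 0"
  shows "((\<lambda>x. inverse (h x)) has_vector_derivative - (h' / (h x)\<^sup>2)) (at x within S)"
  using Deriv.has_derivative_inverse[OF assms(2) assms(1)[unfolded has_vector_derivative_def]]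
  by (simp add: has_vector_derivative_def field_simps power2_eq_square scaleR_conv_of_real)

lemma has_vector_derivative_vecI:
  fixes F :: "real \<Rightarrow> 'a::real_normed_vector ^ 'n"
  assumes "\<And>i. ((\<lambda>x. F x $ i) has_vector_derivative F' $ i) (at x within S)"
  shows "(F has_vector_derivative F') (at x within S)"
proof -
  have bl: "bounded_linear (axis i :: 'a \<Rightarrow> 'a ^ 'n)" for i
  proof (rule bounded_linear_intro[of _ 1])
    fix v :: 'a
    have "norm (axis i v :: 'a ^ 'n) \<le> (\<Sum>j\<in>UNIV. norm ((axis i v :: 'a ^ 'n) $ j))"
      unfolding norm_vec_def by (rule L2_set_le_sum) simp
    also have "\<dots> = (\<Sum>j\<in>UNIV. if j = i then norm v else 0)"
      by (rule sum.cong) (auto simp: axis_def)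
    finally show "norm (axis i v :: 'a ^ 'n) \<le> norm v * 1" by simp
  qed (auto simp: axis_def vec_eq_iff)
  have sum_axis: "(\<Sum>i\<in>UNIV. axis i (v $ i)) = v" for v :: "'a ^ 'n"
    by (simp add: vec_eq_iff axis_def)
  have "((\<lambda>x. \<Sum>i\<in>UNIV. axis i (F x $ i)) has_vector_derivative (\<Sum>i\<in>UNIV. axis i (F' $ i))) (at x within S)"
    by (intro has_vector_derivative_sum bounded_linear.has_vector_derivative[OF bl] assms)
  then show ?thesis by (simp add: sum_axis)
qed

text \<open>Only continuity of Q is built in; its smoothness matters first in
  \<open>approximable_C_class\<close>.\<close>

locale dirac =
  fixes b :: real and p q f g :: "real \<Rightarrow> complex"
  assumes b_pos: "b > 0"
    and cont_Qmat: "continuous_on {0..b} (Qmat p q)"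
    and solution: "nonvanishing_solution b p q f g"
begin

lemma cont_p: "continuous_on {0..b} p" and cont_q: "continuous_on {0..b} q"
proof -
  have "continuous_on {0..b} (\<lambda>x. Qmat p q x $ 1 $ 1)" "continuous_on {0..b} (\<lambda>x. Qmat p q x $ 1 $ 2)"
    by (intro continuous_intros cont_Qmat)+
  then show "continuous_on {0..b} p" "continuous_on {0..b} q" by (simp_all add: Qmat_def)
qed

lemma f_deriv: "x \<in> {0..b} \<Longrightarrow> (f has_vector_derivative q x * f x - p x * g x) (at x within {0..b})"
  and g_deriv: "x \<in> {0..b} \<Longrightarrow> (g has_vector_derivative - p x * f x - q x * g x) (at x within {0..b})"
  using nonvanishing_solution_derivative[OF solution cont_p cont_q] by blast+

lemma cont_f: "continuous_on {0..b} f" and cont_g: "continuous_on {0..b} g"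
  by (rule continuous_on_vector_derivative, erule f_deriv)
    (rule continuous_on_vector_derivative, erule g_deriv)

lemma f_nz: "x \<in> {0..b} \<Longrightarrow> f x \<noteq> 0" and g_nz: "x \<in> {0..b} \<Longrightarrow> g x \<noteq> 0" and fg_0: "f 0 * g 0 = 1"
  using solution by (auto simp: nonvanishing_solution_def)

text \<open>The two summands are the integrands that start the recurrences, which is why 1 / (f g)
  can measure the difference of the two formal powers.\<close>

lemma inverse_fg_deriv:
  assumes x: "x \<in> {0..b}"
  shows "((\<lambda>x. inverse (f x * g x)) has_vector_derivative
    p x / (f x)\<^sup>2 + p x / (g x)\<^sup>2) (at x within {0..b})"
proof -
  have "((\<lambda>x. f x * g x) has_vector_derivative - p x * ((f x)\<^sup>2 + (g x)\<^sup>2)) (at x within {0..b})"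
    by (rule derivative_eq_intros f_deriv g_deriv x)+ (simp add: algebra_simps power2_eq_square)
  from has_vector_derivative_inverse[OF this] f_nz[OF x] g_nz[OF x]
  have "((\<lambda>x. inverse (f x * g x)) has_vector_derivative
    - (- p x * ((f x)\<^sup>2 + (g x)\<^sup>2) / (f x * g x)\<^sup>2)) (at x within {0..b})" by simp
  also have "- (- p x * ((f x)\<^sup>2 + (g x)\<^sup>2) / (f x * g x)\<^sup>2) = p x / (f x)\<^sup>2 + p x / (g x)\<^sup>2"
    using f_nz[OF x] g_nz[OF x] by (simp add: field_simps power2_eq_square)
  finally show ?thesis .
qed

text \<open>The difference \<open>X\<^sup>n - Y\<^sup>n\<close> is \<open>- w\<^sub>n / (f g)\<close>, where \<open>w\<^sub>0 = \<sigma>\<close> and \<open>w\<^sub>n = n Z\<^sup>n\<^sup>-\<^sup>1\<close> for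
  \<open>n > 0\<close>; this turns the recurrences into the differential equation for \<open>(f X\<^sup>n, g Y\<^sup>n)\<close>.\<close>
lemma formal_powers_derivative:
  fixes XY0 :: "(real \<Rightarrow> complex) \<times> (real \<Rightarrow> complex)" and \<sigma> :: complex
  defines "P \<equiv> formal_powers p f g XY0"
  assumes X0: "\<And>x. x \<in> {0..b} \<Longrightarrow> (fst XY0 has_vector_derivative - \<sigma> * (p x / (f x)\<^sup>2)) (at x within {0..b})"
    and Y0: "\<And>x. x \<in> {0..b} \<Longrightarrow> (snd XY0 has_vector_derivative \<sigma> * (p x / (g x)\<^sup>2)) (at x within {0..b})"
    and XY00: "fst XY0 0 - snd XY0 0 = - \<sigma>"
    and x: "x \<in> {0..b}"
  shows "((\<lambda>x. f x * fst (P n) x) has_vector_derivative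
      (q x * (f x * fst (P n) x) - p x * (g x * snd (P n) x) - of_nat n * (g x * snd (P (n - 1)) x)))
        (at x within {0..b})"
    and "((\<lambda>x. g x * snd (P n) x) has_vector_derivative
      (- p x * (f x * fst (P n) x) - q x * (g x * snd (P n) x) + of_nat n * (f x * fst (P (n - 1)) x)))
        (at x within {0..b})"
proof -
  define Z where "Z n = (\<lambda>x. integral {0..x} (\<lambda>s. (f s)\<^sup>2 * fst (P n) s + (g s)\<^sup>2 * snd (P n) s))" for n
  have PS: "fst (P (Suc n)) = (\<lambda>x. - of_nat (Suc n) * integral {0..x} (\<lambda>s. p s / (f s)\<^sup>2 * Z n s + g s / f s * snd (P n) s))"
    "snd (P (Suc n)) = (\<lambda>x. of_nat (Suc n) * integral {0..x} (\<lambda>s. p s / (g s)\<^sup>2 * Z n s + f s / g s * fst (P n) s))" for n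
    by (simp_all add: P_def Z_def Let_def)
  have P0: "P 0 = XY0" by (simp add: P_def)
  have Zd: "(Z n has_vector_derivative (f x)\<^sup>2 * fst (P n) x + (g x)\<^sup>2 * snd (P n) x) (at x within {0..b})"
    if "continuous_on {0..b} (fst (P n))" "continuous_on {0..b} (snd (P n))" "x \<in> {0..b}" for n x
    unfolding Z_def
    by (rule integral_has_vector_derivative) (intro continuous_intros cont_f cont_g that)+
  have PSd: "(fst (P (Suc n)) has_vector_derivative
      - of_nat (Suc n) * (p x / (f x)\<^sup>2 * Z n x + g x / f x * snd (P n) x)) (at x within {0..b})"
    "(snd (P (Suc n)) has_vector_derivative
      of_nat (Suc n) * (p x / (g x)\<^sup>2 * Z n x + f x / g x * fst (P n) x)) (at x within {0..b})"
    if c: "continuous_on {0..b} (fst (P n))" "continuous_on {0..b} (snd (P n))" and x: "x \<in> {0..b}" for n x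
  proof -
    have cZ: "continuous_on {0..b} (Z n)"
      using Zd[OF c] by (intro continuous_on_vector_derivative)
    have nz: "\<forall>x\<in>{0..b}. (f x)\<^sup>2 \<noteq> 0" "\<forall>x\<in>{0..b}. (g x)\<^sup>2 \<noteq> 0" "\<forall>x\<in>{0..b}. f x \<noteq> 0" "\<forall>x\<in>{0..b}. g x \<noteq> 0"
      using f_nz g_nz by auto
    show "(fst (P (Suc n)) has_vector_derivative
      - of_nat (Suc n) * (p x / (f x)\<^sup>2 * Z n x + g x / f x * snd (P n) x)) (at x within {0..b})"
      unfolding PS
      by (intro has_vector_derivative_mult_right integral_has_vector_derivative continuous_intros
          cont_f cont_g cont_p c cZ x nz)
    show "(snd (P (Suc n)) has_vector_derivative
      of_nat (Suc n) * (p x / (g x)\<^sup>2 * Z n x + f x / g x * fst (P n) x)) (at x within {0..b})"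
      unfolding PS
      by (intro has_vector_derivative_mult_right integral_has_vector_derivative continuous_intros
          cont_f cont_g cont_p c cZ x nz)
  qed
  have cP: "continuous_on {0..b} (fst (P n)) \<and> continuous_on {0..b} (snd (P n))" for n
  proof (induction n)
    case 0
    show ?case unfolding P0 using continuous_on_vector_derivative[OF X0] continuous_on_vector_derivative[OF Y0] by blast
  next
    case (Suc n)
    then have "continuous_on {0..b} (fst (P n))" "continuous_on {0..b} (snd (P n))" by auto
    note d = PSd[OF this]
    show ?case using continuous_on_vector_derivative[OF d(1)] continuous_on_vector_derivative[OF d(2)] by blast
  qed
  note Pd = PSd[OF conjunct1[OF cP] conjunct2[OF cP]]
  define w where "w n = (case n of 0 \<Rightarrow> (\<lambda>x. \<sigma>) | Suc m \<Rightarrow> (\<lambda>x. of_nat n * Z m x))" for n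
  have diff: "fst (P n) x - snd (P n) x = - (w n x * inverse (f x * g x))" if x: "x \<in> {0..b}" for n x
  proof -
    have const: "((\<lambda>x. fst (P n) x - snd (P n) x + w n x * inverse (f x * g x)) has_vector_derivative 0) (at x within {0..b})"
      if x: "x \<in> {0..b}" for x
    proof (cases n)
      case 0
      show ?thesis unfolding 0 P0 w_def
        by (rule derivative_eq_intros X0 Y0 inverse_fg_deriv x | simp)+ (simp add: algebra_simps)
    next
      case (Suc m)
      note Zm = Zd[OF conjunct1[OF cP] conjunct2[OF cP] x, of m]
      have "((\<lambda>x. fst (P (Suc m)) x - snd (P (Suc m)) x + (of_nat (Suc m) * Z m x) * inverse (f x * g x))
          has_vector_derivative
            (- of_nat (Suc m) * (p x / (f x)\<^sup>2 * Z m x + g x / f x * snd (P m) x))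
            - of_nat (Suc m) * (p x / (g x)\<^sup>2 * Z m x + f x / g x * fst (P m) x)
            + ((of_nat (Suc m) * Z m x) * (p x / (f x)\<^sup>2 + p x / (g x)\<^sup>2)
               + (of_nat (Suc m) * ((f x)\<^sup>2 * fst (P m) x + (g x)\<^sup>2 * snd (P m) x)) * inverse (f x * g x)))
          (at x within {0..b})"
        by (intro has_vector_derivative_add has_vector_derivative_diff has_vector_derivative_mult
            has_vector_derivative_mult_right Pd inverse_fg_deriv Zm x)
      moreover have "(- of_nat (Suc m) * (p x / (f x)\<^sup>2 * Z m x + g x / f x * snd (P m) x))
            - of_nat (Suc m) * (p x / (g x)\<^sup>2 * Z m x + f x / g x * fst (P m) x)
            + ((of_nat (Suc m) * Z m x) * (p x / (f x)\<^sup>2 + p x / (g x)\<^sup>2)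
               + (of_nat (Suc m) * ((f x)\<^sup>2 * fst (P m) x + (g x)\<^sup>2 * snd (P m) x)) * inverse (f x * g x)) = 0"
        using f_nz[OF x] g_nz[OF x] by (simp add: field_simps power2_eq_square del: of_nat_Suc)
      ultimately show ?thesis unfolding Suc w_def by simp
    qed
    obtain c where c: "\<And>x. x \<in> {0..b} \<Longrightarrow> fst (P n) x - snd (P n) x + w n x * inverse (f x * g x) = c"
      by (rule has_vector_derivative_zero_constant[OF convex_real_interval(5) const]) (assumption, rule that)
    have "fst (P n) 0 - snd (P n) 0 + w n 0 * inverse (f 0 * g 0) = 0"
      by (cases n) (simp_all add: P0 XY00 PS w_def fg_0 Z_def)
    with c[of 0] c[OF x] b_pos have "fst (P n) x - snd (P n) x + w n x * inverse (f x * g x) = 0" by simp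
    then show ?thesis by (simp add: eq_neg_iff_add_eq_0)
  qed
  show "((\<lambda>x. f x * fst (P n) x) has_vector_derivative
      (q x * (f x * fst (P n) x) - p x * (g x * snd (P n) x) - of_nat n * (g x * snd (P (n - 1)) x)))
        (at x within {0..b})"
    and "((\<lambda>x. g x * snd (P n) x) has_vector_derivative
      (- p x * (f x * fst (P n) x) - q x * (g x * snd (P n) x) + of_nat n * (f x * fst (P (n - 1)) x)))
        (at x within {0..b})"
  proof -
    define X Y where "X = fst (P n) x" and "Y = snd (P n) x"
    have XY: "X = Y - w n x * inverse (f x * g x)" using diff[OF x, of n] by (simp add: X_def Y_def algebra_simps)
    have nz: "f x \<noteq> 0" "g x \<noteq> 0" using f_nz g_nz x by auto
    define X' where "X' = (case n of 0 \<Rightarrow> - \<sigma> * (p x / (f x)\<^sup>2)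
      | Suc m \<Rightarrow> - of_nat n * (p x / (f x)\<^sup>2 * Z m x + g x / f x * snd (P m) x))"
    define Y' where "Y' = (case n of 0 \<Rightarrow> \<sigma> * (p x / (g x)\<^sup>2)
      | Suc m \<Rightarrow> of_nat n * (p x / (g x)\<^sup>2 * Z m x + f x / g x * fst (P m) x))"
    have "(fst (P n) has_vector_derivative X') (at x within {0..b})"
      "(snd (P n) has_vector_derivative Y') (at x within {0..b})"
      using X0[OF x] Y0[OF x] Pd[OF x] by (cases n; simp add: X'_def Y'_def P0)+
    from has_vector_derivative_mult[OF f_deriv[OF x] this(1)]
      has_vector_derivative_mult[OF g_deriv[OF x] this(2)]
    have d: "((\<lambda>x. f x * fst (P n) x) has_vector_derivative f x * X' + (q x * f x - p x * g x) * X) (at x within {0..b})"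
      "((\<lambda>x. g x * snd (P n) x) has_vector_derivative g x * Y' + (- p x * f x - q x * g x) * Y) (at x within {0..b})"
      by (simp_all add: X_def Y_def)
    have e1: "f x * X' = - p x / f x * w n x - of_nat n * (g x * snd (P (n - 1)) x)"
      "g x * Y' = p x / g x * w n x + of_nat n * (f x * fst (P (n - 1)) x)"
      using nz by (cases n; simp add: X'_def Y'_def w_def field_simps power2_eq_square del: of_nat_Suc)+
    have e2: "(q x * f x - p x * g x) * X = q x * (f x * X) - p x * (g x * Y) + p x / f x * w n x"
      "(- p x * f x - q x * g x) * Y = - p x * (f x * X) - q x * (g x * Y) - p x / g x * w n x"
      unfolding XY using nz by (simp_all add: field_simps)
    have "f x * X' + (q x * f x - p x * g x) * X = q x * (f x * X) - p x * (g x * Y) - of_nat n * (g x * snd (P (n - 1)) x)"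
      "g x * Y' + (- p x * f x - q x * g x) * Y = - p x * (f x * X) - q x * (g x * Y) + of_nat n * (f x * fst (P (n - 1)) x)"
      unfolding e1 e2 by simp_all
    with d show "((\<lambda>x. f x * fst (P n) x) has_vector_derivative
      (q x * (f x * fst (P n) x) - p x * (g x * snd (P n) x) - of_nat n * (g x * snd (P (n - 1)) x)))
        (at x within {0..b})"
     "((\<lambda>x. g x * snd (P n) x) has_vector_derivative
      (- p x * (f x * fst (P n) x) - q x * (g x * snd (P n) x) + of_nat n * (f x * fst (P (n - 1)) x)))
        (at x within {0..b})"
      by (simp_all add: X_def Y_def)
  qed
qed

end

lemma of_columns_nth [simp]: "of_columns u v $ i $ 1 = u $ i" "of_columns u v $ i $ 2 = v $ i"
  by (simp_all add: of_columns_def transpose_def)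

lemma cmat2_eqI:
  fixes A B :: cmat2
  assumes "A $ 1 $ 1 = B $ 1 $ 1" "A $ 1 $ 2 = B $ 1 $ 2" "A $ 2 $ 1 = B $ 2 $ 1" "A $ 2 $ 2 = B $ 2 $ 2"
  shows "A = B"
  using assms by (simp add: vec_eq_iff forall_2)

lemma mult_nth: "((A :: cmat2) ** B) $ i $ j = A $ i $ 1 * B $ 1 $ j + A $ i $ 2 * B $ 2 $ j"
  by (simp add: matrix_matrix_mult_def sum_2)

lemma Bmat_nth [simp]: "Bmat $ 1 $ 1 = 0" "Bmat $ 1 $ 2 = 1" "Bmat $ 2 $ 1 = -1" "Bmat $ 2 $ 2 = 0"
  by (simp_all add: Bmat_def)

lemma BQ_nth [simp]: "BQ p q x $ 1 $ 1 = q x" "BQ p q x $ 1 $ 2 = - p x"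
   "BQ p q x $ 2 $ 1 = - p x" "BQ p q x $ 2 $ 2 = - q x"
  by (simp_all add: BQ_def mult_nth) (simp_all add: Qmat_def)

lemma tau_nth [simp]: "tau A $ 1 $ 1 = - A $ 2 $ 2" "tau A $ 1 $ 2 = A $ 2 $ 1"
   "tau A $ 2 $ 1 = A $ 1 $ 2" "tau A $ 2 $ 2 = - A $ 1 $ 1"
  by (simp_all add: tau_def mult_nth)

context dirac
begin

text \<open>The matrix analogue of x^k: by \<open>Mmat_deriv\<close> and \<open>Mmat_0\<close> it is
  x^k times the identity when Q = 0.\<close>

definition Mmat :: "nat \<Rightarrow> real \<Rightarrow> cmat2" where
  "Mmat k x = of_columns (Phi p f g k x) (Psi p f g k x)"

lemma integral_p_div_square_deriv:
  assumes "x \<in> {0..b}"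
  shows "((\<lambda>x. integral {0..x} (\<lambda>s. p s / (f s)\<^sup>2)) has_vector_derivative p x / (f x)\<^sup>2) (at x within {0..b})"
    and "((\<lambda>x. integral {0..x} (\<lambda>s. p s / (g s)\<^sup>2)) has_vector_derivative p x / (g x)\<^sup>2) (at x within {0..b})"
  using f_nz g_nz assms
  by (auto intro!: integral_has_vector_derivative continuous_intros cont_f cont_g cont_p)

text \<open>The instance \<open>\<sigma> = 1\<close> of \<open>formal_powers_derivative\<close>; the
  tilde family is the instance -1.\<close>

lemma XYpow_deriv:
  assumes x: "x \<in> {0..b}"
  shows "((\<lambda>x. f x * fst (XYpow p f g n) x) has_vector_derivative
      (q x * (f x * fst (XYpow p f g n) x) - p x * (g x * snd (XYpow p f g n) x)
        - of_nat n * (g x * snd (XYpow p f g (n - 1)) x))) (at x within {0..b})" (is ?thesis1)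
    and "((\<lambda>x. g x * snd (XYpow p f g n) x) has_vector_derivative
      (- p x * (f x * fst (XYpow p f g n) x) - q x * (g x * snd (XYpow p f g n) x)
        + of_nat n * (f x * fst (XYpow p f g (n - 1)) x))) (at x within {0..b})" (is ?thesis2)
proof -
  let ?X = "\<lambda>x. - integral {0..x} (\<lambda>s. p s / (f s)\<^sup>2)" and ?Y = "\<lambda>x. 1 + integral {0..x} (\<lambda>s. p s / (g s)\<^sup>2)"
  have "(fst (?X, ?Y) has_vector_derivative - (1) * (p x / (f x)\<^sup>2)) (at x within {0..b})"
    "(snd (?X, ?Y) has_vector_derivative (1) * (p x / (g x)\<^sup>2)) (at x within {0..b})"
    if "x \<in> {0..b}" for x
    using that by (auto intro!: derivative_eq_intros integral_p_div_square_deriv)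
  note d = formal_powers_derivative[OF this _ x, folded XYpow_def]
  show ?thesis1 by (rule d(1)) simp_all
  show ?thesis2 by (rule d(2)) simp_all
qed

lemma XYpow_tilde_deriv:
  assumes x: "x \<in> {0..b}"
  shows "((\<lambda>x. f x * fst (XYpow_tilde p f g n) x) has_vector_derivative
      (q x * (f x * fst (XYpow_tilde p f g n) x) - p x * (g x * snd (XYpow_tilde p f g n) x)
        - of_nat n * (g x * snd (XYpow_tilde p f g (n - 1)) x))) (at x within {0..b})" (is ?thesis1)
    and "((\<lambda>x. g x * snd (XYpow_tilde p f g n) x) has_vector_derivative
      (- p x * (f x * fst (XYpow_tilde p f g n) x) - q x * (g x * snd (XYpow_tilde p f g n) x)
        + of_nat n * (f x * fst (XYpow_tilde p f g (n - 1)) x))) (at x within {0..b})" (is ?thesis2)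
proof -
  let ?X = "\<lambda>x. 1 + integral {0..x} (\<lambda>s. p s / (f s)\<^sup>2)" and ?Y = "\<lambda>x. - integral {0..x} (\<lambda>s. p s / (g s)\<^sup>2)"
  have "(fst (?X, ?Y) has_vector_derivative - (- 1) * (p x / (f x)\<^sup>2)) (at x within {0..b})"
    "(snd (?X, ?Y) has_vector_derivative (- 1) * (p x / (g x)\<^sup>2)) (at x within {0..b})"
    if "x \<in> {0..b}" for x
    using that by (auto intro!: derivative_eq_intros integral_p_div_square_deriv)
  note d = formal_powers_derivative[OF this _ x, folded XYpow_tilde_def]
  show ?thesis1 by (rule d(1)) simp_all
  show ?thesis2 by (rule d(2)) simp_all
qed

lemma Mmat_nth:
  "Mmat k x $ 1 $ 1 = (if odd k then ((- 1) ^ ((k + 1) div 2) * f 0) * (f x * fst (XYpow p f g k) x)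
      else ((- 1) ^ (k div 2) * g 0) * (f x * fst (XYpow_tilde p f g k) x))"
  "Mmat k x $ 2 $ 1 = (if odd k then ((- 1) ^ ((k + 1) div 2) * f 0) * (g x * snd (XYpow p f g k) x)
      else ((- 1) ^ (k div 2) * g 0) * (g x * snd (XYpow_tilde p f g k) x))"
  "Mmat k x $ 1 $ 2 = (if odd k then ((- 1) ^ ((k - 1) div 2) * g 0) * (f x * fst (XYpow_tilde p f g k) x)
      else ((- 1) ^ (k div 2) * f 0) * (f x * fst (XYpow p f g k) x))"
  "Mmat k x $ 2 $ 2 = (if odd k then ((- 1) ^ ((k - 1) div 2) * g 0) * (g x * snd (XYpow_tilde p f g k) x)
      else ((- 1) ^ (k div 2) * f 0) * (g x * snd (XYpow p f g k) x))"
  by (simp_all add: Mmat_def Phi_def Psi_def fgvec_def vector_scalar_mult_def)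

text \<open>The signs and parities in \<open>Phi\<close> and \<open>Psi\<close> are placed so that
  the two columns satisfy one matrix equation. At k = 0 the truncated index \<open>k - 1\<close>
  carries the factor 0.\<close>

lemma Mmat_deriv:
  assumes x: "x \<in> {0..b}"
  shows "(Mmat k has_vector_derivative BQ p q x ** Mmat k x - of_nat k *\<^sub>R tau (Mmat (k - 1) x))
    (at x within {0..b})"
proof -
  let ?D = "BQ p q x ** Mmat k x - of_nat k *\<^sub>R tau (Mmat (k - 1) x)"
  note d = XYpow_deriv[OF x, of k, THEN has_vector_derivative_mult_right]
    XYpow_tilde_deriv[OF x, of k, THEN has_vector_derivative_mult_right]
  \<comment> \<open>The index 0 is separated from the other even ones because there
    \<open>k - 1\<close> truncates to an even index.\<close>
  consider m where "k = Suc (2 * m)" | "k = 0" | m where "k = Suc (Suc (2 * m))"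
    by (metis evenE oddE Suc_eq_plus1 mult_0_right not0_implies_Suc mult_Suc_right add_2_eq_Suc)
  then have "\<forall>i j. ((\<lambda>x. Mmat k x $ i $ j) has_vector_derivative ?D $ i $ j) (at x within {0..b})"
  proof cases
    case 1
    have o: "odd k" using 1 by simp
    show ?thesis unfolding forall_2
      by (intro conjI; simp only: Mmat_nth[of k] o simp_thms if_True if_False)
        (rule has_vector_derivative_eq_rhs, rule d,
          simp add: 1 mult_nth Mmat_nth scaleR_conv_of_real[where 'a = complex] algebra_simps)+
  next
    case 2
    have o: "even k" using 2 by simp
    show ?thesis unfolding forall_2
      by (intro conjI; simp only: Mmat_nth[of k] o simp_thms if_True if_False)
        (rule has_vector_derivative_eq_rhs, rule d,
          simp add: 2 mult_nth Mmat_nth scaleR_conv_of_real[where 'a = complex] algebra_simps)+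
  next
    case 3
    have o: "even k" using 3 by simp
    show ?thesis unfolding forall_2
      by (intro conjI; simp only: Mmat_nth[of k] o simp_thms if_True if_False)
        (rule has_vector_derivative_eq_rhs, rule d,
          simp add: 3 mult_nth Mmat_nth scaleR_conv_of_real[where 'a = complex] algebra_simps)+
  qed
  then show ?thesis
    by (intro has_vector_derivative_vecI) auto
qed

text \<open>The factors \<open>f 0\<close> and \<open>g 0\<close> in \<open>Phi\<close> and
  \<open>Psi\<close>, with \<open>f 0 * g 0 = 1\<close>, produce the identity at k = 0; for k > 0
  all integrals start at 0.\<close>

lemma Mmat_0: "Mmat k 0 = (if k = 0 then mat 1 else 0)"
proof -
  have z: "fst (formal_powers p f g XY0 (Suc n)) 0 = 0" "snd (formal_powers p f g XY0 (Suc n)) 0 = 0" for XY0 n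
    by (simp_all add: Let_def)
  show ?thesis
  proof (cases k)
    case 0
    then show ?thesis
      using fg_0 by (intro cmat2_eqI)
        (simp_all add: Mmat_nth XYpow_def XYpow_tilde_def mat_def mult.commute)
  next
    case (Suc n)
    then show ?thesis
      by (intro cmat2_eqI) (simp_all add: Mmat_nth XYpow_def XYpow_tilde_def z del: formal_powers.simps)
  qed
qed

end

section \<open>Generalized wave matrices\<close>

lemma tau_P [simp]: "tau (Pplus A) = Pplus A" "tau (Pminus A) = - Pminus A"
  by (simp_all add: Pplus_tau Pminus_tau tau_simps algebra_simps)

lemma tau_mult: "tau M ** A = - tau (M ** tau A)"
  by (simp add: tau_def matrix_mul_assoc mm.minus_left)

lemmas has_vector_derivative_Pplus = bounded_linear.has_vector_derivative[OF bounded_linear_Pplus]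
lemmas has_vector_derivative_Pminus = bounded_linear.has_vector_derivative[OF bounded_linear_Pminus]
lemmas continuous_on_P [continuous_intros] =
  bounded_linear.continuous_on[OF bounded_linear_Pplus]
  bounded_linear.continuous_on[OF bounded_linear_Pminus]
  bounded_linear.continuous_on[OF bounded_linear_tau]
  mm.continuous_on

context dirac
begin

text \<open>For Q = 0 this is (x + t)^n \<open>Pplus C\<close> + (x - t)^n \<open>Pminus C\<close>,
  with Goursat data (2 x)^n C.\<close>

definition Kn :: "nat \<Rightarrow> cmat2 \<Rightarrow> real \<Rightarrow> real \<Rightarrow> cmat2" where
  "Kn n C x t = (\<Sum>k\<le>n. (of_nat (n choose k) * t ^ k) *\<^sub>R (Mmat (n - k) x ** (tau ^^ k) C))"

text \<open>The right-hand side is the termwise t-derivative of \<open>Kn n C\<close>; the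
  absorption identity k (n choose k) = n (n - 1 choose k - 1) makes it a multiple of a member of
  lower degree.\<close>

lemma Kn_dt_sum:
  "of_nat n *\<^sub>R Kn (n - 1) (tau C) x t =
    (\<Sum>k\<le>n. (of_nat (n choose k) * (of_nat k * t ^ (k - 1))) *\<^sub>R (Mmat (n - k) x ** (tau ^^ k) C))"
proof (cases n)
  case (Suc m)
  have c: "real (Suc m choose Suc j) * real (Suc j) = real (Suc m) * real (m choose j)" for j
    by (metis Suc_times_binomial mult.commute of_nat_mult)
  show ?thesis
    unfolding Suc sum.atMost_Suc_shift Kn_def scaleR_sum_right
    by (simp add: funpow_swap1 mult.assoc[symmetric] c del: of_nat_Suc binomial_Suc_Suc)
qed simp

text \<open>Under \<open>tau\<close>, the right-hand side is what the second term of
  \<open>Mmat_deriv\<close> contributes to the x-derivative. Its agreement with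
  \<open>Kn_dt_sum\<close> is the differential equation for \<open>Kn\<close>.\<close>

lemma Kn_dx_sum:
  "of_nat n *\<^sub>R Kn (n - 1) (tau C) x t =
    (\<Sum>k\<le>n. (of_nat (n choose k) * t ^ k * of_nat (n - k)) *\<^sub>R (Mmat (n - k - 1) x ** tau ((tau ^^ k) C)))"
proof (cases n)
  case (Suc m)
  have c: "real (Suc m choose k) * real (Suc m - k) = real (Suc m) * real (m choose k)" for k
    using binomial_absorb_comp[of "Suc m" k] by (metis diff_Suc_1 mult.commute of_nat_mult)
  have c': "real (Suc m choose k) * t ^ k * real (Suc m - k) = real (Suc m) * (real (m choose k) * t ^ k)" for k
    using c[of k] by (metis mult.assoc mult.commute)
  have "(\<Sum>k\<le>Suc m. (of_nat (Suc m choose k) * t ^ k * of_nat (Suc m - k)) *\<^sub>R (Mmat (Suc m - k - 1) x ** tau ((tau ^^ k) C)))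
     = (\<Sum>k\<le>m. (of_nat (Suc m choose k) * t ^ k * of_nat (Suc m - k)) *\<^sub>R (Mmat (m - k) x ** (tau ^^ k) (tau C)))"
    by (simp add: funpow_swap1 del: binomial_Suc_Suc)
  also have "\<dots> = of_nat (Suc m) *\<^sub>R Kn m (tau C) x t"
    unfolding Kn_def scaleR_sum_right c' by simp
  finally show ?thesis unfolding Suc by simp
qed simp

lemma Mmat_shift_deriv:
  assumes x: "x0 + s \<in> {0..b}"
  shows "((\<lambda>s. Mmat k (x0 + s)) has_vector_derivative
      BQ p q (x0 + s) ** Mmat k (x0 + s) - of_nat k *\<^sub>R tau (Mmat (k - 1) (x0 + s)))
    (at s within {s. x0 + s \<in> {0..b}})"
proof -
  have "(Mmat k has_vector_derivative BQ p q (x0 + s) ** Mmat k (x0 + s) - of_nat k *\<^sub>R tau (Mmat (k - 1) (x0 + s)))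
      (at (x0 + s) within (\<lambda>s. x0 + s) ` {s. x0 + s \<in> {0..b}})"
    by (rule has_vector_derivative_within_subset[OF Mmat_deriv[OF x]]) auto
  moreover have "((\<lambda>s. x0 + s) has_vector_derivative 1) (at s within {s. x0 + s \<in> {0..b}})"
    by (auto intro!: derivative_eq_intros)
  ultimately show ?thesis
    using vector_diff_chain_within by (fastforce simp: o_def)
qed

text \<open>\<open>W\<close> is the t-derivative. As \<open>tau\<close> is 1 on the range of
  \<open>Pplus\<close> and -1 on that of \<open>Pminus\<close>, the slope
  \<open>\<sigma> = -1\<close> removes \<open>W\<close> from the \<open>Pplus\<close> component and
  \<open>\<sigma> = 1\<close> removes it from the \<open>Pminus\<close> component: these lines are
  the characteristics.\<close>

lemma Kn_line_deriv:
  fixes x0 t0 s \<sigma> :: real and n :: nat and C :: cmat2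
  assumes x: "x0 + s \<in> {0..b}"
  defines "W \<equiv> of_nat n *\<^sub>R Kn (n - 1) (tau C) (x0 + s) (t0 + \<sigma> * s)"
  shows "((\<lambda>s. Kn n C (x0 + s) (t0 + \<sigma> * s)) has_vector_derivative
      BQ p q (x0 + s) ** Kn n C (x0 + s) (t0 + \<sigma> * s) + tau W + \<sigma> *\<^sub>R W)
    (at s within {s. x0 + s \<in> {0..b}})"
proof -
  let ?x = "x0 + s" and ?t = "t0 + \<sigma> * s"
  have mult: "((\<lambda>s. Mmat k (x0 + s) ** A) has_vector_derivative
      (BQ p q ?x ** Mmat k ?x - of_nat k *\<^sub>R tau (Mmat (k - 1) ?x)) ** A) (at s within {s. x0 + s \<in> {0..b}})" for k and A :: cmat2
    by (rule bounded_linear.has_vector_derivative[OF mm.bounded_linear_left Mmat_shift_deriv[OF x]])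
  have split: "(BQ p q ?x ** M - r *\<^sub>R tau M') ** A
      = BQ p q ?x ** (M ** A) + r *\<^sub>R tau (M' ** tau A)" for M M' A :: cmat2 and r
    by (simp add: mm.diff_left mm.scaleR_left tau_mult matrix_mul_assoc[symmetric])
  have pow: "((\<lambda>s. of_nat (n choose k) * (t0 + \<sigma> * s) ^ k) has_real_derivative
      of_nat (n choose k) * (of_nat k * ?t ^ (k - 1)) * \<sigma>) (at s within {s. x0 + s \<in> {0..b}})" for k
    by (auto intro!: derivative_eq_intros simp: algebra_simps)
  have "((\<lambda>s. Kn n C (x0 + s) (t0 + \<sigma> * s)) has_vector_derivative
      (\<Sum>k\<le>n. (of_nat (n choose k) * ?t ^ k) *\<^sub>R
          ((BQ p q ?x ** Mmat (n - k) ?x - of_nat (n - k) *\<^sub>R tau (Mmat (n - k - 1) ?x)) ** (tau ^^ k) C)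
        + (of_nat (n choose k) * (of_nat k * ?t ^ (k - 1)) * \<sigma>) *\<^sub>R (Mmat (n - k) ?x ** (tau ^^ k) C)))
    (at s within {s. x0 + s \<in> {0..b}})"
    unfolding Kn_def
    by (intro has_vector_derivative_sum has_vector_derivative_scaleR pow mult)
  also have "(\<Sum>k\<le>n. (of_nat (n choose k) * ?t ^ k) *\<^sub>R
          ((BQ p q ?x ** Mmat (n - k) ?x - of_nat (n - k) *\<^sub>R tau (Mmat (n - k - 1) ?x)) ** (tau ^^ k) C)
        + (of_nat (n choose k) * (of_nat k * ?t ^ (k - 1)) * \<sigma>) *\<^sub>R (Mmat (n - k) ?x ** (tau ^^ k) C))
    = BQ p q ?x ** Kn n C ?x ?t
      + (\<Sum>k\<le>n. (of_nat (n choose k) * ?t ^ k * of_nat (n - k)) *\<^sub>R tau (Mmat (n - k - 1) ?x ** tau ((tau ^^ k) C)))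
      + \<sigma> *\<^sub>R (\<Sum>k\<le>n. (of_nat (n choose k) * (of_nat k * ?t ^ (k - 1))) *\<^sub>R (Mmat (n - k) ?x ** (tau ^^ k) C))"
    unfolding Kn_def mm.sum_right scaleR_sum_right sum.distrib[symmetric] split
    by (rule sum.cong) (simp_all add: scaleR_right_distrib mm.scaleR_right mult.commute)
  also have "\<dots> = BQ p q ?x ** Kn n C ?x ?t + tau W + \<sigma> *\<^sub>R W"
    by (simp only: Kn_dt_sum[symmetric] tau_simps(3,6)[symmetric] Kn_dx_sum[symmetric] W_def)
  finally show ?thesis .
qed

definition KN :: "nat \<Rightarrow> (nat \<Rightarrow> cmat2) \<Rightarrow> real \<Rightarrow> real \<Rightarrow> cmat2" where
  "KN N C x t = (\<Sum>n\<le>N. Kn n (C n) x t)"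

text \<open>The derivative of \<open>KN\<close> with respect to its last argument.\<close>
definition KNt :: "nat \<Rightarrow> (nat \<Rightarrow> cmat2) \<Rightarrow> real \<Rightarrow> real \<Rightarrow> cmat2" where
  "KNt N C x t = (\<Sum>n\<le>N. of_nat n *\<^sub>R Kn (n - 1) (tau (C n)) x t)"

lemma KN_line_deriv:
  assumes x: "x0 + s \<in> {0..b}"
  shows "((\<lambda>s. KN N C (x0 + s) (t0 + \<sigma> * s)) has_vector_derivative
      BQ p q (x0 + s) ** KN N C (x0 + s) (t0 + \<sigma> * s) + tau (KNt N C (x0 + s) (t0 + \<sigma> * s))
        + \<sigma> *\<^sub>R KNt N C (x0 + s) (t0 + \<sigma> * s))
    (at s within {s. x0 + s \<in> {0..b}})"
proof -
  have "((\<lambda>s. KN N C (x0 + s) (t0 + \<sigma> * s)) has_vector_derivative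
    (\<Sum>n\<le>N. BQ p q (x0 + s) ** Kn n (C n) (x0 + s) (t0 + \<sigma> * s)
      + tau (of_nat n *\<^sub>R Kn (n - 1) (tau (C n)) (x0 + s) (t0 + \<sigma> * s))
      + \<sigma> *\<^sub>R (of_nat n *\<^sub>R Kn (n - 1) (tau (C n)) (x0 + s) (t0 + \<sigma> * s))))
    (at s within {s. x0 + s \<in> {0..b}})"
    unfolding KN_def by (intro has_vector_derivative_sum Kn_line_deriv x)
  then show ?thesis
    by (simp add: KN_def KNt_def mm.sum_right tau_simps scaleR_sum_right sum.distrib)
qed

lemma Kn_0: "Kn n C 0 t = t ^ n *\<^sub>R (tau ^^ n) C"
proof -
  have "Kn n C 0 t = (\<Sum>k\<le>n. if k = n then t ^ n *\<^sub>R (tau ^^ n) C else 0)"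
    unfolding Kn_def by (rule sum.cong) (auto simp: Mmat_0)
  then show ?thesis by simp
qed

lemma cont_Mmat: "continuous_on {0..b} (Mmat k)"
  by (rule continuous_on_vector_derivative, erule Mmat_deriv)

lemma Kn_linear: "Kn n (A + B) x t = Kn n A x t + Kn n B x t" "Kn n (A - B) x t = Kn n A x t - Kn n B x t"
   "Kn n (r *\<^sub>R A) x t = r *\<^sub>R Kn n A x t" "Kn n 0 x t = 0"
proof -
  have l: "linear ((tau ^^ k))" for k
  proof (induction k)
    case (Suc k)
    then show ?case using linear_compose[OF Suc tau_linear] by (simp add: o_def)
  qed (simp add: linear_iff)
  show "Kn n (A + B) x t = Kn n A x t + Kn n B x t" "Kn n (A - B) x t = Kn n A x t - Kn n B x t"
   "Kn n (r *\<^sub>R A) x t = r *\<^sub>R Kn n A x t" "Kn n 0 x t = 0"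
    by (simp_all add: Kn_def linear_add[OF l] linear_diff[OF l] linear_scale[OF l] linear_0[OF l]
        mm.add_right mm.diff_right mm.scaleR_right scaleR_right_distrib scaleR_right_diff_distrib
        sum.distrib sum_subtractf scaleR_sum_right mult.left_commute mult.commute)
qed

lemma cont_Kn:
  assumes "continuous_on S u" "continuous_on S v" "u ` S \<subseteq> {0..b}"
  shows "continuous_on S (\<lambda>z. Kn n C (u z) (v z))"
  unfolding Kn_def
  by (intro continuous_intros assms continuous_on_compose2[OF cont_Mmat])

lemma cont_KN:
  assumes "continuous_on S u" "continuous_on S v" "u ` S \<subseteq> {0..b}"
  shows "continuous_on S (\<lambda>z. KN N C (u z) (v z))" "continuous_on S (\<lambda>z. KNt N C (u z) (v z))"
  unfolding KN_def KNt_def by (intro continuous_intros cont_Kn assms)+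

text \<open>\<open>gtrace\<close> is the Goursat data of a solution, \<open>cotrace\<close> the components on the same two lines
  that are not prescribed.\<close>
definition gtrace :: "(real \<Rightarrow> real \<Rightarrow> cmat2) \<Rightarrow> real \<Rightarrow> cmat2" where
  "gtrace K x = Pplus (K x x) + Pminus (K x (- x))"

definition cotrace :: "(real \<Rightarrow> real \<Rightarrow> cmat2) \<Rightarrow> real \<Rightarrow> cmat2" where
  "cotrace K x = Pminus (K x x) + Pplus (K x (- x))"

text \<open>Each diagonal is characteristic for one component, whose derivative therefore contains
  no \<open>KNt\<close>; the other component meets it with the factor 2.\<close>

lemma P_KN_diag_deriv:
  assumes x: "x \<in> {0..b}"
  shows "((\<lambda>x. Pplus (KN N C x x)) has_vector_derivative BQ p q x ** Pminus (KN N C x x) + 2 *\<^sub>R Pplus (KNt N C x x)) (at x within {0..b})"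
    "((\<lambda>x. Pminus (KN N C x x)) has_vector_derivative BQ p q x ** Pplus (KN N C x x)) (at x within {0..b})"
    "((\<lambda>x. Pplus (KN N C x (- x))) has_vector_derivative BQ p q x ** Pminus (KN N C x (- x))) (at x within {0..b})"
    "((\<lambda>x. Pminus (KN N C x (- x))) has_vector_derivative BQ p q x ** Pplus (KN N C x (- x)) - 2 *\<^sub>R Pminus (KNt N C x (- x))) (at x within {0..b})"
  using has_vector_derivative_Pplus[OF KN_line_deriv[of 0 x N C 0 1]]
    has_vector_derivative_Pminus[OF KN_line_deriv[of 0 x N C 0 1]]
    has_vector_derivative_Pplus[OF KN_line_deriv[of 0 x N C 0 "-1"]]
    has_vector_derivative_Pminus[OF KN_line_deriv[of 0 x N C 0 "-1"]] x
  by (simp_all add: Pplus_simps Pminus_simps scaleR_2 algebra_simps flip: atLeastAtMost_iff)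

text \<open>Together with \<open>cotrace_KN_deriv\<close> this is a closed system for the two traces
  once the trace of the t-derivative is given; it dictates the operator used in the induction on
  r.\<close>

lemma gtrace_KN_deriv:
  assumes x: "x \<in> {0..b}"
  shows "(gtrace (KN N C) has_vector_derivative
      BQ p q x ** cotrace (KN N C) x + 2 *\<^sub>R tau (gtrace (KNt N C) x)) (at x within {0..b})"
proof -
  have "((\<lambda>x. Pplus (KN N C x x) + Pminus (KN N C x (- x))) has_vector_derivative
     (BQ p q x ** Pminus (KN N C x x) + 2 *\<^sub>R Pplus (KNt N C x x)) +
     (BQ p q x ** Pplus (KN N C x (- x)) - 2 *\<^sub>R Pminus (KNt N C x (- x)))) (at x within {0..b})"
    by (intro has_vector_derivative_add P_KN_diag_deriv x)
  then show ?thesis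
    by (simp add: gtrace_def[abs_def] cotrace_def mm.add_right tau_simps algebra_simps)
qed

lemma cotrace_KN_deriv:
  assumes x: "x \<in> {0..b}"
  shows "(cotrace (KN N C) has_vector_derivative BQ p q x ** gtrace (KN N C) x) (at x within {0..b})"
proof -
  have "((\<lambda>x. Pminus (KN N C x x) + Pplus (KN N C x (- x))) has_vector_derivative
     BQ p q x ** Pplus (KN N C x x) + BQ p q x ** Pminus (KN N C x (- x))) (at x within {0..b})"
    by (intro has_vector_derivative_add P_KN_diag_deriv x)
  then show ?thesis
    by (simp add: gtrace_def cotrace_def[abs_def] mm.add_right)
qed

section \<open>Stability of the Goursat and Cauchy problems\<close>

lemma cont_BQ: "continuous_on {0..b} (BQ p q)"
  unfolding BQ_def[abs_def] by (intro continuous_intros cont_Qmat)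

lemma BQ_bound_exists: "\<exists>M>0. \<forall>x\<in>{0..b}. \<forall>A :: cmat2. norm (BQ p q x ** A) \<le> M * norm A"
proof -
  obtain m where m: "\<And>x. x \<in> {0..b} \<Longrightarrow> norm (BQ p q x) \<le> m"
    using compact_continuous_image[OF cont_BQ compact_Icc] compact_imp_bounded bounded_iff
    by (metis (no_types, lifting) imageI)
  have "norm (BQ p q x ** A) \<le> (8 * \<bar>m\<bar> + 1) * norm A" if "x \<in> {0..b}" for x and A :: cmat2
  proof -
    have "norm (BQ p q x ** A) \<le> norm (BQ p q x) * norm A * 8" by (rule norm_matrix_mult_le)
    also have "\<dots> \<le> \<bar>m\<bar> * norm A * 8"
      using m[OF that] by (intro mult_right_mono) auto
    also have "\<dots> \<le> (8 * \<bar>m\<bar> + 1) * norm A" by (simp add: algebra_simps)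
    finally show ?thesis .
  qed
  then show ?thesis by (intro exI[of _ "8 * \<bar>m\<bar> + 1"]) auto
qed

definition MQ :: real where
  "MQ = (SOME M. M > 0 \<and> (\<forall>x\<in>{0..b}. \<forall>A :: cmat2. norm (BQ p q x ** A) \<le> M * norm A))"

lemma MQ_pos: "MQ > 0"
  and norm_BQ_mult_le: "x \<in> {0..b} \<Longrightarrow> norm (BQ p q x ** (A :: cmat2)) \<le> MQ * norm A"
  using someI_ex[OF BQ_bound_exists] unfolding MQ_def by blast+

text \<open>The constant 2 A exp (4 M b) of \<open>Volterra_bound\<close> for A = 2
  \<open>MQ\<close>, one \<open>MQ\<close> from each of the two integrals.\<close>

definition CV :: real where "CV = 4 * MQ * exp (4 * MQ * b)"

lemma CV_pos: "CV > 0"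
  using MQ_pos by (simp add: CV_def)

text \<open>After subtraction of the free terms the remainder solves a Volterra equation whose
  inhomogeneity is an integral of \<open>\<rho>\<close>; hence a sup bound by an L1 norm. Domain and
  lower limits are general so that data on the two diagonals and data on an initial line are both
  covered.\<close>

lemma Goursat_estimate:
  fixes H :: "real \<Rightarrow> real \<Rightarrow> cmat2"
  assumes T: "compact T" and sum: "\<And>x y. (x, y) \<in> T \<Longrightarrow> 0 \<le> x + y \<and> x + y \<le> b"
    and l: "\<And>x y. (x, y) \<in> T \<Longrightarrow> l x \<le> y" "\<And>x y v. (x, y) \<in> T \<Longrightarrow> v \<in> {l x..y} \<Longrightarrow> (x, v) \<in> T"
    and m: "\<And>x y. (x, y) \<in> T \<Longrightarrow> m y \<le> x" "\<And>x y u. (x, y) \<in> T \<Longrightarrow> u \<in> {m y..x} \<Longrightarrow> (u, y) \<in> T"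
    and range: "\<And>x y. (x, y) \<in> T \<Longrightarrow> {l x..y} \<subseteq> {lo..hi} \<and> {m y..x} \<subseteq> {lo..hi}"
    and contH: "continuous_on T (\<lambda>(x, y). H x y)" and cont\<rho>: "continuous_on {lo..hi} \<rho>"
    and eq: "\<And>x y. (x, y) \<in> T \<Longrightarrow> H x y = Pplus (\<rho> x) + Pminus (\<rho> y)
        + integral {l x..y} (\<lambda>v. BQ p q (x + v) ** Pminus (H x v))
        + integral {m y..x} (\<lambda>u. BQ p q (u + y) ** Pplus (H u y))"
    and xy: "(x, y) \<in> T"
  shows "norm (H x y - Pplus (\<rho> x) - Pminus (\<rho> y)) \<le> CV * integral {lo..hi} (\<lambda>s. norm (\<rho> s))"
proof -
  define G where "G x y = H x y - Pplus (\<rho> x) - Pminus (\<rho> y)" for x y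
  define R where "R = integral {lo..hi} (\<lambda>s. norm (\<rho> s))"
  have in_range: "x \<in> {lo..hi} \<and> y \<in> {lo..hi}" if "(x, y) \<in> T" for x y
    using range[OF that] l(1)[OF that] m(1)[OF that] by force
  have contG: "continuous_on T (\<lambda>(x, y). G x y)"
  proof -
    have "continuous_on T (\<lambda>z. (\<lambda>(x, y). H x y) z - Pplus (\<rho> (fst z)) - Pminus (\<rho> (snd z)))"
      using in_range
      by (intro continuous_intros contH continuous_on_compose2[OF cont\<rho>]) auto
    then show ?thesis by (simp add: G_def case_prod_unfold)
  qed
  have cont1: "continuous_on {l x..y} (\<lambda>v. J x v)" if "continuous_on T (\<lambda>(x, y). J x y)" "(x, y) \<in> T"
    for x y and J :: "real \<Rightarrow> real \<Rightarrow> cmat2"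
    by (rule continuous_on_compose2[OF that(1), of "{l x..y}" "\<lambda>v. (x, v)", simplified])
      (use l(2)[OF that(2)] in \<open>auto intro!: continuous_intros\<close>)
  have cont2: "continuous_on {m y..x} (\<lambda>u. J u y)" if "continuous_on T (\<lambda>(x, y). J x y)" "(x, y) \<in> T"
    for x y and J :: "real \<Rightarrow> real \<Rightarrow> cmat2"
    by (rule continuous_on_compose2[OF that(1), of "{m y..x}" "\<lambda>u. (u, y)", simplified])
      (use m(2)[OF that(2)] in \<open>auto intro!: continuous_intros\<close>)
  have R_le: "integral {c..d} (\<lambda>s. norm (\<rho> s)) \<le> R" if "{c..d} \<subseteq> {lo..hi}" for c d
    unfolding R_def
    using that
    by (intro integral_subset_le integrable_continuous_real continuous_intros cont\<rho> continuous_on_subset[OF cont\<rho>]) auto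
  have norm_le: "norm (integral {c..d} F) \<le> MQ * R + MQ * integral {c..d} \<phi>"
    if F: "continuous_on {c..d} F" and \<phi>: "continuous_on {c..d} \<phi>" and cd: "{c..d} \<subseteq> {lo..hi}"
      and le: "\<And>v. v \<in> {c..d} \<Longrightarrow> norm (F v) \<le> MQ * (norm (\<rho> v) + \<phi> v)"
    for c d and F :: "real \<Rightarrow> cmat2" and \<phi> :: "real \<Rightarrow> real"
  proof -
    note c\<rho> = continuous_on_subset[OF cont\<rho> cd]
    have "norm (integral {c..d} F) \<le> integral {c..d} (\<lambda>v. MQ * (norm (\<rho> v) + \<phi> v))"
      by (intro integral_norm_bound_integral integrable_continuous_real continuous_intros F \<phi> c\<rho> le)
    also have "\<dots> = MQ * (integral {c..d} (\<lambda>v. norm (\<rho> v)) + integral {c..d} \<phi>)"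
      by (subst integral_mult_right, subst integral_add)
        (auto intro!: integrable_continuous_real continuous_intros \<phi> c\<rho>)
    also have "\<dots> \<le> MQ * (R + integral {c..d} \<phi>)"
      using R_le[OF cd] MQ_pos by (intro mult_left_mono) auto
    finally show ?thesis by (simp add: distrib_left)
  qed
  have "norm (G x y) \<le> 2 * (2 * MQ * R) * exp (4 * MQ * b)"
  proof (rule Volterra_bound[OF T _ sum MQ_pos _ l m _ xy])
    show "continuous_on T (\<lambda>(x, y). norm (G x y))"
      using continuous_on_norm[OF contG] by (simp add: case_prod_unfold)
    have "0 \<le> R" unfolding R_def by (rule integral_nonneg) (auto intro!: integrable_continuous_real continuous_intros cont\<rho>)
    then show "0 \<le> 2 * MQ * R" using MQ_pos by simp
    fix x y assume xy: "(x, y) \<in> T"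
    have G_eq: "G x y = integral {l x..y} (\<lambda>v. BQ p q (x + v) ** Pminus (H x v))
        + integral {m y..x} (\<lambda>u. BQ p q (u + y) ** Pplus (H u y))"
      using eq[OF xy] by (simp add: G_def)
    have "norm (integral {l x..y} (\<lambda>v. BQ p q (x + v) ** Pminus (H x v)))
        \<le> MQ * R + MQ * integral {l x..y} (\<lambda>v. norm (G x v))"
    proof (rule norm_le)
      show "continuous_on {l x..y} (\<lambda>v. BQ p q (x + v) ** Pminus (H x v))"
        using sum[OF l(2)[OF xy]]
        by (intro continuous_intros cont1[OF contH xy] continuous_on_compose2[OF cont_BQ] image_subsetI)
          (simp only: atLeastAtMost_iff)
      show "continuous_on {l x..y} (\<lambda>v. norm (G x v))"
        by (intro continuous_intros cont1[OF contG xy])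
      show "{l x..y} \<subseteq> {lo..hi}" using range[OF xy] by blast
      fix v assume v: "v \<in> {l x..y}"
      have "norm (BQ p q (x + v) ** Pminus (H x v)) \<le> MQ * norm (Pminus (H x v))"
        using sum[OF l(2)[OF xy v]] by (intro norm_BQ_mult_le) auto
      \<comment> \<open>\<open>Pminus\<close> annihilates \<open>Pplus (\<rho> x)\<close>, so the
        data enters only at the integration variable and its L1 norm suffices.\<close>
      also have "\<dots> = MQ * norm (Pminus (\<rho> v) + Pminus (G x v))"
        by (simp add: G_def Pminus_simps)
      also have "\<dots> \<le> MQ * (norm (\<rho> v) + norm (G x v))"
        using MQ_pos by (intro mult_left_mono norm_triangle_le add_mono norm_P_le) simp
      finally show "norm (BQ p q (x + v) ** Pminus (H x v)) \<le> MQ * (norm (\<rho> v) + norm (G x v))" .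
    qed
    moreover have "norm (integral {m y..x} (\<lambda>u. BQ p q (u + y) ** Pplus (H u y)))
        \<le> MQ * R + MQ * integral {m y..x} (\<lambda>u. norm (G u y))"
    proof (rule norm_le)
      show "continuous_on {m y..x} (\<lambda>u. BQ p q (u + y) ** Pplus (H u y))"
        using sum[OF m(2)[OF xy]]
        by (intro continuous_intros cont2[OF contH xy] continuous_on_compose2[OF cont_BQ] image_subsetI)
          (simp only: atLeastAtMost_iff)
      show "continuous_on {m y..x} (\<lambda>u. norm (G u y))"
        by (intro continuous_intros cont2[OF contG xy])
      show "{m y..x} \<subseteq> {lo..hi}" using range[OF xy] by blast
      fix u assume u: "u \<in> {m y..x}"
      have "norm (BQ p q (u + y) ** Pplus (H u y)) \<le> MQ * norm (Pplus (H u y))"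
        using sum[OF m(2)[OF xy u]] by (intro norm_BQ_mult_le) auto
      also have "\<dots> = MQ * norm (Pplus (\<rho> u) + Pplus (G u y))"
        by (simp add: G_def Pplus_simps)
      also have "\<dots> \<le> MQ * (norm (\<rho> u) + norm (G u y))"
        using MQ_pos by (intro mult_left_mono norm_triangle_le add_mono norm_P_le) simp
      finally show "norm (BQ p q (u + y) ** Pplus (H u y)) \<le> MQ * (norm (\<rho> u) + norm (G u y))" .
    qed
    moreover have "norm (G x y) \<le> norm (integral {l x..y} (\<lambda>v. BQ p q (x + v) ** Pminus (H x v)))
        + norm (integral {m y..x} (\<lambda>u. BQ p q (u + y) ** Pplus (H u y)))"
      unfolding G_eq by (rule norm_triangle_ineq)
    ultimately show "norm (G x y) \<le> 2 * MQ * R + MQ * integral {l x..y} (\<lambda>v. norm (G x v))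
        + MQ * integral {m y..x} (\<lambda>u. norm (G u y))"
      by linarith
  qed
  then show ?thesis by (simp add: G_def R_def CV_def mult_ac)
qed

text \<open>Integration of \<open>KN_line_deriv\<close> along the characteristics. The limit
  \<open>l = 0\<close> starts on a diagonal, \<open>l = - x\<close> on the initial line where the
  first argument of \<open>KN\<close> is 0.\<close>

lemma KN_mild:
  assumes "0 \<le> x + l" "l \<le> y" "x + y \<le> b"
  shows "Pplus (KN N C (x + y) (x - y)) = Pplus (KN N C (x + l) (x - l))
      + integral {l..y} (\<lambda>v. BQ p q (x + v) ** Pminus (KN N C (x + v) (x - v)))"
    and "Pminus (KN N C (y + x) (y - x)) = Pminus (KN N C (l + x) (l - x))
      + integral {l..y} (\<lambda>u. BQ p q (u + x) ** Pplus (KN N C (u + x) (u - x)))"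
proof -
  have sub: "{l..y} \<subseteq> {s. x + s \<in> {0..b}}" using assms by auto
  have "((\<lambda>s. Pplus (KN N C (x + s) (x - s))) has_vector_derivative
      BQ p q (x + s) ** Pminus (KN N C (x + s) (x - s))) (at s within {l..y})" if "s \<in> {l..y}" for s
    using has_vector_derivative_Pplus[OF KN_line_deriv[of x s N C x "-1"]] that sub
    by (intro has_vector_derivative_within_subset[OF _ sub]) (auto simp: Pplus_simps)
  from fundamental_theorem_of_calculus[OF assms(2) this]
  show "Pplus (KN N C (x + y) (x - y)) = Pplus (KN N C (x + l) (x - l))
      + integral {l..y} (\<lambda>v. BQ p q (x + v) ** Pminus (KN N C (x + v) (x - v)))"
    by (simp add: has_integral_iff algebra_simps)
  have "((\<lambda>s. Pminus (KN N C (s + x) (s - x))) has_vector_derivative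
      BQ p q (s + x) ** Pplus (KN N C (s + x) (s - x))) (at s within {l..y})" if "s \<in> {l..y}" for s
    using has_vector_derivative_Pminus[OF KN_line_deriv[of x s N C "-x" 1]] that sub
    by (intro has_vector_derivative_within_subset[OF _ sub]) (auto simp: Pminus_simps add.commute)
  from fundamental_theorem_of_calculus[OF assms(2) this]
  show "Pminus (KN N C (y + x) (y - x)) = Pminus (KN N C (l + x) (l - x))
      + integral {l..y} (\<lambda>u. BQ p q (u + x) ** Pplus (KN N C (u + x) (u - x)))"
    by (simp add: has_integral_iff algebra_simps)
qed

end

text \<open>The scaling by 2 makes \<open>mpoly2\<close> the leading part of the Goursat data of \<open>KN\<close>.\<close>
definition mpoly2 :: "nat \<Rightarrow> (nat \<Rightarrow> cmat2) \<Rightarrow> real \<Rightarrow> cmat2" where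
  "mpoly2 N C s = (\<Sum>n\<le>N. (2 * s) ^ n *\<^sub>R C n)"

lemma cont_mpoly2: "continuous_on S (mpoly2 N C)"
  unfolding mpoly2_def[abs_def] by (intro continuous_intros)

context dirac
begin

text \<open>On the \<open>Pminus\<close> component the n-th power of \<open>tau\<close> contributes
  (-1)^n, which cancels the sign of the argument - 2 s. Both components thus see the same
  polynomial.\<close>

lemma KN_0: "Pplus (KN N C 0 (2 * s)) = Pplus (mpoly2 N C s)"
  "Pminus (KN N C 0 (- (2 * s))) = Pminus (mpoly2 N C s)"
proof -
  have "(- (2 * s)) ^ n * (- 1) ^ n = (2 * s) ^ n" for n
    unfolding power_mult_distrib[symmetric] by simp
  then show "Pplus (KN N C 0 (2 * s)) = Pplus (mpoly2 N C s)"
    "Pminus (KN N C 0 (- (2 * s))) = Pminus (mpoly2 N C s)"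
    unfolding KN_def Kn_0 mpoly2_def Pplus_simps Pminus_simps P_tau_pow scaleR_scaleR by simp_all
qed

text \<open>\<open>Goursat_estimate\<close> also covers the Cauchy problem: the lower limits move to \<open>x = 0\<close>.\<close>
lemma gtrace_minus_mpoly2:
  assumes X: "X \<in> {0..b}"
  shows "norm (gtrace (KN N C) X - mpoly2 N C X) \<le> 2 * CV * integral {-X..X} (\<lambda>s. norm (mpoly2 N C s))"
proof -
  \<comment> \<open>Contains the domains of dependence of (X, 0) and (0, X), the two points at which
    the trace at \<open>X\<close> is read; on its base x + y = 0 both coordinates range over
    [-X, X].\<close>
  define T where "T = {(x, y). x \<le> X \<and> y \<le> X \<and> 0 \<le> x + y \<and> x + y \<le> b}"
  define H where "H x y = KN N C (x + y) (x - y)" for x y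
  have T_eq: "T = {z. fst z \<le> X} \<inter> {z. snd z \<le> X} \<inter> {z. 0 \<le> fst z + snd z} \<inter> {z. fst z + snd z \<le> b}"
    by (auto simp: T_def)
  have "closed T"
    unfolding T_eq by (intro closed_Int closed_Collect_le continuous_intros)
  moreover have "T \<subseteq> {-X..X} \<times> {-X..X}"
    by (auto simp: T_def)
  ultimately have "compact T"
    by (metis compact_Times compact_Icc compact_Int_closed inf.absorb2)
  have est: "norm (H x y - Pplus (mpoly2 N C x) - Pminus (mpoly2 N C y))
      \<le> CV * integral {-X..X} (\<lambda>s. norm (mpoly2 N C s))" if "(x, y) \<in> T" for x y
  proof (rule Goursat_estimate[where l = uminus and m = uminus, OF \<open>compact T\<close> _ _ _ _ _ _ _ cont_mpoly2 _ that])
    have "continuous_on T (\<lambda>z. KN N C (fst z + snd z) (fst z - snd z))"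
      by (intro cont_KN continuous_intros) (auto simp: T_def)
    then show "continuous_on T (\<lambda>(x, y). H x y)" by (simp add: H_def case_prod_unfold)
  next
    fix x y assume "(x, y) \<in> T"
    then have xy: "x \<le> X" "y \<le> X" "0 \<le> x + y" "x + y \<le> b" by (auto simp: T_def)
    have "H x y = Pplus (H x y) + Pminus (H x y)" by simp
    also have "Pplus (H x y) = Pplus (mpoly2 N C x) + integral {- x..y} (\<lambda>v. BQ p q (x + v) ** Pminus (H x v))"
      unfolding H_def using KN_mild(1)[of x "- x" y N C] xy by (simp add: KN_0)
    also have "Pminus (H x y) = Pminus (mpoly2 N C y) + integral {- y..x} (\<lambda>u. BQ p q (u + y) ** Pplus (H u y))"
      unfolding H_def using KN_mild(2)[of y "- y" x N C] xy KN_0(2)[of N C y] by (simp add: add.commute)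
    finally show "H x y = Pplus (mpoly2 N C x) + Pminus (mpoly2 N C y)
        + integral {- x..y} (\<lambda>v. BQ p q (x + v) ** Pminus (H x v))
        + integral {- y..x} (\<lambda>u. BQ p q (u + y) ** Pplus (H u y))" by simp
  qed (auto simp: T_def)
  have "gtrace (KN N C) X - mpoly2 N C X
      = Pplus (H X 0 - Pplus (mpoly2 N C X) - Pminus (mpoly2 N C 0))
        + Pminus (H 0 X - Pplus (mpoly2 N C 0) - Pminus (mpoly2 N C X))"
    using Pplus_plus_Pminus[of "mpoly2 N C X"]
    by (simp add: gtrace_def H_def Pplus_simps Pminus_simps algebra_simps)
  also have "norm \<dots> \<le> norm (H X 0 - Pplus (mpoly2 N C X) - Pminus (mpoly2 N C 0))
        + norm (H 0 X - Pplus (mpoly2 N C 0) - Pminus (mpoly2 N C X))"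
    by (intro norm_triangle_le add_mono norm_P_le)
  also have "\<dots> \<le> CV * integral {-X..X} (\<lambda>s. norm (mpoly2 N C s)) + CV * integral {-X..X} (\<lambda>s. norm (mpoly2 N C s))"
    using X by (intro add_mono est) (auto simp: T_def)
  finally show ?thesis by simp
qed

section \<open>Kernel error in terms of the Goursat residual\<close>

lemma cont_gtrace_KN: "continuous_on {0..b} (gtrace (KN N C))"
  by (rule continuous_on_vector_derivative, erule gtrace_KN_deriv)

text \<open>The substitution maps [-x, x] onto [0, x] and halves lengths, so the squares gain a
  factor 2; its root is rounded up to 2.\<close>

lemma L2norm_average_le:
  assumes c: "continuous_on {0..b} \<rho>" and x: "x \<in> {0..b}" and \<sigma>: "\<sigma> = 1 \<or> \<sigma> = -1"
  shows "L2norm (- x) x (\<lambda>t. \<rho> ((x + \<sigma> * t) / 2)) \<le> 2 * L2norm 0 b \<rho>"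
proof (rule power2_le_imp_le)
  let ?n = "\<lambda>s. (norm (\<rho> s))\<^sup>2"
  let ?u = "\<lambda>t. (x + \<sigma> * t) / 2"
  have cn: "continuous_on {0..x} ?n"
    using x by (intro continuous_intros continuous_on_subset[OF c]) auto
  have "((\<lambda>t. (\<sigma> / 2) *\<^sub>R ?n (?u t)) has_integral
      (integral {?u (- x)..?u x} ?n - integral {?u x..?u (- x)} ?n)) {- x..x}"
    by (rule has_integral_substitution_general[of "{}", OF _ _ _ cn])
      (use x \<sigma> in \<open>auto intro!: derivative_eq_intros continuous_intros\<close>)
  then have "((\<lambda>t. (\<sigma> * 2) *\<^sub>R ((\<sigma> / 2) *\<^sub>R ?n (?u t))) has_integral (\<sigma> * 2) *\<^sub>R (\<sigma> *\<^sub>R integral {0..x} ?n)) {- x..x}"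
    using \<sigma> x by (intro has_integral_cmul) (cases "x = 0"; auto)
  then have "((\<lambda>t. ?n (?u t)) has_integral 2 * integral {0..x} ?n) {- x..x}"
    using \<sigma> by auto
  then have "(L2norm (- x) x (\<lambda>t. \<rho> (?u t)))\<^sup>2 = 2 * integral {0..x} ?n"
    unfolding L2norm_square by (rule integral_unique)
  also have "\<dots> \<le> 2 * integral {0..b} ?n"
    using x by (intro mult_left_mono integral_subset_le integrable_norm_square c continuous_on_subset[OF c]) auto
  also have "\<dots> = 2 * (L2norm 0 b \<rho>)\<^sup>2" by (simp add: L2norm_square)
  also have "\<dots> \<le> (2 * L2norm 0 b \<rho>)\<^sup>2" by (simp add: power_mult_distrib)
  finally show "(L2norm (- x) x (\<lambda>t. \<rho> (?u t)))\<^sup>2 \<le> (2 * L2norm 0 b \<rho>)\<^sup>2" .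
qed (simp add: L2norm_nonneg)

text \<open>The mild equations of the two kernels differ only in their data, so
  \<open>Goursat_estimate\<close> applies to the difference. The two free terms account for 4, the
  remainder, bounded in the sup norm, for 2 b \<open>CV\<close>.\<close>

lemma kernel_difference:
  assumes K: "transmutation_kernel b p q K" and x: "x \<in> {0..b}"
  shows "L2norm (- x) x (\<lambda>t. K x t - KN N C x t)
    \<le> (4 + 2 * b * CV) * L2norm 0 b (\<lambda>s. (1/2) *\<^sub>R BQ p q s - gtrace (KN N C) s)"
proof -
  define \<rho> where "\<rho> = (\<lambda>s. (1/2) *\<^sub>R BQ p q s - gtrace (KN N C) s)"
  define T where "T = {(\<xi>, \<eta>). 0 \<le> \<xi> \<and> 0 \<le> \<eta> \<and> \<xi> + \<eta> \<le> b}"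
  define HK where "HK \<xi> \<eta> = K (\<xi> + \<eta>) (\<xi> - \<eta>)" for \<xi> \<eta>
  define HN where "HN \<xi> \<eta> = KN N C (\<xi> + \<eta>) (\<xi> - \<eta>)" for \<xi> \<eta>
  define H where "H \<xi> \<eta> = HK \<xi> \<eta> - HN \<xi> \<eta>" for \<xi> \<eta>
  have contHK: "continuous_on T (\<lambda>(\<xi>, \<eta>). HK \<xi> \<eta>)"
    and HK: "\<And>\<xi> \<eta>. (\<xi>, \<eta>) \<in> T \<Longrightarrow> HK \<xi> \<eta> = (1/2) *\<^sub>R BQ p q \<xi>
        + integral {0..\<xi>} (\<lambda>u. BQ p q (u + \<eta>) ** Pplus (HK u \<eta>))
        + integral {0..\<eta>} (\<lambda>v. BQ p q (\<xi> + v) ** Pminus (HK \<xi> v))"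
    using K by (auto simp: transmutation_kernel_def Let_def T_def HK_def BQ_def)
  have contHN: "continuous_on T (\<lambda>(\<xi>, \<eta>). HN \<xi> \<eta>)"
  proof -
    have "continuous_on T (\<lambda>z. KN N C (fst z + snd z) (fst z - snd z))"
      by (intro cont_KN continuous_intros) (auto simp: T_def)
    then show ?thesis by (simp add: HN_def case_prod_unfold)
  qed
  have contH: "continuous_on T (\<lambda>(\<xi>, \<eta>). H \<xi> \<eta>)"
    using continuous_on_diff[OF contHK contHN] by (simp add: H_def case_prod_unfold)
  have cont\<rho>: "continuous_on {0..b} \<rho>"
    unfolding \<rho>_def by (intro continuous_intros cont_BQ cont_gtrace_KN)
  have T_eq: "T = {z. 0 \<le> fst z} \<inter> {z. 0 \<le> snd z} \<inter> {z. fst z + snd z \<le> b}"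
    by (auto simp: T_def)
  have "closed T"
    unfolding T_eq by (intro closed_Int closed_Collect_le continuous_intros)
  moreover have "T \<subseteq> {0..b} \<times> {0..b}"
    by (auto simp: T_def)
  ultimately have "compact T"
    by (metis compact_Times compact_Icc compact_Int_closed inf.absorb2)
  have seg: "(\<xi>, v) \<in> T" if "(\<xi>, \<eta>) \<in> T" "v \<in> {0..\<eta>}" for \<xi> \<eta> v using that by (auto simp: T_def)
  have seg': "(u, \<eta>) \<in> T" if "(\<xi>, \<eta>) \<in> T" "u \<in> {0..\<xi>}" for \<xi> \<eta> u using that by (auto simp: T_def)
  have cont1: "continuous_on {0..\<eta>} (\<lambda>v. BQ p q (\<xi> + v) ** Pminus (J \<xi> v))"
    if "continuous_on T (\<lambda>(\<xi>, \<eta>). J \<xi> \<eta>)" "(\<xi>, \<eta>) \<in> T" for \<xi> \<eta> and J :: "real \<Rightarrow> real \<Rightarrow> cmat2"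
  proof -
    have "continuous_on {0..\<eta>} (\<lambda>v. J \<xi> v)"
      by (rule continuous_on_compose2[OF that(1), of _ "\<lambda>v. (\<xi>, v)", simplified])
        (use seg[OF that(2)] in \<open>auto intro!: continuous_intros\<close>)
    then show ?thesis
      using that(2) by (intro continuous_intros continuous_on_compose2[OF cont_BQ]) (auto simp: T_def)
  qed
  have cont2: "continuous_on {0..\<xi>} (\<lambda>u. BQ p q (u + \<eta>) ** Pplus (J u \<eta>))"
    if "continuous_on T (\<lambda>(\<xi>, \<eta>). J \<xi> \<eta>)" "(\<xi>, \<eta>) \<in> T" for \<xi> \<eta> and J :: "real \<Rightarrow> real \<Rightarrow> cmat2"
  proof -
    have "continuous_on {0..\<xi>} (\<lambda>u. J u \<eta>)"
      by (rule continuous_on_compose2[OF that(1), of _ "\<lambda>u. (u, \<eta>)", simplified])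
        (use seg'[OF that(2)] in \<open>auto intro!: continuous_intros\<close>)
    then show ?thesis
      using that(2) by (intro continuous_intros continuous_on_compose2[OF cont_BQ]) (auto simp: T_def)
  qed
  define R where "R = integral {0..b} (\<lambda>s. norm (\<rho> s))"
  have est: "norm (H \<xi> \<eta> - Pplus (\<rho> \<xi>) - Pminus (\<rho> \<eta>)) \<le> CV * R" if "(\<xi>, \<eta>) \<in> T" for \<xi> \<eta>
    unfolding R_def
  proof (rule Goursat_estimate[where l = "\<lambda>_. 0" and m = "\<lambda>_. 0", OF \<open>compact T\<close> _ _ _ _ _ _ contH cont\<rho> _ that])
    fix \<xi> \<eta> assume T: "(\<xi>, \<eta>) \<in> T"
    then have le: "0 \<le> \<xi>" "0 \<le> \<eta>" "\<xi> + \<eta> \<le> b" by (auto simp: T_def)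
    have "HN \<xi> \<eta> = Pplus (HN \<xi> \<eta>) + Pminus (HN \<xi> \<eta>)" by simp
    also have "Pplus (HN \<xi> \<eta>) = Pplus (gtrace (KN N C) \<xi>) + integral {0..\<eta>} (\<lambda>v. BQ p q (\<xi> + v) ** Pminus (HN \<xi> v))"
      unfolding HN_def using KN_mild(1)[of \<xi> 0 \<eta> N C] le by (simp add: gtrace_def Pplus_simps)
    also have "Pminus (HN \<xi> \<eta>) = Pminus (gtrace (KN N C) \<eta>) + integral {0..\<xi>} (\<lambda>u. BQ p q (u + \<eta>) ** Pplus (HN u \<eta>))"
      unfolding HN_def using KN_mild(2)[of \<eta> 0 \<xi> N C] le by (simp add: gtrace_def Pminus_simps add.commute)
    finally have HN: "HN \<xi> \<eta> = Pplus (gtrace (KN N C) \<xi>) + integral {0..\<eta>} (\<lambda>v. BQ p q (\<xi> + v) ** Pminus (HN \<xi> v))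
      + (Pminus (gtrace (KN N C) \<eta>) + integral {0..\<xi>} (\<lambda>u. BQ p q (u + \<eta>) ** Pplus (HN u \<eta>)))" .
    have "integral {0..\<eta>} (\<lambda>v. BQ p q (\<xi> + v) ** Pminus (H \<xi> v))
      = integral {0..\<eta>} (\<lambda>v. BQ p q (\<xi> + v) ** Pminus (HK \<xi> v)) - integral {0..\<eta>} (\<lambda>v. BQ p q (\<xi> + v) ** Pminus (HN \<xi> v))"
      unfolding H_def Pminus_simps mm.diff_right
      by (intro integral_diff integrable_continuous_real cont1 contHK contHN T)
    moreover have "integral {0..\<xi>} (\<lambda>u. BQ p q (u + \<eta>) ** Pplus (H u \<eta>))
      = integral {0..\<xi>} (\<lambda>u. BQ p q (u + \<eta>) ** Pplus (HK u \<eta>)) - integral {0..\<xi>} (\<lambda>u. BQ p q (u + \<eta>) ** Pplus (HN u \<eta>))"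
      unfolding H_def Pplus_simps mm.diff_right
      by (intro integral_diff integrable_continuous_real cont2 contHK contHN T)
    \<comment> \<open>The data (1/2) BQ of K lies in the range of \<open>Pplus\<close>; on t = - x
      the data is zero.\<close>
    moreover have "Pplus (\<rho> \<xi>) = (1/2) *\<^sub>R BQ p q \<xi> - Pplus (gtrace (KN N C) \<xi>)"
      "Pminus (\<rho> \<eta>) = - Pminus (gtrace (KN N C) \<eta>)"
      by (simp_all add: \<rho>_def Pplus_simps Pminus_simps)
    ultimately show "H \<xi> \<eta> = Pplus (\<rho> \<xi>) + Pminus (\<rho> \<eta>)
        + integral {0..\<eta>} (\<lambda>v. BQ p q (\<xi> + v) ** Pminus (H \<xi> v))
        + integral {0..\<xi>} (\<lambda>u. BQ p q (u + \<eta>) ** Pplus (H u \<eta>))"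
      using HK[OF T] HN by (simp add: H_def)
  qed (auto simp: T_def)
  have R0: "0 \<le> R"
    unfolding R_def by (rule integral_nonneg) (auto intro!: integrable_continuous_real continuous_intros cont\<rho>)
  have R_le: "R \<le> sqrt b * L2norm 0 b \<rho>"
    unfolding R_def using integral_norm_le_L2norm[OF cont\<rho>] b_pos by simp
  define D where "D = (\<lambda>t. K x t - KN N C x t)"
  define D1 where "D1 = (\<lambda>t. \<rho> ((x + 1 * t) / 2))"
  define D2 where "D2 = (\<lambda>t. \<rho> ((x + (-1) * t) / 2))"
  obtain e :: cmat2 where e: "norm e = 1"
    using vector_choose_size[of 1] by auto
  define D3 where "D3 = (\<lambda>t::real. (CV * R) *\<^sub>R e)"
  have D_H: "D t = H ((x + t) / 2) ((x - t) / 2)" and in_T: "((x + t) / 2, (x - t) / 2) \<in> T" if "t \<in> {- x..x}" for t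
  proof -
    have "(x + t) / 2 + (x - t) / 2 = x" "(x + t) / 2 - (x - t) / 2 = t" by (simp_all add: field_simps)
    then show "D t = H ((x + t) / 2) ((x - t) / 2)" "((x + t) / 2, (x - t) / 2) \<in> T"
      using that x by (simp_all add: D_def H_def HK_def HN_def T_def)
  qed
  have cD: "continuous_on {- x..x} D"
  proof -
    have "continuous_on {- x..x} (\<lambda>t. H ((x + t) / 2) ((x - t) / 2))"
      by (rule continuous_on_compose2[OF contH, of _ "\<lambda>t. ((x + t) / 2, (x - t) / 2)", simplified])
        (use in_T in \<open>auto intro!: continuous_intros\<close>)
    then show ?thesis by (rule continuous_on_eq) (simp add: D_H)
  qed
  have cD1: "continuous_on {- x..x} D1" and cD2: "continuous_on {- x..x} D2"
    unfolding D1_def D2_def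
    using x by (auto intro!: continuous_intros continuous_on_compose2[OF cont\<rho>])
  have cD3: "continuous_on {- x..x} D3" unfolding D3_def by (intro continuous_intros)
  have "norm (D t) \<le> norm (D1 t) + (norm (D2 t) + norm (D3 t))" if t: "t \<in> {- x..x}" for t
  proof -
    have "norm (D3 t) = CV * R" using CV_pos R0 e by (simp add: D3_def)
    have "D t = Pplus (\<rho> ((x + t) / 2)) + Pminus (\<rho> ((x - t) / 2))
      + (H ((x + t) / 2) ((x - t) / 2) - Pplus (\<rho> ((x + t) / 2)) - Pminus (\<rho> ((x - t) / 2)))"
      using D_H[OF t] by simp
    also have "norm \<dots> \<le> norm (\<rho> ((x + t) / 2)) + norm (\<rho> ((x - t) / 2)) + CV * R"
      by (intro norm_triangle_le add_mono norm_P_le est in_T t)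
    finally show ?thesis using \<open>norm (D3 t) = CV * R\<close> by (simp add: D1_def D2_def)
  qed
  then have le: "norm (D t) \<le> norm (D1 t) + norm ((norm (D2 t) + norm (D3 t)) *\<^sub>R e)" if "t \<in> {- x..x}" for t
    using that e by simp
  have "L2norm (- x) x D \<le> L2norm (- x) x D1 + L2norm (- x) x (\<lambda>t. (norm (D2 t) + norm (D3 t)) *\<^sub>R e)"
    by (rule L2norm_triangle_le[OF cD cD1 _ le]) (intro continuous_intros cD2 cD3)
  also have "L2norm (- x) x (\<lambda>t. (norm (D2 t) + norm (D3 t)) *\<^sub>R e) \<le> L2norm (- x) x D2 + L2norm (- x) x D3"
    by (rule L2norm_triangle_le[OF _ cD2 cD3]) (auto intro!: continuous_intros cD2 cD3 simp: e)
  also have "L2norm (- x) x D3 \<le> sqrt (x - (- x)) * (CV * R)"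
    using x CV_pos R0 e by (intro L2norm_le_sup cD3) (auto simp: D3_def)
  \<comment> \<open>The length 2 x is rounded up to 4 b, whose root combines with the root of b to 2
    b.\<close>
  also have "\<dots> \<le> sqrt (4 * b) * (CV * (sqrt b * L2norm 0 b \<rho>))"
    using x CV_pos R_le R0 by (intro mult_mono real_sqrt_le_mono mult_left_mono) (auto intro: mult_nonneg_nonneg)
  also have "\<dots> = 2 * b * CV * L2norm 0 b \<rho>"
    using b_pos by (simp add: real_sqrt_mult)
  also have "L2norm (- x) x D1 \<le> 2 * L2norm 0 b \<rho>"
    unfolding D1_def by (rule L2norm_average_le[OF cont\<rho> x]) simp
  also have "L2norm (- x) x D2 \<le> 2 * L2norm 0 b \<rho>"
    unfolding D2_def by (rule L2norm_average_le[OF cont\<rho> x]) simp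
  finally show ?thesis by (simp add: D_def \<rho>_def algebra_simps)
qed

end

section \<open>Jackson's inequality\<close>

text \<open>These are the coefficients of the Chebyshev polynomials, by the three-term recurrence.
  The nonzero leading coefficient is what allows \<open>power_sum_eq_cos_sum\<close> to go back from
  powers to cosines.\<close>

lemma cos_multiple_power_sum:
  "\<exists>t :: nat \<Rightarrow> real. t k \<noteq> 0 \<and> (\<forall>\<theta>. cos (of_nat k * \<theta>) = (\<Sum>j\<le>k. t j * cos \<theta> ^ j))"
proof (induction k rule: induct_nat_012)
  case 0
  show ?case by (intro exI[of _ "\<lambda>_. 1"]) simp
next
  case 1
  show ?case by (intro exI[of _ "\<lambda>j. of_nat j"]) simp
next
  case (ge2 k)
  then obtain t0 t1 :: "nat \<Rightarrow> real" where t0: "\<And>\<theta>. cos (of_nat k * \<theta>) = (\<Sum>j\<le>k. t0 j * cos \<theta> ^ j)"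
    and t1: "t1 (Suc k) \<noteq> 0" "\<And>\<theta>. cos (of_nat (Suc k) * \<theta>) = (\<Sum>j\<le>Suc k. t1 j * cos \<theta> ^ j)" by blast
  define t where "t j = 2 * (case j of 0 \<Rightarrow> 0 | Suc i \<Rightarrow> t1 i) - (if j \<le> k then t0 j else 0)" for j
  have "cos (of_nat (Suc (Suc k)) * \<theta>) = (\<Sum>j\<le>Suc (Suc k). t j * cos \<theta> ^ j)" for \<theta>
  proof -
    have "cos (of_nat (Suc (Suc k)) * \<theta>) + cos (of_nat k * \<theta>) = 2 * cos \<theta> * cos (of_nat (Suc k) * \<theta>)"
    proof -
      have "of_nat (Suc (Suc k)) * \<theta> = of_nat (Suc k) * \<theta> + \<theta>" "of_nat k * \<theta> = of_nat (Suc k) * \<theta> - \<theta>"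
        by (simp_all add: algebra_simps)
      then show ?thesis by (simp only: cos_add cos_diff) simp
    qed
    then have "cos (of_nat (Suc (Suc k)) * \<theta>) = 2 * (\<Sum>j\<le>Suc k. t1 j * cos \<theta> ^ Suc j) - (\<Sum>j\<le>k. t0 j * cos \<theta> ^ j)"
      unfolding t0 t1(2) by (simp add: sum_distrib_left algebra_simps)
    moreover have "(\<Sum>j\<le>Suc (Suc k). t j * cos \<theta> ^ j)
        = 2 * (\<Sum>j\<le>Suc (Suc k). (case j of 0 \<Rightarrow> 0 | Suc i \<Rightarrow> t1 i) * cos \<theta> ^ j)
          - (\<Sum>j\<le>Suc (Suc k). (if j \<le> k then t0 j else 0) * cos \<theta> ^ j)"
      by (simp only: t_def left_diff_distrib sum_subtractf sum_distrib_left mult.assoc)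
    moreover have "(\<Sum>j\<le>Suc (Suc k). (case j of 0 \<Rightarrow> 0 | Suc i \<Rightarrow> t1 i) * cos \<theta> ^ j) = (\<Sum>j\<le>Suc k. t1 j * cos \<theta> ^ Suc j)"
      by (subst sum.atMost_Suc_shift) simp
    moreover have "(\<Sum>j\<le>Suc (Suc k). (if j \<le> k then t0 j else 0) * cos \<theta> ^ j) = (\<Sum>j\<le>k. t0 j * cos \<theta> ^ j)"
      by simp
    ultimately show ?thesis by simp
  qed
  moreover have "t (Suc (Suc k)) \<noteq> 0" using t1(1) by (simp add: t_def)
  ultimately show ?case by blast
qed

lemma power_sum_eq_cos_sum:
  fixes C :: "nat \<Rightarrow> 'a::real_vector"
  shows "\<exists>D. \<forall>\<theta>. (\<Sum>n\<le>N. cos \<theta> ^ n *\<^sub>R C n) = (\<Sum>k\<le>N. cos (of_nat k * \<theta>) *\<^sub>R D k)"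
proof (induction N arbitrary: C)
  case 0
  show ?case by (intro exI[of _ C]) simp
next
  case (Suc N)
  obtain t :: "nat \<Rightarrow> real" where t: "t (Suc N) \<noteq> 0"
    "\<And>\<theta>. cos (of_nat (Suc N) * \<theta>) = (\<Sum>j\<le>Suc N. t j * cos \<theta> ^ j)"
    using cos_multiple_power_sum by blast
  \<comment> \<open>The coefficient of the highest cosine, fixed by comparing leading powers;
    subtracting its multiple leaves degree at most \<open>N\<close>.\<close>
  define E where "E = C (Suc N) /\<^sub>R t (Suc N)"
  obtain D where D: "\<And>\<theta>. (\<Sum>n\<le>N. cos \<theta> ^ n *\<^sub>R (C n - t n *\<^sub>R E)) = (\<Sum>k\<le>N. cos (of_nat k * \<theta>) *\<^sub>R D k)"
    using Suc.IH[of "\<lambda>n. C n - t n *\<^sub>R E"] by blast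
  have "(\<Sum>n\<le>Suc N. cos \<theta> ^ n *\<^sub>R C n) = (\<Sum>k\<le>Suc N. cos (of_nat k * \<theta>) *\<^sub>R (D(Suc N := E)) k)" for \<theta>
  proof -
    have "(\<Sum>k\<le>Suc N. cos (of_nat k * \<theta>) *\<^sub>R (D(Suc N := E)) k)
      = (\<Sum>k\<le>N. cos (of_nat k * \<theta>) *\<^sub>R D k) + cos (of_nat (Suc N) * \<theta>) *\<^sub>R E"
      by (simp del: of_nat_Suc)
    also have "\<dots> = (\<Sum>n\<le>N. cos \<theta> ^ n *\<^sub>R (C n - t n *\<^sub>R E)) + (\<Sum>j\<le>Suc N. cos \<theta> ^ j *\<^sub>R (t j *\<^sub>R E))"
      unfolding D t(2) by (simp add: scaleR_sum_left mult.commute scaleR_left_distrib)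
    also have "\<dots> = (\<Sum>n\<le>N. cos \<theta> ^ n *\<^sub>R C n) + cos \<theta> ^ Suc N *\<^sub>R (t (Suc N) *\<^sub>R E)"
      by (simp only: sum.atMost_Suc scaleR_right_diff_distrib sum_subtractf) simp
    also have "t (Suc N) *\<^sub>R E = C (Suc N)" using t(1) by (simp add: E_def)
    finally show ?thesis by simp
  qed
  then show ?case by blast
qed

lemma cos_sum_eq_power_sum:
  fixes D :: "nat \<Rightarrow> 'a::real_vector"
  shows "\<exists>C. \<forall>\<theta>. (\<Sum>k\<le>N. cos (of_nat k * \<theta>) *\<^sub>R D k) = (\<Sum>n\<le>N. cos \<theta> ^ n *\<^sub>R C n)"
proof (induction N)
  case 0
  show ?case by (intro exI[of _ D]) simp
next
  case (Suc N)
  obtain C where C: "\<And>\<theta>. (\<Sum>k\<le>N. cos (of_nat k * \<theta>) *\<^sub>R D k) = (\<Sum>n\<le>N. cos \<theta> ^ n *\<^sub>R C n)"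
    using Suc.IH by blast
  obtain t :: "nat \<Rightarrow> real" where
    t: "\<And>\<theta>. cos (of_nat (Suc N) * \<theta>) = (\<Sum>j\<le>Suc N. t j * cos \<theta> ^ j)"
    using cos_multiple_power_sum by blast
  have "(\<Sum>k\<le>Suc N. cos (of_nat k * \<theta>) *\<^sub>R D k)
     = (\<Sum>n\<le>Suc N. cos \<theta> ^ n *\<^sub>R ((if n \<le> N then C n else 0) + t n *\<^sub>R D (Suc N)))" for \<theta>
  proof -
    have "(\<Sum>k\<le>Suc N. cos (of_nat k * \<theta>) *\<^sub>R D k)
      = (\<Sum>n\<le>N. cos \<theta> ^ n *\<^sub>R C n) + (\<Sum>j\<le>Suc N. cos \<theta> ^ j *\<^sub>R (t j *\<^sub>R D (Suc N)))"
      unfolding sum.atMost_Suc[of "\<lambda>k. cos (of_nat k * \<theta>) *\<^sub>R D k"] C t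
      by (simp add: scaleR_sum_left mult.commute scaleR_left_distrib)
    also have "(\<Sum>n\<le>N. cos \<theta> ^ n *\<^sub>R C n) = (\<Sum>n\<le>Suc N. cos \<theta> ^ n *\<^sub>R (if n \<le> N then C n else 0))"
      by simp
    finally show ?thesis by (simp only: scaleR_right_distrib sum.distrib)
  qed
  then show ?case by (intro exI allI)
qed

lemma cos_has_integral_0_pi:
  assumes "c \<in> \<int>" "c \<noteq> 0"
  shows "((\<lambda>\<theta>. cos (c * \<theta>)) has_integral 0) {0..pi}"
proof -
  have "((\<lambda>\<theta>. cos (c * \<theta>)) has_integral sin (c * pi) / c - sin (c * 0) / c) {0..pi}"
    using assms(2)
    by (intro fundamental_theorem_of_calculus)
      (auto intro!: derivative_eq_intros simp flip: has_real_derivative_iff_has_vector_derivative)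
  moreover have "sin (c * pi) = 0" using assms(1) sin_times_pi_eq_0 by blast
  ultimately show ?thesis by simp
qed

text \<open>Frequency 0 is excluded: its square integral would be pi for the cosine and 0 for the
  sine.\<close>

lemma cos_sin_orthogonal:
  fixes j k :: nat
  assumes "j > 0" "k > 0"
  shows "((\<lambda>\<theta>. cos (of_nat j * \<theta>) * cos (of_nat k * \<theta>)) has_integral (if j = k then pi / 2 else 0)) {0..pi}"
    and "((\<lambda>\<theta>. sin (of_nat j * \<theta>) * sin (of_nat k * \<theta>)) has_integral (if j = k then pi / 2 else 0)) {0..pi}"
proof -
  define i where "i = (if j = k then pi else 0)"
  have h1: "((\<lambda>\<theta>. cos ((real j + real k) * \<theta>)) has_integral 0) {0..pi}"
    using assms by (intro cos_has_integral_0_pi) auto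
  have h2: "((\<lambda>\<theta>. cos ((real j - real k) * \<theta>)) has_integral i) {0..pi}"
    using cos_has_integral_0_pi[of "real j - real k"] has_integral_const_real[of "1::real" 0 pi]
    by (cases "j = k") (auto simp: i_def)
  have "((\<lambda>\<theta>. (cos ((real j - real k) * \<theta>) + cos ((real j + real k) * \<theta>)) / 2) has_integral (i + 0) / 2) {0..pi}"
    and "((\<lambda>\<theta>. (cos ((real j - real k) * \<theta>) - cos ((real j + real k) * \<theta>)) / 2) has_integral (i - 0) / 2) {0..pi}"
    by (rule has_integral_divide[OF has_integral_add[OF h2 h1]] has_integral_divide[OF has_integral_diff[OF h2 h1]])+
  moreover have "(i + 0) / 2 = (if j = k then pi / 2 else 0)" "(i - 0) / 2 = (if j = k then pi / 2 else 0)"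
    by (auto simp: i_def)
  ultimately show "((\<lambda>\<theta>. cos (of_nat j * \<theta>) * cos (of_nat k * \<theta>)) has_integral (if j = k then pi / 2 else 0)) {0..pi}"
    "((\<lambda>\<theta>. sin (of_nat j * \<theta>) * sin (of_nat k * \<theta>)) has_integral (if j = k then pi / 2 else 0)) {0..pi}"
    by (simp_all add: cos_times_cos sin_times_sin left_diff_distrib distrib_right)
qed

lemma norm_square_orthogonal_sum:
  fixes D :: "nat \<Rightarrow> 'a::real_inner" and \<phi> :: "nat \<Rightarrow> real \<Rightarrow> real"
  assumes fin: "finite S" and orth: "\<And>j k. j \<in> S \<Longrightarrow> k \<in> S \<Longrightarrow>
      ((\<lambda>\<theta>. \<phi> j \<theta> * \<phi> k \<theta>) has_integral (if j = k then c else 0)) I"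
  shows "((\<lambda>\<theta>. (norm (\<Sum>k\<in>S. \<phi> k \<theta> *\<^sub>R D k))\<^sup>2) has_integral c * (\<Sum>k\<in>S. (norm (D k))\<^sup>2)) I"
proof -
  have "((\<lambda>\<theta>. \<Sum>j\<in>S. \<Sum>k\<in>S. \<phi> j \<theta> * \<phi> k \<theta> * (D j \<bullet> D k)) has_integral
      (\<Sum>j\<in>S. \<Sum>k\<in>S. (if j = k then c else 0) * (D j \<bullet> D k))) I"
    by (intro has_integral_sum fin has_integral_mult_left orth)
  moreover have "(\<Sum>j\<in>S. \<Sum>k\<in>S. (if j = k then c else 0) * (D j \<bullet> D k)) = c * (\<Sum>k\<in>S. (norm (D k))\<^sup>2)"
    using fin by (simp add: sum_distrib_left power2_norm_eq_inner if_distrib[of "\<lambda>x. x * _"] cong: if_cong)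
  moreover have "(\<lambda>\<theta>. \<Sum>j\<in>S. \<Sum>k\<in>S. \<phi> j \<theta> * \<phi> k \<theta> * (D j \<bullet> D k)) = (\<lambda>\<theta>. (norm (\<Sum>k\<in>S. \<phi> k \<theta> *\<^sub>R D k))\<^sup>2)"
    by (simp add: power2_norm_eq_inner inner_sum_left inner_sum_right sum_distrib_left mult_ac inner_commute)
  ultimately show ?thesis by simp
qed

lemma has_integral_cos_substitution:
  fixes h :: "real \<Rightarrow> real"
  assumes "b > 0" "continuous_on {-b..b} h"
  shows "((\<lambda>\<theta>. b * sin \<theta> * h (b * cos \<theta>)) has_integral integral {-b..b} h) {0..pi}"
proof -
  have range: "(\<lambda>\<theta>. b * cos \<theta>) ` {0..pi} \<subseteq> {-b..b}"
  proof (rule image_subsetI)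
    fix \<theta> :: real
    have "b * (-1) \<le> b * cos \<theta>" "b * cos \<theta> \<le> b * 1"
      using assms(1) by (intro mult_left_mono; simp)+
    then show "b * cos \<theta> \<in> {-b..b}" by simp
  qed
  have "((\<lambda>\<theta>. (- (b * sin \<theta>)) *\<^sub>R h (b * cos \<theta>)) has_integral
      (integral {b * cos 0..b * cos pi} h - integral {b * cos pi..b * cos 0} h)) {0..pi}"
    by (rule has_integral_substitution_general[of "{}", OF _ _ range assms(2)])
      (auto intro!: derivative_eq_intros continuous_intros)
  then have "((\<lambda>\<theta>. - (b * sin \<theta> * h (b * cos \<theta>))) has_integral - integral {-b..b} h) {0..pi}"
    using assms(1) by simp
  from has_integral_neg[OF this] show ?thesis by simp
qed

text \<open>Expand \<open>F (b cos \<theta>)\<close> into a cosine sum and truncate it at \<open>N\<close>; Parseval for the sum and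
  for its derivative gives the factor \<open>1 / (N + 1)\<close>. The weights introduced by the
  substitution \<open>s = b cos \<theta>\<close> have the favourable direction on both sides.\<close>
lemma Jackson_polynomial:
  assumes b: "b > 0" and der: "\<And>s. (mpoly2 M C has_vector_derivative F' s) (at s)"
    and contF': "continuous_on {-b..b} F'"
  shows "\<exists>C'. L2norm (-b) b (\<lambda>s. mpoly2 M C s - mpoly2 N C' s) \<le> b / of_nat (N + 1) * L2norm (-b) b F'"
proof -
  let ?F = "mpoly2 M C"
  obtain D where D: "\<And>\<theta>. ?F (b * cos \<theta>) = (\<Sum>k\<le>M. cos (of_nat k * \<theta>) *\<^sub>R D k)"
    using power_sum_eq_cos_sum[where N = M and C = "\<lambda>n. (2 * b) ^ n *\<^sub>R C n"]
    by (force simp: mpoly2_def power_mult_distrib mult_ac)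
  \<comment> \<open>Coefficients beyond \<open>M\<close> are set to 0, since \<open>N\<close> may
    exceed \<open>M\<close>; the truncation is then exact.\<close>
  obtain C0 where C0: "\<And>\<theta>. (\<Sum>k\<le>N. cos (of_nat k * \<theta>) *\<^sub>R (if k \<le> M then D k else 0)) = (\<Sum>n\<le>N. cos \<theta> ^ n *\<^sub>R C0 n)"
    using cos_sum_eq_power_sum[where D = "\<lambda>k. if k \<le> M then D k else 0"] by blast
  \<comment> \<open>The division undoes the scaling in \<open>mpoly2\<close>, evaluated at b times a
    cosine.\<close>
  define C' where "C' n = C0 n /\<^sub>R (2 * b) ^ n" for n
  have P: "mpoly2 N C' (b * cos \<theta>) = (\<Sum>k\<le>N. cos (of_nat k * \<theta>) *\<^sub>R (if k \<le> M then D k else 0))" for \<theta>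
  proof -
    have "(2 * (b * cos \<theta>)) ^ n *\<^sub>R C' n = cos \<theta> ^ n *\<^sub>R C0 n" for n
    proof -
      have "(2 * (b * cos \<theta>)) ^ n = cos \<theta> ^ n * (2 * b) ^ n"
        unfolding power_mult_distrib[symmetric] by (simp add: mult_ac)
      moreover have "(2 * b) ^ n \<noteq> 0" using b by simp
      moreover have "(c * B) *\<^sub>R (C0 n /\<^sub>R B) = c *\<^sub>R C0 n" if "B \<noteq> 0" for c B
        using that by simp
      ultimately show ?thesis unfolding C'_def by metis
    qed
    then show ?thesis unfolding C0 mpoly2_def by simp
  qed
  define S where "S = {N<..M}"
  have diff: "?F (b * cos \<theta>) - mpoly2 N C' (b * cos \<theta>) = (\<Sum>k\<in>S. cos (of_nat k * \<theta>) *\<^sub>R D k)" for \<theta>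
  proof -
    have "(\<Sum>k\<le>N. cos (of_nat k * \<theta>) *\<^sub>R (if k \<le> M then D k else 0)) = (\<Sum>k\<in>{..M} - S. cos (of_nat k * \<theta>) *\<^sub>R D k)"
      by (intro sum.mono_neutral_cong_right) (auto simp: S_def)
    moreover have "(\<Sum>k\<le>M. cos (of_nat k * \<theta>) *\<^sub>R D k)
        = (\<Sum>k\<in>{..M} - S. cos (of_nat k * \<theta>) *\<^sub>R D k) + (\<Sum>k\<in>S. cos (of_nat k * \<theta>) *\<^sub>R D k)"
      by (rule sum.subset_diff) (auto simp: S_def)
    ultimately show ?thesis unfolding D P by simp
  qed
  define s where "s = (\<Sum>k\<in>S. (norm (D k))\<^sup>2)"
  define s' where "s' = (\<Sum>k=1..M. (norm (of_nat k *\<^sub>R D k))\<^sup>2)"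
  have cosint: "((\<lambda>\<theta>. (norm (\<Sum>k\<in>S. cos (of_nat k * \<theta>) *\<^sub>R D k))\<^sup>2) has_integral pi / 2 * s) {0..pi}"
    unfolding s_def by (intro norm_square_orthogonal_sum cos_sin_orthogonal) (auto simp: S_def)
  have sinint: "((\<lambda>\<theta>. (norm (\<Sum>k=1..M. sin (of_nat k * \<theta>) *\<^sub>R (of_nat k *\<^sub>R D k)))\<^sup>2) has_integral pi / 2 * s') {0..pi}"
    unfolding s'_def by (intro norm_square_orthogonal_sum cos_sin_orthogonal) auto
  have "(of_nat (N + 1))\<^sup>2 * s = (\<Sum>k\<in>S. (of_nat (N + 1))\<^sup>2 * (norm (D k))\<^sup>2)"
    by (simp add: s_def sum_distrib_left)
  also have "\<dots> \<le> (\<Sum>k\<in>S. (norm (of_nat k *\<^sub>R D k))\<^sup>2)"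
  proof (rule sum_mono)
    fix k assume "k \<in> S"
    then have "(real (N + 1))\<^sup>2 \<le> (real k)\<^sup>2" by (intro power_mono) (auto simp: S_def)
    then show "(real (N + 1))\<^sup>2 * (norm (D k))\<^sup>2 \<le> (norm (of_nat k *\<^sub>R D k))\<^sup>2"
      by (simp add: power_mult_distrib mult_right_mono)
  qed
  also have "\<dots> \<le> s'"
    unfolding s'_def by (rule sum_mono2) (auto simp: S_def)
  finally have ss': "(of_nat (N + 1))\<^sup>2 * s \<le> s'" .
  have deriv: "(b * sin \<theta>) *\<^sub>R F' (b * cos \<theta>) = (\<Sum>k=1..M. sin (of_nat k * \<theta>) *\<^sub>R (of_nat k *\<^sub>R D k))" for \<theta>
  proof -
    have "((\<lambda>\<theta>. ?F (b * cos \<theta>)) has_vector_derivative (- (b * sin \<theta>)) *\<^sub>R F' (b * cos \<theta>)) (at \<theta>)"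
    proof -
      have "((\<lambda>\<theta>. b * cos \<theta>) has_vector_derivative - (b * sin \<theta>)) (at \<theta>)"
        by (auto intro!: derivative_eq_intros simp flip: has_real_derivative_iff_has_vector_derivative)
      from vector_diff_chain_at[OF this der] show ?thesis by (simp add: o_def)
    qed
    moreover have "((\<lambda>\<theta>. ?F (b * cos \<theta>)) has_vector_derivative
        (\<Sum>k\<le>M. (- (of_nat k * sin (of_nat k * \<theta>))) *\<^sub>R D k)) (at \<theta>)"
      unfolding D
      by (intro has_vector_derivative_sum has_vector_derivative_eq_rhs[OF has_vector_derivative_scaleR])
        (auto intro!: derivative_eq_intros)
    ultimately have "(- (b * sin \<theta>)) *\<^sub>R F' (b * cos \<theta>) = (\<Sum>k\<le>M. (- (of_nat k * sin (of_nat k * \<theta>))) *\<^sub>R D k)"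
      by (rule vector_derivative_unique_at)
    then have "(b * sin \<theta>) *\<^sub>R F' (b * cos \<theta>) = (\<Sum>k\<le>M. (of_nat k * sin (of_nat k * \<theta>)) *\<^sub>R D k)"
      by (simp add: sum_negf)
    also have "\<dots> = (\<Sum>k=1..M. sin (of_nat k * \<theta>) *\<^sub>R (of_nat k *\<^sub>R D k))"
      by (intro sum.mono_neutral_cong_right) (auto simp: mult.commute)
    finally show ?thesis .
  qed
  have contE: "continuous_on X (\<lambda>s. ?F s - mpoly2 N C' s)" for X
    by (intro continuous_intros cont_mpoly2)
  have "(L2norm (-b) b (\<lambda>s. ?F s - mpoly2 N C' s))\<^sup>2 \<le> b * (pi / 2 * s)"
    unfolding L2norm_square
  proof (rule has_integral_le[OF has_integral_cos_substitution[OF b] has_integral_mult_right[OF cosint]])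
    show "continuous_on {- b..b} (\<lambda>x. (norm (mpoly2 M C x - mpoly2 N C' x))\<^sup>2)"
      by (intro continuous_intros contE)
    fix \<theta> :: real assume "\<theta> \<in> {0..pi}"
    have "b * sin \<theta> * (norm (?F (b * cos \<theta>) - mpoly2 N C' (b * cos \<theta>)))\<^sup>2
        \<le> b * 1 * (norm (?F (b * cos \<theta>) - mpoly2 N C' (b * cos \<theta>)))\<^sup>2"
      using b by (intro mult_right_mono mult_left_mono) auto
    then show "b * sin \<theta> * (norm (?F (b * cos \<theta>) - mpoly2 N C' (b * cos \<theta>)))\<^sup>2
        \<le> b * (norm (\<Sum>k\<in>S. cos (of_nat k * \<theta>) *\<^sub>R D k))\<^sup>2"
      by (simp add: diff)
  qed
  moreover have "pi / 2 * s' \<le> b * (L2norm (-b) b F')\<^sup>2"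
    unfolding L2norm_square
  proof (rule has_integral_le[OF sinint has_integral_mult_right[OF has_integral_cos_substitution[OF b]]])
    show "continuous_on {- b..b} (\<lambda>x. (norm (F' x))\<^sup>2)"
      by (intro continuous_intros contF')
    fix \<theta> :: real assume \<theta>: "\<theta> \<in> {0..pi}"
    then have "0 \<le> sin \<theta>" by (auto intro: sin_ge_zero)
    then have "b * (sin \<theta> * (b * sin \<theta>)) \<le> b * (1 * (b * sin \<theta>))"
      using b by (intro mult_left_mono mult_right_mono) auto
    then have "(b * sin \<theta>)\<^sup>2 \<le> b * (b * sin \<theta>)"
      by (simp add: power2_eq_square mult_ac)
    then have "(b * sin \<theta>)\<^sup>2 * (norm (F' (b * cos \<theta>)))\<^sup>2 \<le> b * (b * sin \<theta>) * (norm (F' (b * cos \<theta>)))\<^sup>2"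
      by (rule mult_right_mono) simp
    then show "(norm (\<Sum>k=1..M. sin (of_nat k * \<theta>) *\<^sub>R (of_nat k *\<^sub>R D k)))\<^sup>2
        \<le> b * (b * sin \<theta> * (norm (F' (b * cos \<theta>)))\<^sup>2)"
      unfolding deriv[symmetric] by (simp add: power_mult_distrib mult.assoc)
  qed
  ultimately have "(of_nat (N + 1))\<^sup>2 * (L2norm (-b) b (\<lambda>s. ?F s - mpoly2 N C' s))\<^sup>2 \<le> b * (b * (L2norm (-b) b F')\<^sup>2)"
  proof -
    assume 1: "(L2norm (-b) b (\<lambda>s. ?F s - mpoly2 N C' s))\<^sup>2 \<le> b * (pi / 2 * s)"
      and 2: "pi / 2 * s' \<le> b * (L2norm (-b) b F')\<^sup>2"
    have "(of_nat (N + 1))\<^sup>2 * (L2norm (-b) b (\<lambda>s. ?F s - mpoly2 N C' s))\<^sup>2 \<le> (of_nat (N + 1))\<^sup>2 * (b * (pi / 2 * s))"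
      by (intro mult_left_mono 1) simp
    also have "\<dots> = b * (pi / 2 * ((of_nat (N + 1))\<^sup>2 * s))" by (simp only: mult_ac)
    also have "\<dots> \<le> b * (pi / 2 * s')"
      using b ss' by (intro mult_left_mono) auto
    also have "\<dots> \<le> b * (b * (L2norm (-b) b F')\<^sup>2)"
      using b 2 by (intro mult_left_mono) auto
    finally show ?thesis .
  qed
  then have "(of_nat (N + 1) * L2norm (-b) b (\<lambda>s. ?F s - mpoly2 N C' s))\<^sup>2 \<le> (b * L2norm (-b) b F')\<^sup>2"
    by (simp only: power_mult_distrib) (simp add: power2_eq_square mult_ac)
  then have "of_nat (N + 1) * L2norm (-b) b (\<lambda>s. ?F s - mpoly2 N C' s) \<le> b * L2norm (-b) b F'"
    by (rule power2_le_imp_le) (use b in \<open>simp add: L2norm_nonneg\<close>)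
  then have "L2norm (-b) b (\<lambda>s. ?F s - mpoly2 N C' s) \<le> b / of_nat (N + 1) * L2norm (-b) b F'"
    by (simp add: field_simps)
  then show ?thesis by blast
qed

section \<open>Density of the attainable Goursat data\<close>

lemma polynomial_function_power_sum:
  fixes g :: "real \<Rightarrow> 'a::euclidean_space"
  assumes "polynomial_function g"
  shows "\<exists>N a. \<forall>x. g x = (\<Sum>i\<le>N. x ^ i *\<^sub>R a i)"
proof -
  have "\<forall>e. \<exists>a n. (\<lambda>x. g x \<bullet> e) = (\<lambda>x. \<Sum>i\<le>n. a i * x ^ i)"
  proof
    fix e
    have "bounded_linear (\<lambda>v::'a. v \<bullet> e)" by (rule bounded_linear_inner_left)
    then have "real_polynomial_function (\<lambda>x. g x \<bullet> e)"
      using assms unfolding polynomial_function_def by (auto simp: o_def)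
    then show "\<exists>a n. (\<lambda>x. g x \<bullet> e) = (\<lambda>x. \<Sum>i\<le>n. a i * x ^ i)"
      by (simp add: real_polynomial_function_iff_sum)
  qed
  then obtain a n where an: "\<And>e x. g x \<bullet> e = (\<Sum>i\<le>n e. a e i * x ^ i)" by metis
  define N where "N = Max (n ` (Basis :: 'a set))"
  define c where "c i = (\<Sum>e\<in>(Basis :: 'a set). (if i \<le> n e then a e i else 0) *\<^sub>R e)" for i
  have "g x = (\<Sum>i\<le>N. x ^ i *\<^sub>R c i)" for x
  proof -
    have "g x \<bullet> e = (\<Sum>i\<le>N. (if i \<le> n e then a e i else 0) * x ^ i)" if "e \<in> Basis" for e
    proof -
      have "n e \<le> N" unfolding N_def using that by (intro Max_ge) auto
      then show ?thesis unfolding an by (intro sum.mono_neutral_cong_left) auto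
    qed
    then have "g x = (\<Sum>e\<in>Basis. (\<Sum>i\<le>N. (if i \<le> n e then a e i else 0) * x ^ i) *\<^sub>R e)"
      using euclidean_representation[of "g x"] by simp
    also have "\<dots> = (\<Sum>i\<le>N. x ^ i *\<^sub>R c i)"
      unfolding c_def scaleR_sum_left scaleR_sum_right scaleR_scaleR
      by (subst sum.swap) (simp add: mult.commute)
    finally show ?thesis .
  qed
  then show ?thesis by blast
qed

lemma sum_even_indices:
  fixes h :: "nat \<Rightarrow> 'a::comm_monoid_add"
  assumes "\<And>n. odd n \<Longrightarrow> h n = 0"
  shows "(\<Sum>n\<le>2 * N. h n) = (\<Sum>i\<le>N. h (2 * i))"
  by (induction N) (use assms in auto)

text \<open>Weierstrass approximation of F(sqrt y) on [0, b^2], followed by the substitution y =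
  s^2.\<close>

lemma even_mpoly2_dense:
  fixes F :: "real \<Rightarrow> cmat2"
  assumes F: "continuous_on {0..b} F" and b: "b > 0" and \<epsilon>: "\<epsilon> > 0"
  shows "\<exists>N C. (\<forall>n. odd n \<longrightarrow> C n = 0) \<and> (\<forall>s\<in>{0..b}. norm (F s - mpoly2 N C s) < \<epsilon>)"
proof -
  have "continuous_on {0..b\<^sup>2} (\<lambda>y. F (sqrt y))"
    using b by (intro continuous_intros continuous_on_compose2[OF F]) (auto simp: real_le_lsqrt real_sqrt_le_iff)
  from Stone_Weierstrass_polynomial_function[OF compact_Icc this \<epsilon>]
  obtain h where h: "polynomial_function h" "\<And>y. y \<in> {0..b\<^sup>2} \<Longrightarrow> norm (F (sqrt y) - h y) < \<epsilon>" by blast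
  from polynomial_function_power_sum[OF h(1)] obtain N a where a: "\<And>x. h x = (\<Sum>i\<le>N. x ^ i *\<^sub>R a i)" by blast
  define C where "C n = (if even n then a (n div 2) /\<^sub>R 2 ^ n else 0)" for n
  have "mpoly2 (2 * N) C s = h (s\<^sup>2)" for s
  proof -
    have "(B * c) *\<^sub>R (v /\<^sub>R B) = c *\<^sub>R v" if "B \<noteq> 0" for B c and v :: cmat2
      using that by simp
    from this[of "2 ^ (2 * i)" "(s\<^sup>2) ^ i" "a i" for i]
    have "(2 * s) ^ (2 * i) *\<^sub>R C (2 * i) = (s\<^sup>2) ^ i *\<^sub>R a i" for i
      by (simp add: C_def power_mult_distrib flip: power_mult)
    then show ?thesis
      unfolding mpoly2_def a by (subst sum_even_indices) (simp add: C_def, intro sum.cong refl, simp only:)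
  qed
  then have "norm (F s - mpoly2 (2 * N) C s) < \<epsilon>" if "s \<in> {0..b}" for s
    using h(2)[of "s\<^sup>2"] that by (simp add: power_mono)
  moreover have "\<forall>n. odd n \<longrightarrow> C n = 0" by (simp add: C_def)
  ultimately show ?thesis by blast
qed

lemma mpoly2_even:
  assumes "\<And>n. odd n \<Longrightarrow> C n = 0"
  shows "mpoly2 N C (- s) = mpoly2 N C s"
proof -
  have "(2 * - s) ^ n *\<^sub>R C n = (2 * s) ^ n *\<^sub>R C n" for n
    using assms[of n] by (cases "even n") auto
  then show ?thesis by (simp only: mpoly2_def)
qed

lemma integral_even_function:
  fixes h :: "real \<Rightarrow> real"
  assumes "continuous_on {-x..x} h" "\<And>s. h (- s) = h s" "0 \<le> x"
  shows "integral {-x..x} h = 2 * integral {0..x} h"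
proof -
  have "integral {-x..x} h = integral {-x..0} h + integral {0..x} h"
    by (rule Henstock_Kurzweil_Integration.integral_combine[symmetric])
      (use assms in \<open>auto intro: integrable_continuous_real\<close>)
  also have "integral {-x..0} h = integral {-x..-0} (\<lambda>s. h (- s))"
    by (simp add: assms(2))
  also have "\<dots> = integral {0..x} h" using Henstock_Kurzweil_Integration.integral_reflect_real[of x 0 h] by simp
  finally show ?thesis by simp
qed

lemma L2norm_even_le:
  assumes "continuous_on {-b..b} F" "\<And>s. F (- s) = F s" "0 \<le> b"
  shows "L2norm (-b) b F \<le> 2 * L2norm 0 b F"
proof (rule power2_le_imp_le)
  have "(L2norm (-b) b F)\<^sup>2 = 2 * (L2norm 0 b F)\<^sup>2"
    unfolding L2norm_square
    by (rule integral_even_function) (use assms in \<open>auto intro!: continuous_intros\<close>)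
  also have "\<dots> \<le> (2 * L2norm 0 b F)\<^sup>2" by (simp add: power_mult_distrib)
  finally show "(L2norm (-b) b F)\<^sup>2 \<le> (2 * L2norm 0 b F)\<^sup>2" .
qed (simp add: L2norm_nonneg)

text \<open>Cauchy-Schwarz with the weight split off. After multiplication by exp (-
  \<open>\<kappa>\<close> x) the bound is uniform in x with factor 1 / sqrt (2
  \<open>\<kappa>\<close>), so a large \<open>\<kappa>\<close> makes a Volterra term small.\<close>

lemma integral_le_weighted_L2norm:
  fixes \<phi> :: "real \<Rightarrow> cmat2"
  assumes \<phi>: "continuous_on {0..b} \<phi>" and x: "x \<in> {0..b}" and \<kappa>: "\<kappa> > 0"
  shows "integral {0..x} (\<lambda>s. norm (\<phi> s))
    \<le> exp (\<kappa> * x) / sqrt (2 * \<kappa>) * L2norm 0 b (\<lambda>s. exp (- \<kappa> * s) *\<^sub>R \<phi> s)"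
proof (rule power2_le_imp_le)
  let ?w = "\<lambda>s. exp (- \<kappa> * s) *\<^sub>R \<phi> s"
  have cont: "continuous_on {0..x} \<phi>" using x by (intro continuous_on_subset[OF \<phi>]) auto
  have "integral {0..x} (\<lambda>s. norm (\<phi> s)) = integral {0..x} (\<lambda>s. exp (\<kappa> * s) * norm (?w s))"
    by (rule integral_cong) (simp add: exp_minus)
  then have "(integral {0..x} (\<lambda>s. norm (\<phi> s)))\<^sup>2
      \<le> integral {0..x} (\<lambda>s. (exp (\<kappa> * s))\<^sup>2) * integral {0..x} (\<lambda>s. (norm (?w s))\<^sup>2)"
    by (simp only:) (intro integral_Cauchy_Schwarz continuous_intros cont)
  also have "\<dots> \<le> (exp (\<kappa> * x))\<^sup>2 / (2 * \<kappa>) * (L2norm 0 b ?w)\<^sup>2"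
  proof (rule mult_mono)
    have "((\<lambda>s. (exp (\<kappa> * s))\<^sup>2) has_integral (exp (\<kappa> * x))\<^sup>2 / (2 * \<kappa>) - (exp (\<kappa> * 0))\<^sup>2 / (2 * \<kappa>)) {0..x}"
      using x \<kappa>
      by (intro fundamental_theorem_of_calculus)
        (auto intro!: derivative_eq_intros simp: power2_eq_square simp flip: has_real_derivative_iff_has_vector_derivative)
    then show "integral {0..x} (\<lambda>s. (exp (\<kappa> * s))\<^sup>2) \<le> (exp (\<kappa> * x))\<^sup>2 / (2 * \<kappa>)"
      using \<kappa> by (simp add: integral_unique)
    show "integral {0..x} (\<lambda>s. (norm (?w s))\<^sup>2) \<le> (L2norm 0 b ?w)\<^sup>2"
      unfolding L2norm_square
      using x by (intro integral_subset_le integrable_norm_square continuous_intros \<phi> cont) auto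
    show "0 \<le> integral {0..x} (\<lambda>s. (norm (?w s))\<^sup>2)"
      by (intro integral_nonneg integrable_norm_square continuous_intros cont) simp
  qed (use \<kappa> in simp)
  also have "\<dots> = (exp (\<kappa> * x) / sqrt (2 * \<kappa>) * L2norm 0 b ?w)\<^sup>2"
    using \<kappa> by (simp add: power_mult_distrib power_divide)
  finally show "(integral {0..x} (\<lambda>s. norm (\<phi> s)))\<^sup>2 \<le> (exp (\<kappa> * x) / sqrt (2 * \<kappa>) * L2norm 0 b ?w)\<^sup>2" .
qed (use \<kappa> in \<open>simp add: L2norm_nonneg\<close>)

text \<open>Entries of a coefficient sequence above its degree bound are arbitrary, so they are cut
  off before sequences of different degree are added.\<close>

lemma mpoly2_combine:
  "mpoly2 (max N1 N2) (\<lambda>n. (if n \<le> N1 then C1 n else 0) + r *\<^sub>R (if n \<le> N2 then C2 n else 0)) s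
    = mpoly2 N1 C1 s + r *\<^sub>R mpoly2 N2 C2 s"
proof -
  have "mpoly2 N (\<lambda>n. if n \<le> N' then C n else 0) s = mpoly2 N' C s" if "N' \<le> N" for N N' C
    unfolding mpoly2_def using that by (intro sum.mono_neutral_cong_right) auto
  moreover have "mpoly2 N (\<lambda>n. D n + r *\<^sub>R E n) s = mpoly2 N D s + r *\<^sub>R mpoly2 N E s" for N D E
    by (simp add: mpoly2_def scaleR_right_distrib sum.distrib scaleR_sum_right mult.commute)
  ultimately show ?thesis by simp
qed

section \<open>Inverting the map from even polynomials to Goursat data\<close>

context dirac
begin

lemma KN_combine:
  "KN (max N1 N2) (\<lambda>n. (if n \<le> N1 then C1 n else 0) + r *\<^sub>R (if n \<le> N2 then C2 n else 0)) x t
    = KN N1 C1 x t + r *\<^sub>R KN N2 C2 x t"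
proof -
  have "KN N (\<lambda>n. if n \<le> N' then C n else 0) x t = KN N' C x t" if "N' \<le> N" for N N' C
    unfolding KN_def using that by (intro sum.mono_neutral_cong_right) (auto simp: Kn_linear)
  moreover have "KN N (\<lambda>n. D n + r *\<^sub>R E n) x t = KN N D x t + r *\<^sub>R KN N E x t" for N D E
    by (simp add: KN_def Kn_linear sum.distrib scaleR_sum_right)
  ultimately show ?thesis by simp
qed

lemma gtrace_combine:
  "gtrace (KN (max N1 N2) (\<lambda>n. (if n \<le> N1 then C1 n else 0) + r *\<^sub>R (if n \<le> N2 then C2 n else 0))) x
    = gtrace (KN N1 C1) x + r *\<^sub>R gtrace (KN N2 C2) x"
  by (simp add: gtrace_def KN_combine Pplus_simps Pminus_simps scaleR_right_distrib)

text \<open>The summand 1 is the polynomial itself, 4 b \<open>CV\<close> the remainder in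
  \<open>gtrace_minus_mpoly2\<close>, with sqrt (2 b) rounded up to sqrt (4 b).\<close>

lemma gtrace_bounded:
  "L2norm 0 b (gtrace (KN N C)) \<le> (1 + 4 * b * CV) * L2norm (-b) b (mpoly2 N C)"
proof -
  let ?\<rho> = "mpoly2 N C" and ?A = "gtrace (KN N C)"
  let ?R = "integral {-b..b} (\<lambda>s. norm (?\<rho> s))"
  have R: "?R \<le> sqrt (2 * b) * L2norm (-b) b ?\<rho>"
    using integral_norm_le_L2norm[OF cont_mpoly2, of "-b" b N C] b_pos by simp
  have "L2norm 0 b ?A \<le> L2norm 0 b ?\<rho> + L2norm 0 b (\<lambda>x. ?A x - ?\<rho> x)"
    by (rule L2norm_triangle_le)
      (auto intro!: cont_gtrace_KN cont_mpoly2 continuous_intros norm_triangle_sub)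
  also have "L2norm 0 b ?\<rho> \<le> L2norm (-b) b ?\<rho>"
    unfolding L2norm_def using b_pos
    by (intro real_sqrt_le_mono integral_subset_le integrable_norm_square cont_mpoly2) auto
  also have "L2norm 0 b (\<lambda>x. ?A x - ?\<rho> x) \<le> sqrt (b - 0) * (2 * CV * ?R)"
  proof (rule L2norm_le_sup)
    fix x assume x: "x \<in> {0..b}"
    have "norm (?A x - ?\<rho> x) \<le> 2 * CV * integral {-x..x} (\<lambda>s. norm (?\<rho> s))"
      by (rule gtrace_minus_mpoly2[OF x])
    also have "\<dots> \<le> 2 * CV * ?R"
      using x CV_pos
      by (intro mult_left_mono integral_subset_le integrable_continuous_real continuous_intros cont_mpoly2) auto
    finally show "norm (?A x - ?\<rho> x) \<le> 2 * CV * ?R" .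
  qed (use b_pos in \<open>auto intro!: cont_gtrace_KN cont_mpoly2 continuous_intros\<close>)
  also have "\<dots> \<le> sqrt b * (2 * CV * (sqrt (4 * b) * L2norm (-b) b ?\<rho>))"
  proof -
    have "sqrt (2 * b) * L2norm (-b) b ?\<rho> \<le> sqrt (4 * b) * L2norm (-b) b ?\<rho>"
      using b_pos by (intro mult_right_mono) (auto simp: L2norm_nonneg)
    then show ?thesis
      using R CV_pos b_pos by (auto intro!: mult_left_mono)
  qed
  also have "\<dots> = 4 * b * CV * L2norm (-b) b ?\<rho>"
    using b_pos by (simp add: real_sqrt_mult)
  finally show ?thesis by (simp add: algebra_simps)
qed

text \<open>Chosen so that, in the norm weighted by \<open>exp (- wt x)\<close>, the Volterra part of \<open>gtrace\<close> is a
  contraction by 1/2 on even polynomials.\<close>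
definition wt :: real where "wt = 32 * CV\<^sup>2 * b"

definition wnorm :: "(real \<Rightarrow> cmat2) \<Rightarrow> real" where
  "wnorm F = L2norm 0 b (\<lambda>x. exp (- wt * x) *\<^sub>R F x)"

lemma wt_pos: "wt > 0" using CV_pos b_pos by (simp add: wt_def)

lemma wnorm_nonneg: "0 \<le> wnorm F" by (simp add: wnorm_def L2norm_nonneg)

lemma wnorm_triangle_le:
  assumes "continuous_on {0..b} F" "continuous_on {0..b} G" "continuous_on {0..b} H"
    and "\<And>x. x \<in> {0..b} \<Longrightarrow> norm (F x) \<le> norm (G x) + norm (H x)"
  shows "wnorm F \<le> wnorm G + wnorm H"
  unfolding wnorm_def using assms(4)
  by (intro L2norm_triangle_le continuous_intros assms(1-3)) (simp add: distrib_left[symmetric])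

lemma wnorm_le_L2norm: "continuous_on {0..b} F \<Longrightarrow> wnorm F \<le> L2norm 0 b F"
  unfolding wnorm_def using wt_pos
  by (intro L2norm_le[where c = 1, simplified] continuous_intros) (auto simp: mult_left_le_one_le)

lemma L2norm_le_wnorm: "continuous_on {0..b} F \<Longrightarrow> L2norm 0 b F \<le> exp (wt * b) * wnorm F"
  unfolding wnorm_def
proof (rule L2norm_le)
  fix x assume x: "x \<in> {0..b}"
  have "1 \<le> exp (wt * b) * exp (- wt * x)"
    using x wt_pos by (simp flip: exp_add)
  then have "1 * norm (F x) \<le> exp (wt * b) * exp (- wt * x) * norm (F x)" by (intro mult_right_mono) auto
  then show "norm (F x) \<le> exp (wt * b) * norm (exp (- wt * x) *\<^sub>R F x)" by simp
qed (auto intro!: continuous_intros)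

text \<open>Evenness turns the integral over [-x, x] into twice the integral over [0, x]. The
  perturbation thereby becomes a Volterra term on [0, b], which the exponential weight makes
  small.\<close>

lemma gtrace_minus_even_mpoly2:
  assumes even: "\<And>n. odd n \<Longrightarrow> C n = 0"
  shows "wnorm (\<lambda>x. gtrace (KN N C) x - mpoly2 N C x) \<le> wnorm (mpoly2 N C) / 2"
proof -
  let ?V = "\<lambda>x. gtrace (KN N C) x - mpoly2 N C x"
  \<comment> \<open>Then 4 \<open>CV\<close> / sqrt (2 \<open>wt\<close>) = 1 / (2 sqrt b); passing
    from the sup bound to L2 over [0, b] multiplies by sqrt b and leaves 1/2.\<close>
  have sq: "sqrt (2 * wt) = 8 * CV * sqrt b"
    using CV_pos by (simp add: wt_def real_sqrt_mult)
  have contV: "continuous_on {0..b} ?V" by (intro continuous_intros cont_gtrace_KN cont_mpoly2)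
  have le: "norm (exp (- wt * x) *\<^sub>R ?V x) \<le> wnorm (mpoly2 N C) / (2 * sqrt b)" if x: "x \<in> {0..b}" for x
  proof -
    have "norm (?V x) \<le> 2 * CV * integral {-x..x} (\<lambda>s. norm (mpoly2 N C s))"
      by (rule gtrace_minus_mpoly2[OF x])
    also have "integral {-x..x} (\<lambda>s. norm (mpoly2 N C s)) = 2 * integral {0..x} (\<lambda>s. norm (mpoly2 N C s))"
      using x by (intro integral_even_function continuous_intros cont_mpoly2) (auto simp: mpoly2_even[OF even])
    also have "integral {0..x} (\<lambda>s. norm (mpoly2 N C s)) \<le> exp (wt * x) / sqrt (2 * wt) * wnorm (mpoly2 N C)"
      unfolding wnorm_def by (rule integral_le_weighted_L2norm[OF cont_mpoly2 x wt_pos])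
    finally have "norm (?V x) \<le> 2 * CV * (2 * (exp (wt * x) / sqrt (2 * wt) * wnorm (mpoly2 N C)))"
      using CV_pos by simp
    also have "\<dots> = exp (wt * x) * (wnorm (mpoly2 N C) / (2 * sqrt b))"
      unfolding sq using CV_pos b_pos by (simp add: field_simps)
    finally have "exp (- wt * x) * norm (?V x) \<le> exp (- wt * x) * (exp (wt * x) * (wnorm (mpoly2 N C) / (2 * sqrt b)))"
      by (intro mult_left_mono) auto
    also have "\<dots> = wnorm (mpoly2 N C) / (2 * sqrt b)" by (simp add: exp_minus)
    finally show ?thesis by simp
  qed
  have "wnorm ?V \<le> sqrt (b - 0) * (wnorm (mpoly2 N C) / (2 * sqrt b))"
    unfolding wnorm_def[of ?V] by (rule L2norm_le_sup[OF _ _ le]) (use b_pos in \<open>auto intro!: continuous_intros contV\<close>)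
  also have "\<dots> = wnorm (mpoly2 N C) / 2" using b_pos by (simp add: field_simps)
  finally show ?thesis .
qed

text \<open>A contractive perturbation of the identity is bounded below: the half is absorbed on the
  left.\<close>

lemma even_mpoly2_le_gtrace:
  assumes even: "\<And>n. odd n \<Longrightarrow> C n = 0"
  shows "wnorm (mpoly2 N C) \<le> 2 * wnorm (gtrace (KN N C))"
proof -
  have "wnorm (mpoly2 N C) \<le> wnorm (gtrace (KN N C)) + wnorm (\<lambda>x. gtrace (KN N C) x - mpoly2 N C x)"
    by (rule wnorm_triangle_le)
      (auto intro!: continuous_intros cont_gtrace_KN cont_mpoly2 norm_triangle_sub[of "mpoly2 N C _" "gtrace (KN N C) _", unfolded norm_minus_commute[of "mpoly2 N C _"]])
  with gtrace_minus_even_mpoly2[where N = N and C = C, OF even] show ?thesis by simp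
qed

text \<open>One Neumann step with an even polynomial close to the residual reduces the residual by a
  factor close to 1/2, so the infimum of the attainable residuals is zero.\<close>
lemma gtrace_even_dense:
  assumes A: "continuous_on {0..b} A" and \<epsilon>: "\<epsilon> > 0"
  shows "\<exists>N C. (\<forall>n. odd n \<longrightarrow> C n = 0) \<and> wnorm (\<lambda>x. A x - gtrace (KN N C) x) < \<epsilon>"
proof -
  define S where "S = {wnorm (\<lambda>x. A x - gtrace (KN N C) x) | N C. \<forall>n. odd n \<longrightarrow> C n = 0}"
  have ne: "S \<noteq> {}" unfolding S_def by (auto intro!: exI[of _ "\<lambda>_. 0"])
  have bdd: "bdd_below S" unfolding S_def by (intro bdd_belowI[of _ 0]) (auto simp: wnorm_nonneg)
  define \<delta> where "\<delta> = Inf S"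
  have \<delta>0: "\<delta> \<ge> 0" unfolding \<delta>_def using ne by (intro cInf_greatest) (auto simp: S_def wnorm_nonneg)
  have "\<delta> = 0"
  proof (rule ccontr)
    assume "\<delta> \<noteq> 0"
    then have \<delta>: "\<delta> > 0" using \<delta>0 by simp
    \<comment> \<open>With the accuracy \<open>\<eta>\<close> below, worth
      \<open>\<delta> / 8\<close> in L2, the new residual is less than (1/8 + (5/4 + 1/8) / 2)
      \<open>\<delta>\<close>, that is 13/16 \<open>\<delta>\<close>, which is below the
      infimum.\<close>
    then have "Inf S < 5 / 4 * \<delta>" by (simp add: \<delta>_def)
    from cInf_lessD[OF ne this] obtain N C where C: "\<And>n. odd n \<Longrightarrow> C n = 0"
      and small: "wnorm (\<lambda>x. A x - gtrace (KN N C) x) < 5 / 4 * \<delta>"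
      by (auto simp: S_def)
    define \<rho> where "\<rho> = (\<lambda>x. A x - gtrace (KN N C) x)"
    have cont\<rho>: "continuous_on {0..b} \<rho>" unfolding \<rho>_def by (intro continuous_intros A cont_gtrace_KN)
    define \<eta> where "\<eta> = \<delta> / (8 * sqrt b)"
    have "\<eta> > 0" using \<delta> b_pos by (simp add: \<eta>_def)
    from even_mpoly2_dense[OF cont\<rho> b_pos this] obtain N' D where
      D: "\<And>n. odd n \<Longrightarrow> D n = 0" "\<And>s. s \<in> {0..b} \<Longrightarrow> norm (\<rho> s - mpoly2 N' D s) < \<eta>" by blast
    define E where "E = (\<lambda>n. (if n \<le> N then C n else 0) + 1 *\<^sub>R (if n \<le> N' then D n else 0))"
    have res: "A x - gtrace (KN (max N N') E) x = (\<rho> x - mpoly2 N' D x) - (gtrace (KN N' D) x - mpoly2 N' D x)" for x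
      using gtrace_combine[of N N' C 1 D x] by (simp add: E_def \<rho>_def)
    have contd: "continuous_on {0..b} (\<lambda>x. \<rho> x - mpoly2 N' D x)"
      by (intro continuous_intros cont\<rho> cont_mpoly2)
    have close: "wnorm (\<lambda>x. \<rho> x - mpoly2 N' D x) \<le> \<delta> / 8"
    proof -
      have "wnorm (\<lambda>x. \<rho> x - mpoly2 N' D x) \<le> L2norm 0 b (\<lambda>x. \<rho> x - mpoly2 N' D x)"
        by (rule wnorm_le_L2norm[OF contd])
      also have "\<dots> \<le> sqrt (b - 0) * \<eta>"
        using D(2) b_pos by (intro L2norm_le_sup contd) (auto intro: less_imp_le)
      also have "\<dots> = \<delta> / 8" using b_pos by (simp add: \<eta>_def)
      finally show ?thesis .
    qed
    have "\<delta> \<le> wnorm (\<lambda>x. A x - gtrace (KN (max N N') E) x)"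
      unfolding \<delta>_def
    proof (rule cInf_lower[OF _ bdd])
      have "\<forall>n. odd n \<longrightarrow> E n = 0" using C D(1) by (simp add: E_def)
      then show "wnorm (\<lambda>x. A x - gtrace (KN (max N N') E) x) \<in> S" unfolding S_def by blast
    qed
    also have "\<dots> \<le> wnorm (\<lambda>x. \<rho> x - mpoly2 N' D x) + wnorm (\<lambda>x. gtrace (KN N' D) x - mpoly2 N' D x)"
    proof (rule wnorm_triangle_le)
      fix x
      show "norm (A x - gtrace (KN (max N N') E) x)
          \<le> norm (\<rho> x - mpoly2 N' D x) + norm (gtrace (KN N' D) x - mpoly2 N' D x)"
        unfolding res by (rule norm_triangle_ineq4)
    qed (intro continuous_intros A contd cont_gtrace_KN cont_mpoly2)+
    also have "\<dots> \<le> \<delta> / 8 + wnorm (mpoly2 N' D) / 2"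
      by (intro add_mono close gtrace_minus_even_mpoly2 D)
    also have "wnorm (mpoly2 N' D) \<le> wnorm \<rho> + wnorm (\<lambda>x. \<rho> x - mpoly2 N' D x)"
      by (rule wnorm_triangle_le)
        (auto intro!: contd cont\<rho> cont_mpoly2 norm_triangle_sub[of "mpoly2 N' D _" "\<rho> _", unfolded norm_minus_commute[of "mpoly2 N' D _"]])
    finally have "\<delta> \<le> \<delta> / 8 + (wnorm \<rho> + wnorm (\<lambda>x. \<rho> x - mpoly2 N' D x)) / 2" by simp
    moreover have "wnorm \<rho> < 5 / 4 * \<delta>" using small by (simp add: \<rho>_def)
    moreover have "False" if "\<delta> \<le> \<delta> / 8 + (r + c) / 2" "r < 5 / 4 * \<delta>" "c \<le> \<delta> / 8" for r c :: real
      using that \<delta> by (simp add: field_simps)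
    ultimately show False using close by blast
  qed
  then have "Inf S < \<epsilon>" using \<epsilon> by (simp add: \<delta>_def)
  from cInf_lessD[OF ne this] show ?thesis by (auto simp: S_def)
qed

end

section \<open>Approximation rate\<close>

lemma C_class_on_0: "C_class_on 0 S F \<longleftrightarrow> continuous_on S F"
proof
  assume "C_class_on 0 S F"
  then obtain D where "\<forall>x\<in>S. D 0 x = F x" "continuous_on S (D 0)"
    unfolding C_class_on_def by auto
  then show "continuous_on S F" by (auto intro: continuous_on_eq)
next
  assume "continuous_on S F"
  then show "C_class_on 0 S F"
    unfolding C_class_on_def by (intro exI[of _ "\<lambda>_. F"]) auto
qed

lemma C_class_on_Suc:
  "C_class_on (Suc r) S F \<longleftrightarrow>
    (\<exists>F'. (\<forall>x\<in>S. (F has_vector_derivative F' x) (at x within S)) \<and> C_class_on r S F')"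
proof
  assume "C_class_on (Suc r) S F"
  then obtain D where D: "\<And>x. x \<in> S \<Longrightarrow> D 0 x = F x"
    "\<And>k x. k < Suc r \<Longrightarrow> x \<in> S \<Longrightarrow> (D k has_vector_derivative D (Suc k) x) (at x within S)"
    "\<And>k. k \<le> Suc r \<Longrightarrow> continuous_on S (D k)"
    unfolding C_class_on_def by blast
  have "(F has_vector_derivative D 1 x) (at x within S)" if "x \<in> S" for x
    using D(2)[of 0 x] that by (intro has_vector_derivative_transform[OF that, of F "D 0"]) (auto simp: D(1))
  moreover have "C_class_on r S (D 1)"
    unfolding C_class_on_def by (rule exI[of _ "\<lambda>k. D (Suc k)"]) (auto simp: D)
  ultimately show "\<exists>F'. (\<forall>x\<in>S. (F has_vector_derivative F' x) (at x within S)) \<and> C_class_on r S F'"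
    by blast
next
  assume "\<exists>F'. (\<forall>x\<in>S. (F has_vector_derivative F' x) (at x within S)) \<and> C_class_on r S F'"
  then obtain F' D where F': "\<And>x. x \<in> S \<Longrightarrow> (F has_vector_derivative F' x) (at x within S)"
    and D: "\<And>x. x \<in> S \<Longrightarrow> D 0 x = F' x"
      "\<And>k x. k < r \<Longrightarrow> x \<in> S \<Longrightarrow> (D k has_vector_derivative D (Suc k) x) (at x within S)"
      "\<And>k. k \<le> r \<Longrightarrow> continuous_on S (D k)"
    unfolding C_class_on_def by blast
  have "continuous_on S F" by (rule continuous_on_vector_derivative, erule F')
  then show "C_class_on (Suc r) S F"
    unfolding C_class_on_def
  proof (intro exI[of _ "\<lambda>k. case k of 0 \<Rightarrow> F | Suc k \<Rightarrow> D k"] conjI allI impI ballI)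
    fix k x assume k: "k < Suc r" and x: "x \<in> S"
    show "((case k of 0 \<Rightarrow> F | Suc k \<Rightarrow> D k) has_vector_derivative
        (case Suc k of 0 \<Rightarrow> F | Suc k \<Rightarrow> D k) x) (at x within S)"
      using F'[OF x] D(1)[OF x] D(2)[OF _ x] k by (cases k) simp_all
  next
    fix k assume k: "k \<le> Suc r"
    then show "continuous_on S (case k of 0 \<Rightarrow> F | Suc k \<Rightarrow> D k)"
      using \<open>continuous_on S F\<close> D(3) by (cases k) simp_all
  qed simp
qed

lemma C_class_on_SucI:
  assumes "\<And>x. x \<in> S \<Longrightarrow> (F has_vector_derivative F' x) (at x within S)" "C_class_on r S F'"
  shows "C_class_on (Suc r) S F"
  unfolding C_class_on_Suc by (intro exI[of _ F'] conjI ballI assms)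

lemma C_class_on_SucD:
  assumes "C_class_on (Suc r) S F"
  shows "C_class_on r S F"
proof -
  obtain D where "\<forall>x\<in>S. D 0 x = F x"
    "\<forall>k<Suc r. \<forall>x\<in>S. (D k has_vector_derivative D (Suc k) x) (at x within S)"
    "\<forall>k\<le>Suc r. continuous_on S (D k)"
    using assms unfolding C_class_on_def by blast
  then show ?thesis
    unfolding C_class_on_def by (intro exI[of _ D]) simp
qed

lemma C_class_on_imp_continuous_on: "C_class_on r S F \<Longrightarrow> continuous_on S F"
  by (induction r) (auto simp: C_class_on_0 dest: C_class_on_SucD)

lemma C_class_on_bounded_linear:
  assumes L: "bounded_linear L" and F: "C_class_on r S F"
  shows "C_class_on r S (\<lambda>x. L (F x))"
proof -
  obtain D where D: "\<forall>x\<in>S. D 0 x = F x"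
    "\<forall>k<r. \<forall>x\<in>S. (D k has_vector_derivative D (Suc k) x) (at x within S)"
    "\<forall>k\<le>r. continuous_on S (D k)"
    using F unfolding C_class_on_def by blast
  show ?thesis
    unfolding C_class_on_def using D
    by (intro exI[of _ "\<lambda>k x. L (D k x)"] conjI allI impI ballI
        bounded_linear.has_vector_derivative[OF L] bounded_linear.continuous_on[OF L]) simp_all
qed

lemma C_class_on_add:
  assumes "C_class_on r S F" "C_class_on r S G"
  shows "C_class_on r S (\<lambda>x. F x + G x)"
proof -
  obtain D where D: "\<forall>x\<in>S. D 0 x = F x"
    "\<forall>k<r. \<forall>x\<in>S. (D k has_vector_derivative D (Suc k) x) (at x within S)"
    "\<forall>k\<le>r. continuous_on S (D k)"
    using assms(1) unfolding C_class_on_def by blast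
  obtain E where E: "\<forall>x\<in>S. E 0 x = G x"
    "\<forall>k<r. \<forall>x\<in>S. (E k has_vector_derivative E (Suc k) x) (at x within S)"
    "\<forall>k\<le>r. continuous_on S (E k)"
    using assms(2) unfolding C_class_on_def by blast
  show ?thesis
    unfolding C_class_on_def using D E
    by (intro exI[of _ "\<lambda>k x. D k x + E k x"] conjI allI impI ballI
        has_vector_derivative_add continuous_on_add) simp_all
qed

lemma C_class_on_matrix_mult:
  fixes F G :: "real \<Rightarrow> cmat2"
  assumes "C_class_on r S F" "C_class_on r S G"
  shows "C_class_on r S (\<lambda>x. F x ** G x)"
  using assms
proof (induction r arbitrary: F G)
  case 0
  then show ?case by (auto simp: C_class_on_0 intro!: continuous_intros)
next
  case (Suc r)
  from Suc.prems obtain F' G' where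
    F': "\<And>x. x \<in> S \<Longrightarrow> (F has_vector_derivative F' x) (at x within S)" "C_class_on r S F'" and
    G': "\<And>x. x \<in> S \<Longrightarrow> (G has_vector_derivative G' x) (at x within S)" "C_class_on r S G'"
    unfolding C_class_on_Suc by blast
  have "((\<lambda>x. F x ** G x) has_vector_derivative F x ** G' x + F' x ** G x) (at x within S)" if "x \<in> S" for x
    by (rule mm.has_vector_derivative[OF F'(1)[OF that] G'(1)[OF that]])
  moreover have "C_class_on r S (\<lambda>x. F x ** G' x + F' x ** G x)"
    using Suc.prems F'(2) G'(2) by (intro C_class_on_add Suc.IH) (auto dest: C_class_on_SucD)
  ultimately show ?case by (rule C_class_on_SucI)
qed

lemma tau_pow: "(tau ^^ k) A = (if even k then A else tau A)"
  by (induction k) auto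

section \<open>Induction on the order of smoothness\<close>

context dirac
begin

text \<open>The coefficients whose \<open>t\<close>-derivative family is \<open>C\<close>, with constant coefficient \<open>C0\<close>.\<close>
definition lift_coeffs :: "cmat2 \<Rightarrow> (nat \<Rightarrow> cmat2) \<Rightarrow> nat \<Rightarrow> cmat2" where
  "lift_coeffs C0 C n = (case n of 0 \<Rightarrow> C0 | Suc m \<Rightarrow> (1 / of_nat (Suc m)) *\<^sub>R tau (C m))"

lemma KNt_lift: "KNt (Suc N) (lift_coeffs C0 C) x t = KN N C x t"
  unfolding KNt_def sum.atMost_Suc_shift KN_def
  by (simp add: lift_coeffs_def tau_simps Kn_linear del: of_nat_Suc)

lemma gtrace_KNt_lift: "gtrace (KNt (Suc N) (lift_coeffs C0 C)) = gtrace (KN N C)"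
  by (simp add: gtrace_def[abs_def] KNt_lift)

lemma KN_0_0: "KN N C 0 0 = C 0"
proof -
  have "KN N C 0 0 = (\<Sum>n\<le>N. if n = 0 then C 0 else 0)"
    unfolding KN_def by (rule sum.cong) (auto simp: Kn_0)
  then show ?thesis by simp
qed

lemma gtrace_cotrace_0: "gtrace (KN N C) 0 = C 0" "cotrace (KN N C) 0 = C 0"
  using Pplus_plus_Pminus[of "C 0"] by (simp_all add: gtrace_def cotrace_def KN_0_0 add.commute)

text \<open>Lifting integrates the polynomial too, so the derivative in Jackson's inequality is
  controlled by the polynomial before lifting.\<close>

lemma mpoly2_lift_deriv:
  "(mpoly2 (Suc N) (lift_coeffs C0 C) has_vector_derivative 2 *\<^sub>R tau (mpoly2 N C s)) (at s)"
proof -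
  have pow: "((\<lambda>s. (2 * s) ^ Suc n) has_real_derivative of_nat (Suc n) * (2 * s) ^ n * 2) (at s)" for n
    by (rule DERIV_cong, rule DERIV_power, rule DERIV_cmult, rule DERIV_ident) simp
  have "((\<lambda>s. lift_coeffs C0 C 0 + (\<Sum>n\<le>N. (2 * s) ^ Suc n *\<^sub>R lift_coeffs C0 C (Suc n))) has_vector_derivative
      0 + (\<Sum>n\<le>N. (of_nat (Suc n) * (2 * s) ^ n * 2) *\<^sub>R lift_coeffs C0 C (Suc n))) (at s)"
    by (intro has_vector_derivative_add has_vector_derivative_sum has_vector_derivative_const
        has_vector_derivative_eq_rhs[OF has_vector_derivative_scaleR[OF pow has_vector_derivative_const]])
      simp
  moreover have "(of_nat (Suc n) * (2 * s) ^ n * 2) *\<^sub>R lift_coeffs C0 C (Suc n)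
      = 2 *\<^sub>R tau ((2 * s) ^ n *\<^sub>R C n)" for n
    by (simp add: lift_coeffs_def tau_simps del: of_nat_Suc)
  moreover have "mpoly2 (Suc N) (lift_coeffs C0 C)
      = (\<lambda>s. lift_coeffs C0 C 0 + (\<Sum>n\<le>N. (2 * s) ^ Suc n *\<^sub>R lift_coeffs C0 C (Suc n)))"
    unfolding mpoly2_def[abs_def] sum.atMost_Suc_shift by simp
  ultimately show ?thesis
    by (simp add: mpoly2_def tau_simps(6) scaleR_sum_right)
qed

text \<open>Gronwall's inequality for norm A + norm F, with the L1 norm of \<open>A1\<close> as
  source. It is applied to what remains of the data after subtraction of the lifts, where
  \<open>A1\<close> is a residual.\<close>

lemma trace_system_bound:
  assumes A: "\<And>x. x \<in> {0..b} \<Longrightarrow> (A has_vector_derivative BQ p q x ** F x + 2 *\<^sub>R tau (A1 x)) (at x within {0..b})"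
    and F: "\<And>x. x \<in> {0..b} \<Longrightarrow> (F has_vector_derivative BQ p q x ** A x) (at x within {0..b})"
    and 0: "A 0 = 0" "F 0 = 0" and A1: "continuous_on {0..b} A1"
  shows "L2norm 0 b A \<le> 4 * b * exp (4 * MQ * b) * L2norm 0 b A1"
proof -
  have cA: "continuous_on {0..b} A" and cF: "continuous_on {0..b} F"
    by (rule continuous_on_vector_derivative, erule A) (rule continuous_on_vector_derivative, erule F)
  define R where "R = integral {0..b} (\<lambda>s. norm (A1 s))"
  have R0: "0 \<le> R" unfolding R_def by (intro integral_nonneg integrable_continuous_real continuous_intros A1) simp
  have sub: "continuous_on {0..x} J" if "continuous_on {0..b} J" "x \<in> {0..b}" for x and J :: "real \<Rightarrow> cmat2"
    using that by (auto intro: continuous_on_subset)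
  define G where "G x = norm (A x) + norm (F x)" for x
  have ineq: "G x \<le> 2 * R + MQ * integral {0..x} G" if x: "x \<in> {0..b}" for x
  proof -
    note c = sub[OF cA x] sub[OF cF x] sub[OF A1 x] sub[OF cont_BQ x]
    have "((\<lambda>s. BQ p q s ** F s + 2 *\<^sub>R tau (A1 s)) has_integral A x - A 0) {0..x}"
      by (rule fundamental_theorem_of_calculus)
        (use x in \<open>auto intro: has_vector_derivative_within_subset[OF A]\<close>)
    then have Ax: "A x = integral {0..x} (\<lambda>s. BQ p q s ** F s + 2 *\<^sub>R tau (A1 s))"
      by (simp add: 0 integral_unique)
    have "((\<lambda>s. BQ p q s ** A s) has_integral F x - F 0) {0..x}"
      by (rule fundamental_theorem_of_calculus)
        (use x in \<open>auto intro: has_vector_derivative_within_subset[OF F]\<close>)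
    then have Fx: "F x = integral {0..x} (\<lambda>s. BQ p q s ** A s)"
      by (simp add: 0 integral_unique)
    have "norm (A x) \<le> integral {0..x} (\<lambda>s. MQ * norm (F s) + 2 * norm (A1 s))"
      unfolding Ax
    proof (intro integral_norm_bound_integral integrable_continuous_real continuous_intros c)
      fix s assume "s \<in> {0..x}"
      then have "norm (BQ p q s ** F s) \<le> MQ * norm (F s)" using x by (intro norm_BQ_mult_le) auto
      then show "norm (BQ p q s ** F s + 2 *\<^sub>R tau (A1 s)) \<le> MQ * norm (F s) + 2 * norm (A1 s)"
        by (intro norm_triangle_le add_mono) auto
    qed
    moreover have "norm (F x) \<le> integral {0..x} (\<lambda>s. MQ * norm (A s))"
      unfolding Fx
    proof (intro integral_norm_bound_integral integrable_continuous_real continuous_intros c)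
      fix s assume "s \<in> {0..x}"
      then show "norm (BQ p q s ** A s) \<le> MQ * norm (A s)" using x by (intro norm_BQ_mult_le) auto
    qed
    ultimately have "G x \<le> integral {0..x} (\<lambda>s. MQ * norm (F s) + 2 * norm (A1 s)) + integral {0..x} (\<lambda>s. MQ * norm (A s))"
      by (simp add: G_def)
    also have "\<dots> = integral {0..x} (\<lambda>s. MQ * G s + 2 * norm (A1 s))"
      by (subst integral_add[symmetric])
        (auto intro!: integrable_continuous_real continuous_intros c integral_cong simp: G_def algebra_simps)
    also have "\<dots> = MQ * integral {0..x} G + 2 * integral {0..x} (\<lambda>s. norm (A1 s))"
      unfolding G_def
      by (intro integral_unique has_integral_add has_integral_mult_right integrable_integral
          integrable_continuous_real continuous_intros c)
    also have "integral {0..x} (\<lambda>s. norm (A1 s)) \<le> R"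
      unfolding R_def using x
      by (intro integral_subset_le integrable_continuous_real continuous_intros A1 c) auto
    finally show ?thesis by simp
  qed
  have "G x \<le> 2 * (2 * R) * exp (4 * MQ * b)" if x: "x \<in> {0..b}" for x
  \<comment> \<open>A single variable is encoded by a degenerate domain with y = 0; the first
    integral is then over a point and vanishes.\<close>
  proof (rule Volterra_bound[where T = "{0..b} \<times> {0}" and G = "\<lambda>x y. G x" and l = "\<lambda>_. 0" and m = "\<lambda>_. 0" and y = 0])
    show "continuous_on ({0..b} \<times> {0}) (\<lambda>(x, y). G x)"
      unfolding G_def case_prod_unfold
      by (intro continuous_intros continuous_on_compose2[OF cA] continuous_on_compose2[OF cF]) auto
    show "G x \<le> 2 * R + MQ * integral {0..y} (\<lambda>v. G x) + MQ * integral {0..x} (\<lambda>u. G u)"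
      if "(x, y) \<in> {0..b} \<times> {0}" for x and y :: real
      using that ineq[of x] by simp
  qed (use x R0 MQ_pos in \<open>auto intro: compact_Times\<close>)
  moreover have "norm (A x) \<le> G x" for x by (simp add: G_def)
  ultimately have "norm (A x) \<le> 2 * (2 * R) * exp (4 * MQ * b)" if "x \<in> {0..b}" for x
    using that order_trans by blast
  then have "L2norm 0 b A \<le> sqrt (b - 0) * (2 * (2 * R) * exp (4 * MQ * b))"
    using b_pos by (intro L2norm_le_sup cA) simp_all
  also have "\<dots> \<le> sqrt b * (4 * (sqrt b * L2norm 0 b A1) * exp (4 * MQ * b))"
    using integral_norm_le_L2norm[OF A1] b_pos by (auto simp: R_def)
  also have "\<dots> = 4 * b * exp (4 * MQ * b) * L2norm 0 b A1"
    using b_pos by simp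
  finally show ?thesis .
qed

definition approximable :: "nat \<Rightarrow> (real \<Rightarrow> cmat2) \<Rightarrow> real \<Rightarrow> bool" where
  "approximable N A e \<longleftrightarrow> (\<exists>C. L2norm 0 b (\<lambda>x. A x - gtrace (KN N C) x) \<le> e)"

text \<open>Factor 2 for passing from [0, b] to [-b, b], another 2 for inverting the trace, and the
  exponential for removing the weight.\<close>

lemma L2norm_even_mpoly2_le:
  assumes even: "\<And>n. odd n \<Longrightarrow> C n = 0"
  shows "L2norm (-b) b (mpoly2 N C) \<le> 4 * exp (wt * b) * L2norm 0 b (gtrace (KN N C))"
proof -
  have "L2norm (-b) b (mpoly2 N C) \<le> 2 * L2norm 0 b (mpoly2 N C)"
    using b_pos by (intro L2norm_even_le cont_mpoly2 mpoly2_even even) auto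
  also have "\<dots> \<le> 2 * (exp (wt * b) * wnorm (mpoly2 N C))"
    by (intro mult_left_mono L2norm_le_wnorm cont_mpoly2) simp
  also have "\<dots> \<le> 2 * (exp (wt * b) * (2 * wnorm (gtrace (KN N C))))"
    by (intro mult_left_mono even_mpoly2_le_gtrace even) auto
  also have "\<dots> \<le> 2 * (exp (wt * b) * (2 * L2norm 0 b (gtrace (KN N C))))"
    by (intro mult_left_mono wnorm_le_L2norm cont_gtrace_KN) auto
  finally show ?thesis by simp
qed

text \<open>The two error terms of \<open>approximable_Suc\<close>: the lift of the unrepresented
  residual, by \<open>trace_system_bound\<close>, and the truncated lift of the even polynomial, by
  \<open>gtrace_bounded\<close> and Jackson's inequality.\<close>

definition step_const :: real where
  "step_const = 4 * b * exp (4 * MQ * b) + (1 + 4 * b * CV) * (b * 2 * (8 * exp (wt * b)))"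

lemma step_const_pos: "step_const > 0"
  using b_pos CV_pos unfolding step_const_def by (intro add_pos_pos mult_pos_pos) auto

text \<open>The approximation of \<open>A1\<close> lifts to \<open>A\<close>; the remaining error of \<open>A1\<close> is represented by an even
  polynomial of comparable norm, whose lift gains the factor \<open>1 / N\<close> in Jackson's inequality.\<close>
lemma approximable_Suc:
  assumes A: "\<And>x. x \<in> {0..b} \<Longrightarrow> (A has_vector_derivative BQ p q x ** F x + 2 *\<^sub>R tau (A1 x)) (at x within {0..b})"
    and F: "\<And>x. x \<in> {0..b} \<Longrightarrow> (F has_vector_derivative BQ p q x ** A x) (at x within {0..b})"
    and AF: "F 0 = A 0" and A1: "continuous_on {0..b} A1"
    and approx: "approximable N A1 e" and e: "e > 0"
  shows "approximable (Suc N) A (step_const / of_nat (Suc N) * e)"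
proof -
  obtain C1 where C1: "L2norm 0 b (\<lambda>x. A1 x - gtrace (KN N C1) x) \<le> e"
    using approx unfolding approximable_def by blast
  \<comment> \<open>The residual \<open>r\<close> below gains nothing from Jackson's inequality, so
    the factor 1 / (N + 2) is built into its required size.\<close>
  define \<epsilon> where "\<epsilon> = e / of_nat (N + 2)"
  have \<epsilon>: "\<epsilon> > 0" "\<epsilon> \<le> e" using e by (simp_all add: \<epsilon>_def field_simps)
  have cr: "continuous_on {0..b} (\<lambda>x. A1 x - gtrace (KN N C1) x)"
    by (intro continuous_intros A1 cont_gtrace_KN)
  from gtrace_even_dense[OF cr, of "\<epsilon> / exp (wt * b)"] \<epsilon>(1) obtain M C3 where
    C3: "\<And>n. odd n \<Longrightarrow> C3 n = 0"
    and close: "wnorm (\<lambda>x. A1 x - gtrace (KN N C1) x - gtrace (KN M C3) x) < \<epsilon> / exp (wt * b)"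
    by auto
  define r where "r = (\<lambda>x. A1 x - gtrace (KN N C1) x - gtrace (KN M C3) x)"
  have contr: "continuous_on {0..b} r" unfolding r_def by (intro continuous_intros cr cont_gtrace_KN)
  have r_small: "L2norm 0 b r \<le> \<epsilon>"
  proof -
    have "L2norm 0 b r \<le> exp (wt * b) * wnorm r" by (rule L2norm_le_wnorm[OF contr])
    also have "\<dots> \<le> exp (wt * b) * (\<epsilon> / exp (wt * b))"
      using close by (intro mult_left_mono) (auto simp: r_def)
    finally show ?thesis by simp
  qed
  \<comment> \<open>The constant coefficients do not affect the t-derivative. Their sum is
    \<open>A 0\<close>, so that \<open>D\<close> and the corresponding remainder of \<open>F\<close>
    vanish at 0.\<close>
  define L1 where "L1 = lift_coeffs 0 C1"
  define L3 where "L3 = lift_coeffs (A 0) C3"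
  define D where "D = (\<lambda>x. A x - gtrace (KN (Suc N) L1) x - gtrace (KN (Suc M) L3) x)"
  have D_small: "L2norm 0 b D \<le> 4 * b * exp (4 * MQ * b) * L2norm 0 b r"
  proof (rule trace_system_bound)
    fix x assume x: "x \<in> {0..b}"
    have "(D has_vector_derivative
        (BQ p q x ** F x + 2 *\<^sub>R tau (A1 x))
        - (BQ p q x ** cotrace (KN (Suc N) L1) x + 2 *\<^sub>R tau (gtrace (KNt (Suc N) L1) x))
        - (BQ p q x ** cotrace (KN (Suc M) L3) x + 2 *\<^sub>R tau (gtrace (KNt (Suc M) L3) x))) (at x within {0..b})"
      unfolding D_def by (intro has_vector_derivative_diff A gtrace_KN_deriv x)
    then show "(D has_vector_derivative BQ p q x ** (F x - cotrace (KN (Suc N) L1) x - cotrace (KN (Suc M) L3) x)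
        + 2 *\<^sub>R tau (r x)) (at x within {0..b})"
      unfolding L1_def L3_def gtrace_KNt_lift r_def
      by (simp add: mm.diff_right mm.add_right tau_simps algebra_simps)
    have "((\<lambda>x. F x - cotrace (KN (Suc N) L1) x - cotrace (KN (Suc M) L3) x) has_vector_derivative
        BQ p q x ** A x - BQ p q x ** gtrace (KN (Suc N) L1) x - BQ p q x ** gtrace (KN (Suc M) L3) x) (at x within {0..b})"
      by (intro has_vector_derivative_diff F cotrace_KN_deriv x)
    then show "((\<lambda>x. F x - cotrace (KN (Suc N) L1) x - cotrace (KN (Suc M) L3) x) has_vector_derivative
        BQ p q x ** D x) (at x within {0..b})"
      by (simp add: D_def mm.diff_right)
  qed (simp_all add: D_def gtrace_cotrace_0 L1_def L3_def lift_coeffs_def AF contr)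
  have C3_norm: "L2norm (-b) b (mpoly2 M C3) \<le> 8 * exp (wt * b) * e"
  proof -
    \<comment> \<open>The trace of \<open>C3\<close> is the residual of \<open>A1\<close> minus
      \<open>r\<close>, hence of size at most \<open>e + \<epsilon>\<close>.\<close>
    have "L2norm 0 b (gtrace (KN M C3)) \<le> L2norm 0 b (\<lambda>x. A1 x - gtrace (KN N C1) x) + L2norm 0 b r"
    proof (rule L2norm_triangle_le[OF cont_gtrace_KN cr contr])
      fix x
      show "norm (gtrace (KN M C3) x) \<le> norm (A1 x - gtrace (KN N C1) x) + norm (r x)"
        using norm_triangle_ineq4[of "A1 x - gtrace (KN N C1) x" "r x"] by (simp add: r_def)
    qed
    then have "L2norm 0 b (gtrace (KN M C3)) \<le> 2 * e" using C1 r_small \<epsilon> by linarith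
    then have "4 * exp (wt * b) * L2norm 0 b (gtrace (KN M C3)) \<le> 4 * exp (wt * b) * (2 * e)"
      by (intro mult_left_mono) auto
    then have "4 * exp (wt * b) * L2norm 0 b (gtrace (KN M C3)) \<le> 8 * exp (wt * b) * e"
      by simp
    with L2norm_even_mpoly2_le[where C = C3 and N = M, OF C3] show ?thesis by (rule order_trans)
  qed
  have contT: "continuous_on {-b..b} (\<lambda>s. 2 *\<^sub>R tau (mpoly2 M C3 s))"
    by (intro continuous_intros cont_mpoly2)
  obtain C5 where C5: "L2norm (-b) b (\<lambda>s. mpoly2 (Suc M) L3 s - mpoly2 (Suc N) C5 s)
      \<le> b / of_nat (Suc N + 1) * L2norm (-b) b (\<lambda>s. 2 *\<^sub>R tau (mpoly2 M C3 s))"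
    using Jackson_polynomial[OF b_pos mpoly2_lift_deriv[where N = M and ?C0.0 = "A 0" and C = C3] contT, of "Suc N"]
    unfolding L3_def by blast
  have "L2norm (-b) b (\<lambda>s. 2 *\<^sub>R tau (mpoly2 M C3 s)) \<le> 2 * L2norm (-b) b (mpoly2 M C3)"
    by (rule L2norm_le) (auto intro!: continuous_intros cont_mpoly2)
  then have "L2norm (-b) b (\<lambda>s. 2 *\<^sub>R tau (mpoly2 M C3 s)) \<le> 2 * (8 * exp (wt * b) * e)"
    using C3_norm by linarith
  then have jackson: "L2norm (-b) b (\<lambda>s. mpoly2 (Suc M) L3 s - mpoly2 (Suc N) C5 s)
      \<le> b / of_nat (N + 2) * (2 * (8 * exp (wt * b) * e))"
    using b_pos by (intro order_trans[OF C5] mult_mono) (auto simp: L2norm_nonneg)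
  \<comment> \<open>What the cut to degree N + 1 discards, written as a coefficient family so that
    \<open>gtrace_bounded\<close> applies to it.\<close>
  define E where "E = (\<lambda>n. (if n \<le> Suc M then L3 n else 0) + (-1) *\<^sub>R (if n \<le> Suc N then C5 n else 0))"
  have trE: "gtrace (KN (max (Suc M) (Suc N)) E) x = gtrace (KN (Suc M) L3) x - gtrace (KN (Suc N) C5) x" for x
    unfolding E_def gtrace_combine by simp
  have polyE: "mpoly2 (max (Suc M) (Suc N)) E = (\<lambda>s. mpoly2 (Suc M) L3 s - mpoly2 (Suc N) C5 s)"
    unfolding E_def mpoly2_combine by (rule ext) simp
  have E_small: "L2norm 0 b (gtrace (KN (max (Suc M) (Suc N)) E))
      \<le> (1 + 4 * b * CV) * (b / of_nat (N + 2) * (2 * (8 * exp (wt * b) * e)))"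
  proof -
    have "L2norm 0 b (gtrace (KN (max (Suc M) (Suc N)) E))
        \<le> (1 + 4 * b * CV) * L2norm (-b) b (mpoly2 (max (Suc M) (Suc N)) E)"
      by (rule gtrace_bounded)
    also have "\<dots> \<le> (1 + 4 * b * CV) * (b / of_nat (N + 2) * (2 * (8 * exp (wt * b) * e)))"
      unfolding polyE using jackson b_pos CV_pos by (intro mult_left_mono) simp_all
    finally show ?thesis .
  qed
  define L where "L = (\<lambda>n. (if n \<le> Suc N then L1 n else 0) + 1 *\<^sub>R (if n \<le> Suc N then C5 n else 0))"
  have trL: "gtrace (KN (Suc N) L) x = gtrace (KN (Suc N) L1) x + gtrace (KN (Suc N) C5) x" for x
    using gtrace_combine[of "Suc N" "Suc N" L1 1 C5 x] by (simp add: L_def)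
  have contD: "continuous_on {0..b} D"
    unfolding D_def
    by (intro continuous_intros cont_gtrace_KN continuous_on_vector_derivative[where f = A]) (erule A)
  have "L2norm 0 b (\<lambda>x. A x - gtrace (KN (Suc N) L) x)
      \<le> L2norm 0 b D + L2norm 0 b (gtrace (KN (max (Suc M) (Suc N)) E))"
  proof (rule L2norm_triangle_le)
    fix x
    have "A x - gtrace (KN (Suc N) L) x = D x + gtrace (KN (max (Suc M) (Suc N)) E) x"
      unfolding trL trE D_def by simp
    then show "norm (A x - gtrace (KN (Suc N) L) x) \<le> norm (D x) + norm (gtrace (KN (max (Suc M) (Suc N)) E) x)"
      by (simp add: norm_triangle_ineq)
  next
    show "continuous_on {0..b} (\<lambda>x. A x - gtrace (KN (Suc N) L) x)"
      by (intro continuous_intros cont_gtrace_KN continuous_on_vector_derivative[where f = A]) (erule A)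
  qed (intro contD cont_gtrace_KN)+
  also have "\<dots> \<le> 4 * b * exp (4 * MQ * b) * \<epsilon>
      + (1 + 4 * b * CV) * (b / of_nat (N + 2) * (2 * (8 * exp (wt * b) * e)))"
    using b_pos by (intro add_mono order_trans[OF D_small] E_small mult_left_mono r_small) auto
  also have "\<dots> = step_const / of_nat (N + 2) * e"
  proof -
    have "X * (e / n) + Y * (b / n * (2 * (8 * w * e))) = (X + Y * (b * 2 * (8 * w))) / n * e"
      for X Y w n :: real
      by (simp add: add_divide_distrib distrib_right)
    then show ?thesis unfolding step_const_def \<epsilon>_def by blast
  qed
  also have "\<dots> \<le> step_const / of_nat (Suc N) * e"
    using step_const_pos e by (intro mult_right_mono divide_left_mono) auto
  finally show ?thesis unfolding approximable_def by blast
qed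

lemma approximable_C_class:
  assumes "C_class_on r {0..b} (BQ p q)" "C_class_on r {0..b} A"
  shows "\<exists>c>0. \<forall>N>r. approximable N A (c / of_nat N ^ r)"
  using assms
proof (induction r arbitrary: A)
  case 0
  have "gtrace (KN N (\<lambda>_. 0)) x = 0" for N x
    by (simp add: gtrace_def KN_def Kn_linear Pplus_simps Pminus_simps)
  \<comment> \<open>The + 1 keeps the constant positive, as \<open>approximable_Suc\<close> requires
    of its error bound.\<close>
  then have "approximable N A (L2norm 0 b A + 1)" for N
    unfolding approximable_def by (intro exI[of _ "\<lambda>_. 0"]) simp
  then show ?case
    using L2norm_nonneg[of 0 b A] by (intro exI[of _ "L2norm 0 b A + 1"]) auto
next
  case (Suc r)
  obtain A' where A': "\<And>x. x \<in> {0..b} \<Longrightarrow> (A has_vector_derivative A' x) (at x within {0..b})"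
    and A'r: "C_class_on r {0..b} A'"
    using Suc.prems(2) unfolding C_class_on_Suc by blast
  note Qr = C_class_on_SucD[OF Suc.prems(1)] and Ar = C_class_on_SucD[OF Suc.prems(2)]
  have cA: "continuous_on {0..b} A" by (rule C_class_on_imp_continuous_on[OF Ar])
  \<comment> \<open>What the cotrace of a solution with data \<open>A\<close> would have to be, by
    \<open>cotrace_KN_deriv\<close> and the common value in \<open>gtrace_cotrace_0\<close>.\<close>
  define F where "F = (\<lambda>x. A 0 + integral {0..x} (\<lambda>s. BQ p q s ** A s))"
  have F: "(F has_vector_derivative BQ p q x ** A x) (at x within {0..b})" if "x \<in> {0..b}" for x
  proof -
    have "(F has_vector_derivative 0 + BQ p q x ** A x) (at x within {0..b})"
      unfolding F_def
      by (intro has_vector_derivative_add has_vector_derivative_const integral_has_vector_derivative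
          continuous_intros cont_BQ cA that)
    then show ?thesis by simp
  qed
  have "C_class_on (Suc r) {0..b} F"
    by (rule C_class_on_SucI[OF F C_class_on_matrix_mult[OF Qr Ar]])
  then have Fr: "C_class_on r {0..b} F" by (rule C_class_on_SucD)
  \<comment> \<open>Solves A' = BQ F + 2 \<open>tau\<close> A1 for A1, using that \<open>tau\<close>
    is an involution.\<close>
  define A1 where "A1 = (\<lambda>x. (1/2) *\<^sub>R tau (A' x + (- 1) *\<^sub>R (BQ p q x ** F x)))"
  have A1r: "C_class_on r {0..b} A1"
    unfolding A1_def
    by (intro C_class_on_bounded_linear[OF bounded_linear_scaleR_right] C_class_on_bounded_linear[OF bounded_linear_tau]
        C_class_on_add C_class_on_matrix_mult A'r Qr Fr)
  have A1: "(A has_vector_derivative BQ p q x ** F x + 2 *\<^sub>R tau (A1 x)) (at x within {0..b})" if "x \<in> {0..b}" for x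
    using A'[OF that] by (simp add: A1_def tau_simps)
  from Suc.IH[OF Qr A1r] obtain c where c: "c > 0" "\<And>N. N > r \<Longrightarrow> approximable N A1 (c / of_nat N ^ r)"
    by blast
  have "approximable N A (step_const * c * 2 ^ r / of_nat N ^ Suc r)" if N: "N > Suc r" for N
  proof -
    obtain M where M: "N = Suc M" "M > r" using N by (cases N) auto
    then have M0: "real M > 0" by simp
    have "approximable (Suc M) A (step_const / of_nat (Suc M) * (c / of_nat M ^ r))"
      by (rule approximable_Suc[OF A1 F _ C_class_on_imp_continuous_on[OF A1r] c(2)[OF M(2)]])
        (use c(1) M0 in \<open>auto simp: F_def\<close>)
    \<comment> \<open>Replacing M by N = M + 1 in the r-th power costs at most 2^r, because M \<ge>
      1.\<close>
    moreover have "step_const / of_nat (Suc M) * (c / of_nat M ^ r) \<le> step_const * c * 2 ^ r / of_nat N ^ Suc r"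
    proof -
      have "real (Suc M) ^ r \<le> (2 * real M) ^ r"
        using M(2) by (intro power_mono) auto
      then have "c / real M ^ r \<le> c * 2 ^ r / real (Suc M) ^ r"
        using M0 c(1) by (simp add: divide_simps power_mult_distrib mult.commute)
      then have "step_const / real (Suc M) * (c / real M ^ r) \<le> step_const / real (Suc M) * (c * 2 ^ r / real (Suc M) ^ r)"
        using step_const_pos by (intro mult_left_mono) auto
      then show ?thesis by (simp add: M(1) mult_ac)
    qed
    ultimately show ?thesis unfolding approximable_def M(1)[symmetric] using order_trans by blast
  qed
  then show ?case
    using step_const_pos c(1) by (intro exI[of _ "step_const * c * 2 ^ r"]) auto
qed

section \<open>The least squares problem in terms of Goursat data\<close>

definition even_part :: "nat \<Rightarrow> real \<Rightarrow> real \<Rightarrow> cmat2" where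
  "even_part n x t = of_columns (U_2m_minus_1 p f g n x t) (V_2m_minus_1 p f g n x t)"

definition odd_part :: "nat \<Rightarrow> real \<Rightarrow> real \<Rightarrow> cmat2" where
  "odd_part n x t = of_columns (U_2m p f g n x t) (V_2m p f g n x t)"

lemma even_odd_part_sum:
  "even_part n x t = (\<Sum>k\<le>n. if even k then (of_nat (n choose k) * t ^ k) *\<^sub>R Mmat (n - k) x else 0)"
  "odd_part n x t = (\<Sum>k\<le>n. if odd k then (of_nat (n choose k) * t ^ k) *\<^sub>R Mmat (n - k) x else 0)"
proof -
  have filter: "(\<Sum>k\<in>{k. k \<le> n \<and> P k}. h k) = (\<Sum>k\<le>n. if P k then h k else 0)" for P and h :: "nat \<Rightarrow> complex"
    using sum.inter_filter[of "{..n}" h P] by simp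
  have nth: "(\<Sum>k\<le>n. if P k then c k *\<^sub>R D k else 0) $ i $ j = (\<Sum>k\<le>n. if P k then of_real (c k) * D k $ i $ j else 0)"
    for P c i j and D :: "nat \<Rightarrow> cmat2"
    by (simp add: sum_component) (intro sum.cong, auto simp: scaleR_conv_of_real[where 'a = complex])
  show "even_part n x t = (\<Sum>k\<le>n. if even k then (of_nat (n choose k) * t ^ k) *\<^sub>R Mmat (n - k) x else 0)"
    "odd_part n x t = (\<Sum>k\<le>n. if odd k then (of_nat (n choose k) * t ^ k) *\<^sub>R Mmat (n - k) x else 0)"
    by (intro cmat2_eqI; unfold nth;
        simp add: even_part_def odd_part_def U_2m_minus_1_def V_2m_minus_1_def U_2m_def V_2m_def
          wave_even_sum_def wave_odd_sum_def filter sum_component;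
        auto intro!: sum.cong simp: Mmat_def)+
qed

lemma even_odd_part_minus: "even_part n x (- t) = even_part n x t" "odd_part n x (- t) = - odd_part n x t"
  unfolding even_odd_part_sum sum_negf[symmetric] by (auto intro!: sum.cong)

text \<open>The power \<open>tau ^^ k\<close> depends only on the parity of k; this is the reason
  for the separate sums over even and odd k in the wave matrices.\<close>

lemma Kn_split: "Kn n C x t = even_part n x t ** C + odd_part n x t ** tau C"
  unfolding even_odd_part_sum mm.sum_left sum.distrib[symmetric] Kn_def
  by (rule sum.cong) (auto simp: tau_pow mm.scaleR_left mm.scaleR_right mm.zero_left)

text \<open>At t = - x the odd part changes sign, and \<open>Pplus\<close> minus
  \<open>Pminus\<close> is \<open>tau\<close>; so the data is E + \<open>tau\<close> O', which
  multiplication by B turns into the two terms of \<open>Nmat\<close>.\<close>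

lemma Nmat_mult: "Nmat p f g n x ** C = Bmat ** (Pplus (Kn n C x x) + Pminus (Kn n C x (- x)))"
proof -
  have Nmat: "Nmat p f g n x = Bmat ** even_part n x x + odd_part n x x ** Bmat"
    by (intro cmat2_eqI)
      (simp_all add: Nmat_def even_part_def odd_part_def mult_nth matrix_vector_mult_def sum_2)
  define E where "E = even_part n x x ** C"
  define O' where "O' = odd_part n x x ** tau C"
  have "Pplus (E + O') + Pminus (E - O') = (Pplus E + Pminus E) + (Pplus O' - Pminus O')"
    by (simp only: Pplus_simps Pminus_simps) simp
  also have "\<dots> = E + tau O'" by (simp only: Pplus_plus_Pminus Pplus_minus_Pminus)
  finally have "Bmat ** (Pplus (E + O') + Pminus (E - O')) = Bmat ** E - O' ** Bmat"
    by (simp add: mm.add_right tau_def matrix_mul_assoc[symmetric])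
  also have "O' ** Bmat = - (odd_part n x x ** (Bmat ** C))"
    by (simp add: O'_def tau_def matrix_mul_assoc[symmetric] Bmat_square mm.minus_right)
  finally show ?thesis
    by (simp add: Nmat Kn_split even_odd_part_minus mm.minus_left mm.add_left E_def O'_def matrix_mul_assoc)
qed

definition coeff_matrices :: "(nat \<Rightarrow> complex) \<times> (nat \<Rightarrow> complex) \<times> (nat \<Rightarrow> complex) \<times> (nat \<Rightarrow> complex) \<Rightarrow> nat \<Rightarrow> cmat2" where
  "coeff_matrices = (\<lambda>(a, \<beta>, c, d) n. vector [vector [a n, \<beta> n], vector [c n, d n]])"

text \<open>\<open>O1\<close> to \<open>O4\<close> are the values of \<open>Kn n\<close> at the four
  matrix units.\<close>

lemma approx_kernel_eq: "approx_kernel p f g N z x t = KN N (coeff_matrices z) x t"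
proof -
  obtain a \<beta> c d where z: "z = (a, \<beta>, c, d)" by (cases z)
  have "cscale (a n) (O1 p f g n x t) + cscale (\<beta> n) (O2 p f g n x t)
      + cscale (c n) (O3 p f g n x t) + cscale (d n) (O4 p f g n x t) = Kn n (coeff_matrices z n) x t" for n
    unfolding Kn_split z coeff_matrices_def
    by (intro cmat2_eqI)
      (simp_all add: cscale_def O1_def O2_def O3_def O4_def even_part_def odd_part_def mult_nth algebra_simps)
  then show ?thesis by (simp add: approx_kernel_def z KN_def)
qed

lemma lsq_objective_eq:
  "lsq_objective b p q f g N z = (L2norm 0 b (\<lambda>x. (1/2) *\<^sub>R BQ p q x - gtrace (KN N (coeff_matrices z)) x))\<^sup>2"
proof -
  obtain a \<beta> c d where z: "z = (a, \<beta>, c, d)" by (cases z)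
  have "(\<Sum>n\<le>N. Nmat p f g n x ** coeff_matrices z n) = Bmat ** gtrace (KN N (coeff_matrices z)) x" for x
    by (simp add: Nmat_mult gtrace_def KN_def Pplus_simps Pminus_simps mm.sum_right mm.add_right sum.distrib)
  then have "(1/2) *\<^sub>R Qmat p q x + (\<Sum>n\<le>N. Nmat p f g n x ** coeff_matrices z n)
      = - (Bmat ** ((1/2) *\<^sub>R BQ p q x - gtrace (KN N (coeff_matrices z)) x))" for x
    by (simp add: mm.diff_right mm.scaleR_right BQ_def)
  then have n: "norm ((1/2) *\<^sub>R Qmat p q x + (\<Sum>n\<le>N. Nmat p f g n x ** coeff_matrices z n))
      = norm ((1/2) *\<^sub>R BQ p q x - gtrace (KN N (coeff_matrices z)) x)" for x
    by simp
  show ?thesis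
    using L2norm_cong[OF n, of 0 b] by (simp add: lsq_objective_def z coeff_matrices_def)
qed

lemma coeff_matrices_surj: "\<exists>z. coeff_matrices z = C"
  by (rule exI[of _ "(\<lambda>n. C n $ 1 $ 1, \<lambda>n. C n $ 1 $ 2, \<lambda>n. C n $ 2 $ 1, \<lambda>n. C n $ 2 $ 2)"])
    (auto simp: coeff_matrices_def intro!: cmat2_eqI)

text \<open>Every coefficient family competes in the minimization, so the minimizer is at least as
  good as any approximant.\<close>

lemma arg_min_residual_le:
  assumes min: "is_arg_min (lsq_objective b p q f g N) (\<lambda>_. True) z"
    and approx: "approximable N (\<lambda>x. (1/2) *\<^sub>R BQ p q x) e"
  shows "L2norm 0 b (\<lambda>x. (1/2) *\<^sub>R BQ p q x - gtrace (KN N (coeff_matrices z)) x) \<le> e"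
proof -
  obtain C where C: "L2norm 0 b (\<lambda>x. (1/2) *\<^sub>R BQ p q x - gtrace (KN N C) x) \<le> e"
    using approx unfolding approximable_def by blast
  obtain z' where z': "coeff_matrices z' = C" using coeff_matrices_surj by blast
  have "lsq_objective b p q f g N z \<le> lsq_objective b p q f g N z'"
    using min unfolding is_arg_min_def not_less[symmetric] by blast
  then have "L2norm 0 b (\<lambda>x. (1/2) *\<^sub>R BQ p q x - gtrace (KN N (coeff_matrices z)) x)
      \<le> L2norm 0 b (\<lambda>x. (1/2) *\<^sub>R BQ p q x - gtrace (KN N C) x)"
    unfolding lsq_objective_eq z' by (rule power2_le_imp_le) (rule L2norm_nonneg)
  with C show ?thesis by linarith
qed

end

theorem theorem6p5:
  fixes b :: real and r :: nat
    and p q f g :: "real \<Rightarrow> complex"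
    and K :: "real \<Rightarrow> real \<Rightarrow> complex ^ 2 ^ 2"
    and a \<beta> c d :: "nat \<Rightarrow> nat \<Rightarrow> complex"
  assumes "b > 0"
    and "C_class_on r {0..b} (Qmat p q)"
    and "nonvanishing_solution b p q f g"
    and "transmutation_kernel b p q K"
    and "\<And>N. N > r \<Longrightarrow>
           is_arg_min (lsq_objective b p q f g N) (\<lambda>_. True) (a N, \<beta> N, c N, d N)"
  shows "\<exists>C::real. \<forall>x\<in>{0..b}. \<forall>N>r.
           L2norm (- x) x (\<lambda>t. K x t - approx_kernel p f g N (a N, \<beta> N, c N, d N) x t)
             < 2 * C / real N ^ r"
proof -
  interpret dirac b p q f g
    using assms(1-3) by unfold_locales (auto intro: C_class_on_imp_continuous_on)
  have BQr: "C_class_on r {0..b} (BQ p q)"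
    unfolding BQ_def[abs_def]
    by (rule C_class_on_bounded_linear[OF mm.bounded_linear_right assms(2)])
  from approximable_C_class[OF BQr C_class_on_bounded_linear[OF bounded_linear_scaleR_right BQr, of "1/2"]]
  obtain c0 where c0: "c0 > 0"
    "\<And>N. N > r \<Longrightarrow> approximable N (\<lambda>x. (1/2) *\<^sub>R BQ p q x) (c0 / of_nat N ^ r)" by blast
  define k where "k = 4 + 2 * b * CV"
  have k: "k > 0" using b_pos CV_pos by (simp add: k_def add_pos_pos)
  have "L2norm (- x) x (\<lambda>t. K x t - approx_kernel p f g N (a N, \<beta> N, c N, d N) x t)
      < 2 * (k * c0) / real N ^ r" if x: "x \<in> {0..b}" and N: "N > r" for x N
  proof -
    have "L2norm (- x) x (\<lambda>t. K x t - approx_kernel p f g N (a N, \<beta> N, c N, d N) x t)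
        \<le> k * L2norm 0 b (\<lambda>s. (1/2) *\<^sub>R BQ p q s - gtrace (KN N (coeff_matrices (a N, \<beta> N, c N, d N))) s)"
      unfolding approx_kernel_eq k_def by (rule kernel_difference[OF assms(4) x])
    also have "\<dots> \<le> k * (c0 / real N ^ r)"
      using k by (intro mult_left_mono arg_min_residual_le assms(5) c0(2) N) auto
    \<comment> \<open>Strictness comes from the factor 2, as \<open>k * c0\<close> is
      positive.\<close>
    also have "\<dots> < 2 * (k * c0) / real N ^ r"
    proof -
      have "0 < k * c0 / real N ^ r" using k c0(1) N by simp
      moreover have "z < 2 * z" if "0 < z" for z :: real using that by simp
      ultimately have "k * c0 / real N ^ r < 2 * (k * c0 / real N ^ r)" by blast
      then show ?thesis by simp
    qed
    finally show ?thesis .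
  qed
  then show ?thesis by blast
qed

end
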